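(* Let $I\subseteq\Delta$ with associated standard parabolic subalgebra $\mathfrak p=\mathfrak l\oplus\mathfrak u$, and suppose $V$ and $V'$ are simple modules in the category $\mathcal O^{\mathfrak p}$. Then $V\cong V'$ as $\mathfrak g$-modules if and only if $H_D(V)\cong H_D(V')$ as $\mathfrak l$-modules.
   Context: Let $\mathfrak g$ be a finite-dimensional complex semisimple Lie algebra with Cartan subalgebra $\mathfrak h$, root system $\Phi$, root spaces $\mathfrak g_\alpha$, a fixed set of positive roots $\Phi^+$ with simple roots $\Delta$, and Killing form $B$. For $I\subseteq\Delta$: $\Phi_I=\Phi\cap\mathbb ZI$, $\Phi_I^+=\Phi_I\cap\Phi^+$, $\mathfrak l=\mathfrak h\oplus\bigoplus_{\alpha\in\Phi_I}\mathfrak g_\alpha$, $\mathfrak u=\bigoplus_{\alpha\in\Phi^+\setminus\Phi_I^+}\mathfrak g_\alpha$, $\overline{\mathfrak u}=\bigoplus_{\alpha\in\Phi^+\setminus\Phi_I^+}\mathfrak g_{-\alpha}$, $\mathfrak p=\mathfrak l\oplus\mathfrak u$. $\mathcal O^{\mathfrak p}$ is the category of finitely generated $U(\mathfrak g)$-modules that are direct sums of finite-dimensional simple $U(\mathfrak l)$-modules and are locally finite over $U(\mathfrak p)$. Dirac cohomology: let $\mathfrak s=\mathfrak u\oplus\overline{\mathfrak u}$, so $\mathfrak g=\mathfrak l\oplus\mathfrak s$ is $B$-orthogonal, and let $C(\mathfrak s)$ be the Clifford algebra with $uu'+u'u=-2B(u,u')$. Let $Z_1,\dots,Z_m$ be an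 orthonormal basis of $\mathfrak s$ for $B|_{\mathfrak s}$. The cubic Dirac operator is $D=\sum_iZ_i\otimes Z_i+1\otimes v\in U(\mathfrak g)\otimes C(\mathfrak s)$, where $v=\frac12\sum_{i<j<k}B([Z_i,Z_j],Z_k)Z_iZ_jZ_k$ (the image in $C(\mathfrak s)$, under the Chevalley map, of the 3-form $\omega(X,Y,Z)=\frac12B(X,[Y,Z])$). Let $\mathcal S$ be a (fixed) spin module of $C(\mathfrak s)$. For a $\mathfrak g$-module $V$, $D$ acts on $V\otimes\mathcal S$, and $X\in\mathfrak l$ acts on $V\otimes\mathcal S$ by $X\otimes1+1\otimes\alpha(X)$, with $\alpha(X)=\frac12\sum_{i<j}B(X,[Z_i,Z_j])Z_iZ_j$. The Dirac cohomology is the $\mathfrak l$-module $H_D(V)=\ker D/(\ker D\cap\mathrm{Im}\,D)$. *)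

theory Defs
  imports Complex_Main "HOL-Library.Poly_Mapping" "HOL-Library.Set_Algebras"
begin

section \<open>Complex vector spaces\<close>

class complex_vector = ab_group_add +
  fixes scaleC :: "complex \<Rightarrow> 'a \<Rightarrow> 'a"  (infixr \<open>*\<^sub>C\<close> 75)
  assumes scaleC_add_right: "c *\<^sub>C (x + y) = c *\<^sub>C x + c *\<^sub>C y"
    and scaleC_add_left: "(c + d) *\<^sub>C x = c *\<^sub>C x + d *\<^sub>C x"
    and scaleC_scaleC: "c *\<^sub>C d *\<^sub>C x = (c * d) *\<^sub>C x"
    and scaleC_one: "1 *\<^sub>C x = x"

global_interpretation complex_vector: vector_space "scaleC :: complex \<Rightarrow> 'a \<Rightarrow> 'a::complex_vector"
  defines csubspace = complex_vector.subspace
    and cspan = complex_vector.span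
    and cdependent = complex_vector.dependent
    and crepresentation = complex_vector.representation
  by unfold_locales (simp_all add: scaleC_add_right scaleC_add_left scaleC_scaleC scaleC_one)

abbreviation clinear :: "('a::complex_vector \<Rightarrow> 'b::complex_vector) \<Rightarrow> bool"
  where "clinear \<equiv> Vector_Spaces.linear scaleC scaleC"

definition cfinite_dim :: "'a::complex_vector set \<Rightarrow> bool"
  where "cfinite_dim W \<longleftrightarrow> (\<exists>F. finite F \<and> W = cspan F)"

text \<open>Trace of an endomorphism of a finite-dimensional space, computed in an arbitrary basis.\<close>

definition ctrace :: "('a::complex_vector \<Rightarrow> 'a) \<Rightarrow> complex"
  where "ctrace f =
    (let E = (SOME E. \<not> cdependent E \<and> cspan E = UNIV) in \<Sum>e\<in>E. crepresentation E (f e) e)"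

section \<open>Tensor products\<close>

text \<open>
  The tensor product of two spaces is the free vector space on the set of pairs modulo the
  subspace spanned by the bilinearity relations.
\<close>

inductive_set tensor_relations :: "(('a::complex_vector \<times> 'b::complex_vector) \<Rightarrow>\<^sub>0 complex) set"
  where
    add_left: "Poly_Mapping.single (x + x', y) 1 - Poly_Mapping.single (x, y) 1
        - Poly_Mapping.single (x', y) 1 \<in> tensor_relations"
  | add_right: "Poly_Mapping.single (x, y + y') 1 - Poly_Mapping.single (x, y) 1
        - Poly_Mapping.single (x, y') 1 \<in> tensor_relations"
  | scale_left: "Poly_Mapping.single (c *\<^sub>C x, y) 1 - Poly_Mapping.single (x, y) c
        \<in> tensor_relations"
  | scale_right: "Poly_Mapping.single (x, c *\<^sub>C y) 1 - Poly_Mapping.single (x, y) c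
        \<in> tensor_relations"
  | zero: "0 \<in> tensor_relations"
  | add: "p \<in> tensor_relations \<Longrightarrow> q \<in> tensor_relations \<Longrightarrow> p + q \<in> tensor_relations"
  | scale: "p \<in> tensor_relations \<Longrightarrow> Poly_Mapping.map ((*) c) p \<in> tensor_relations"

lemma lookup_map_mult:
  "Poly_Mapping.lookup (Poly_Mapping.map ((*) c) p) k = c * Poly_Mapping.lookup p k"
  for c :: complex
  by (simp add: map.rep_eq when_def)

lemma tensor_relations_uminus:
  assumes "p \<in> tensor_relations" shows "- p \<in> tensor_relations"
proof -
  have "- p = Poly_Mapping.map ((*) (- 1)) p"
    by (rule poly_mapping_eqI) (simp add: lookup_map_mult)
  then show ?thesis using tensor_relations.scale[OF assms, of "- 1"] by simp
qed

definition tensor_eq ::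
    "(('a::complex_vector \<times> 'b::complex_vector) \<Rightarrow>\<^sub>0 complex) \<Rightarrow> (('a \<times> 'b) \<Rightarrow>\<^sub>0 complex) \<Rightarrow> bool"
  where "tensor_eq p q \<longleftrightarrow> p - q \<in> tensor_relations"

lemma equivp_tensor_eq: "equivp tensor_eq"
proof (rule equivpI)
  show "reflp tensor_eq"
    by (auto simp: reflp_def tensor_eq_def intro: tensor_relations.zero)
  show "symp tensor_eq"
    using tensor_relations_uminus by (fastforce simp: symp_def tensor_eq_def)
  show "transp tensor_eq"
    using tensor_relations.add by (fastforce simp: transp_def tensor_eq_def)
qed

quotient_type (overloaded) ('a, 'b) tensor =
  "('a::complex_vector \<times> 'b::complex_vector) \<Rightarrow>\<^sub>0 complex" / tensor_eq
  by (rule equivp_tensor_eq)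

instantiation tensor :: (complex_vector, complex_vector) complex_vector
begin

lift_definition zero_tensor :: "('a, 'b) tensor" is 0 .

lift_definition plus_tensor :: "('a, 'b) tensor \<Rightarrow> ('a, 'b) tensor \<Rightarrow> ('a, 'b) tensor" is "(+)"
  unfolding tensor_eq_def add_diff_add by (rule tensor_relations.add)

lift_definition uminus_tensor :: "('a, 'b) tensor \<Rightarrow> ('a, 'b) tensor" is uminus
  unfolding tensor_eq_def minus_diff_minus by (rule tensor_relations_uminus)

lift_definition minus_tensor :: "('a, 'b) tensor \<Rightarrow> ('a, 'b) tensor \<Rightarrow> ('a, 'b) tensor" is "(-)"
proof -
  fix p p' q q' :: "('a \<times> 'b) \<Rightarrow>\<^sub>0 complex"
  assume "tensor_eq p p'" "tensor_eq q q'"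
  then have "(p - p') + - (q - q') \<in> tensor_relations"
    unfolding tensor_eq_def by (intro tensor_relations.add tensor_relations_uminus)
  moreover have "(p - p') + - (q - q') = (p - q) - (p' - q')" by simp
  ultimately show "tensor_eq (p - q) (p' - q')" unfolding tensor_eq_def by metis
qed

lift_definition scaleC_tensor :: "complex \<Rightarrow> ('a, 'b) tensor \<Rightarrow> ('a, 'b) tensor"
  is "\<lambda>c. Poly_Mapping.map ((*) c)"
proof -
  fix c and p q :: "('a \<times> 'b) \<Rightarrow>\<^sub>0 complex"
  assume "tensor_eq p q"
  then have "Poly_Mapping.map ((*) c) (p - q) \<in> tensor_relations"
    unfolding tensor_eq_def by (rule tensor_relations.scale)
  moreover have "Poly_Mapping.map ((*) c) (p - q) =
      Poly_Mapping.map ((*) c) p - Poly_Mapping.map ((*) c) q"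
    by (rule poly_mapping_eqI) (simp add: lookup_map_mult lookup_minus algebra_simps)
  ultimately show "tensor_eq (Poly_Mapping.map ((*) c) p) (Poly_Mapping.map ((*) c) q)"
    unfolding tensor_eq_def by simp
qed

lemma tensor_eqI: "p = q \<Longrightarrow> tensor_eq p q"
  by (simp add: tensor_eq_def tensor_relations.zero)

instance
proof
  fix a b c :: "('a, 'b) tensor" and s t :: complex
  show "a + b + c = a + (b + c)" by transfer (simp add: tensor_eqI add.assoc)
  show "a + b = b + a" by transfer (simp add: tensor_eqI add.commute)
  show "0 + a = a" by transfer (simp add: tensor_eqI)
  show "- a + a = 0" by transfer (simp add: tensor_eqI)
  show "a - b = a + - b" by transfer (simp add: tensor_eqI)
  show "s *\<^sub>C (a + b) = s *\<^sub>C a + s *\<^sub>C b"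
    by transfer (rule tensor_eqI, rule poly_mapping_eqI,
        simp add: lookup_map_mult lookup_add algebra_simps)
  show "(s + t) *\<^sub>C a = s *\<^sub>C a + t *\<^sub>C a"
    by transfer (rule tensor_eqI, rule poly_mapping_eqI,
        simp add: lookup_map_mult lookup_add algebra_simps)
  show "s *\<^sub>C t *\<^sub>C a = (s * t) *\<^sub>C a"
    by transfer (rule tensor_eqI, rule poly_mapping_eqI,
        simp add: lookup_map_mult algebra_simps)
  show "1 *\<^sub>C a = a"
    by transfer (rule tensor_eqI, rule poly_mapping_eqI, simp add: lookup_map_mult)
qed

end

lift_definition tensor_pure :: "'a::complex_vector \<Rightarrow> 'b::complex_vector \<Rightarrow> ('a, 'b) tensor"
    (infixr \<open>\<otimes>\<^sub>C\<close> 76)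
  is "\<lambda>x y. Poly_Mapping.single (x, y) 1" .


lemma tensor_pure_add_left: "(x + x') \<otimes>\<^sub>C y = x \<otimes>\<^sub>C y + x' \<otimes>\<^sub>C y"
  by transfer (unfold tensor_eq_def diff_diff_add[symmetric], rule tensor_relations.add_left)

lemma tensor_pure_add_right: "x \<otimes>\<^sub>C (y + y') = x \<otimes>\<^sub>C y + x \<otimes>\<^sub>C y'"
  by transfer (unfold tensor_eq_def diff_diff_add[symmetric], rule tensor_relations.add_right)

lemma map_mult_single:
  "Poly_Mapping.map ((*) c) (Poly_Mapping.single k d) = Poly_Mapping.single k (c * d)"
  for c :: complex
  by (rule poly_mapping_eqI) (simp add: lookup_map_mult lookup_single when_def)

lemma tensor_pure_scale_left: "(c *\<^sub>C x) \<otimes>\<^sub>C y = c *\<^sub>C (x \<otimes>\<^sub>C y)"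
  by transfer (unfold tensor_eq_def map_mult_single mult_1_right, rule tensor_relations.scale_left)

lemma tensor_pure_scale_right: "x \<otimes>\<^sub>C (c *\<^sub>C y) = c *\<^sub>C (x \<otimes>\<^sub>C y)"
  by transfer (unfold tensor_eq_def map_mult_single mult_1_right, rule tensor_relations.scale_right)

lemma tensor_induct [case_names zero pure]:
  fixes t :: "('a::complex_vector, 'b::complex_vector) tensor"
  assumes "P 0" and step: "\<And>c x y t. P t \<Longrightarrow> P (c *\<^sub>C (x \<otimes>\<^sub>C y) + t)"
  shows "P t"
proof -
  have "P (abs_tensor p)" for p
  proof (induction p rule: update_induct)
    case const
    then show ?case using assms(1) by (simp add: zero_tensor.abs_eq)
  next
    case (update p k c)
    have "Poly_Mapping.update k c p = Poly_Mapping.map ((*) c) (Poly_Mapping.single k 1) + p"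
      using update.hyps
      by (intro poly_mapping_eqI)
        (auto simp: map_mult_single lookup_add lookup_single lookup_update when_def in_keys_iff)
    then have "abs_tensor (Poly_Mapping.update k c p) = c *\<^sub>C (fst k \<otimes>\<^sub>C snd k) + abs_tensor p"
      by (simp add: plus_tensor.abs_eq scaleC_tensor.abs_eq tensor_pure_def)
    then show ?case using step[OF update.IH] by simp
  qed
  then show ?thesis by (metis Quotient_abs_rep Quotient_tensor)
qed

lemma clinearI:
  assumes "\<And>x y. f (x + y) = f x + f y" "\<And>c x. f (c *\<^sub>C x) = c *\<^sub>C f x"
  shows "clinear f"
  using assms by unfold_locales

lemma clinear_add: "clinear f \<Longrightarrow> f (x + y) = f x + f y"
  by (rule module_hom.add) (rule Vector_Spaces.linear.axioms)

lemma clinear_scale: "clinear f \<Longrightarrow> f (c *\<^sub>C x) = c *\<^sub>C f x"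
  by (rule module_hom.scale) (rule Vector_Spaces.linear.axioms)

lemma clinear_0: "clinear f \<Longrightarrow> f 0 = 0"
  using clinear_scale[of f 0 0] by simp

lemma tensor_clinear_eqI:
  assumes "clinear h" "clinear k" "\<And>x y. h (x \<otimes>\<^sub>C y) = k (x \<otimes>\<^sub>C y)"
  shows "h = k"
proof
  fix t show "h t = k t"
    by (induction t rule: tensor_induct)
      (simp_all add: assms clinear_0 clinear_add clinear_scale)
qed

lemma tensor_universal:
  fixes b :: "'a::complex_vector \<Rightarrow> 'b::complex_vector \<Rightarrow> 'c::complex_vector"
  assumes lin1: "\<And>y. clinear (\<lambda>x. b x y)" and lin2: "\<And>x. clinear (b x)"
  shows "\<exists>!h. clinear h \<and> (\<forall>x y. h (x \<otimes>\<^sub>C y) = b x y)"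
proof -
  define F where "F p = (\<Sum>k\<in>Poly_Mapping.keys p. Poly_Mapping.lookup p k *\<^sub>C b (fst k) (snd k))"
    for p :: "('a \<times> 'b) \<Rightarrow>\<^sub>0 complex"
  have F_add: "F (p + q) = F p + F q" for p q
    unfolding F_def
    by (rule setsum_keys_plus_distrib[where f = "\<lambda>k z. z *\<^sub>C b (fst k) (snd k)"])
      (simp_all add: scaleC_add_left)
  have F_scale: "F (Poly_Mapping.map ((*) c) p) = c *\<^sub>C F p" for c p
  proof -
    have "F (Poly_Mapping.map ((*) c) p) =
      (\<Sum>k\<in>Poly_Mapping.keys p. Poly_Mapping.lookup (Poly_Mapping.map ((*) c) p) k *\<^sub>C b (fst k) (snd k))"
      unfolding F_def
      by (rule sum.mono_neutral_left) (auto simp: in_keys_iff lookup_map_mult)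
    then show ?thesis
      by (simp add: F_def lookup_map_mult complex_vector.scale_sum_right scaleC_scaleC)
  qed
  have F_single: "F (Poly_Mapping.single k z) = z *\<^sub>C b (fst k) (snd k)" for k z
    by (simp add: F_def)
  have F_0: "F 0 = 0" by (simp add: F_def)
  have F_diff: "F (p - q) = F p - F q" for p q
    using F_add[of "p - q" q] by (simp add: algebra_simps)
  have F_rel: "F p = 0" if "p \<in> tensor_relations" for p
    using that
  proof induction
    case (add_left x x' y)
    then show ?case using clinear_add[OF lin1] by (simp add: F_diff F_single scaleC_one)
  next
    case (add_right x y y')
    then show ?case using clinear_add[OF lin2] by (simp add: F_diff F_single scaleC_one)
  next
    case (scale_left c x y)
    then show ?case using clinear_scale[OF lin1] by (simp add: F_diff F_single scaleC_one)
  next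
    case (scale_right x c y)
    then show ?case using clinear_scale[OF lin2] by (simp add: F_diff F_single scaleC_one)
  qed (simp_all add: F_0 F_add F_scale)
  define h where "h t = F (rep_tensor t)" for t
  have h_abs: "h (abs_tensor p) = F p" for p
  proof -
    have "tensor_eq (rep_tensor (abs_tensor p)) p"
      by (simp add: Quotient3_tensor rep_abs_rsp_left equivp_reflp[OF equivp_tensor_eq])
    then have "F (rep_tensor (abs_tensor p) - p) = 0"
      using F_rel unfolding tensor_eq_def by blast
    then show ?thesis by (simp add: h_def F_diff)
  qed
  have abs_rep: "\<exists>p. t = abs_tensor p" for t :: "('a, 'b) tensor"
    by (metis Quotient_abs_rep Quotient_tensor)
  have "clinear h"
  proof (rule clinearI)
    fix s t :: "('a, 'b) tensor" and c
    obtain p q where pq: "s = abs_tensor p" "t = abs_tensor q" using abs_rep by metis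
    show "h (s + t) = h s + h t" by (simp add: pq plus_tensor.abs_eq h_abs F_add)
    show "h (c *\<^sub>C t) = c *\<^sub>C h t" by (simp add: pq scaleC_tensor.abs_eq h_abs F_scale)
  qed
  moreover have "h (x \<otimes>\<^sub>C y) = b x y" for x y
    by (simp add: tensor_pure_def h_abs F_single scaleC_one)
  ultimately show ?thesis
    by (intro ex1I[of _ h] conjI allI) (auto intro: tensor_clinear_eqI)
qed

text \<open>For linear \<open>f\<close> and \<open>g\<close> this is the operator \<open>f \<otimes> g\<close>.\<close>

definition tensor_map :: "('a::complex_vector \<Rightarrow> 'c::complex_vector) \<Rightarrow>
    ('b::complex_vector \<Rightarrow> 'd::complex_vector) \<Rightarrow> ('a, 'b) tensor \<Rightarrow> ('c, 'd) tensor"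
  where "tensor_map f g = (THE h. clinear h \<and> (\<forall>x y. h (x \<otimes>\<^sub>C y) = f x \<otimes>\<^sub>C g y))"

lemma tensor_map:
  assumes "clinear f" "clinear g"
  shows clinear_tensor_map: "clinear (tensor_map f g)"
    and tensor_map_pure: "tensor_map f g (x \<otimes>\<^sub>C y) = f x \<otimes>\<^sub>C g y"
proof -
  have "\<exists>!h. clinear h \<and> (\<forall>x y. h (x \<otimes>\<^sub>C y) = f x \<otimes>\<^sub>C g y)"
    by (rule tensor_universal; rule clinearI)
      (simp_all add: clinear_add[OF assms(1)] clinear_add[OF assms(2)]
        clinear_scale[OF assms(1)] clinear_scale[OF assms(2)] tensor_pure_add_left
        tensor_pure_add_right tensor_pure_scale_left tensor_pure_scale_right)
  then have "clinear (tensor_map f g) \<and> (\<forall>x y. tensor_map f g (x \<otimes>\<^sub>C y) = f x \<otimes>\<^sub>C g y)"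
    unfolding tensor_map_def by (rule theI')
  then show "clinear (tensor_map f g)" "tensor_map f g (x \<otimes>\<^sub>C y) = f x \<otimes>\<^sub>C g y" by auto
qed

section \<open>Lie algebras\<close>

class lie_algebra = complex_vector +
  fixes bracket :: "'a \<Rightarrow> 'a \<Rightarrow> 'a"
  assumes bracket_add_left: "bracket (x + y) z = bracket x z + bracket y z"
    and bracket_add_right: "bracket x (y + z) = bracket x y + bracket x z"
    and bracket_scale_left: "bracket (c *\<^sub>C x) y = c *\<^sub>C bracket x y"
    and bracket_scale_right: "bracket x (c *\<^sub>C y) = c *\<^sub>C bracket x y"
    and bracket_self: "bracket x x = 0"
    and jacobi: "bracket x (bracket y z) + bracket y (bracket z x) + bracket z (bracket x y) = 0"

definition bracket_span :: "'g::lie_algebra set \<Rightarrow> 'g set \<Rightarrow> 'g set"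
  where "bracket_span A B = cspan {bracket x y | x y. x \<in> A \<and> y \<in> B}"

fun derived_series :: "'g::lie_algebra set \<Rightarrow> nat \<Rightarrow> 'g set"
  where
    "derived_series A 0 = A"
  | "derived_series A (Suc n) = bracket_span (derived_series A n) (derived_series A n)"

fun lower_central_series :: "'g::lie_algebra set \<Rightarrow> nat \<Rightarrow> 'g set"
  where
    "lower_central_series A 0 = A"
  | "lower_central_series A (Suc n) = bracket_span A (lower_central_series A n)"

definition lie_subalgebra :: "'g::lie_algebra set \<Rightarrow> bool"
  where "lie_subalgebra A \<longleftrightarrow> csubspace A \<and> (\<forall>x\<in>A. \<forall>y\<in>A. bracket x y \<in> A)"

definition lie_ideal :: "'g::lie_algebra set \<Rightarrow> bool"
  where "lie_ideal J \<longleftrightarrow> csubspace J \<and> (\<forall>x. \<forall>y\<in>J. bracket x y \<in> J)"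

definition solvable :: "'g::lie_algebra set \<Rightarrow> bool"
  where "solvable A \<longleftrightarrow> (\<exists>n. derived_series A n = {0})"

definition nilpotent :: "'g::lie_algebra set \<Rightarrow> bool"
  where "nilpotent A \<longleftrightarrow> (\<exists>n. lower_central_series A n = {0})"

definition semisimple :: "'g::lie_algebra itself \<Rightarrow> bool"
  where "semisimple _ \<longleftrightarrow> (\<forall>J::'g set. lie_ideal J \<and> solvable J \<longrightarrow> J = {0})"

definition cartan_subalgebra :: "'g::lie_algebra set \<Rightarrow> bool"
  where "cartan_subalgebra H \<longleftrightarrow>
    lie_subalgebra H \<and> nilpotent H \<and> {x. \<forall>y\<in>H. bracket x y \<in> H} = H"

definition killing :: "'g::lie_algebra \<Rightarrow> 'g \<Rightarrow> complex"
  where "killing x y = ctrace (\<lambda>z. bracket x (bracket y z))"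

section \<open>Roots and standard parabolic subalgebras\<close>

text \<open>
  A linear functional on \<open>H\<close> is represented by the function on the whole Lie algebra that
  extends it by zero outside \<open>H\<close>, so that functionals are equal iff they agree on \<open>H\<close>.
\<close>

definition dual_space :: "'g::lie_algebra set \<Rightarrow> ('g \<Rightarrow> complex) set"
  where "dual_space H = {\<alpha>. (\<forall>x\<in>H. \<forall>y\<in>H. \<alpha> (x + y) = \<alpha> x + \<alpha> y) \<and>
    (\<forall>c. \<forall>x\<in>H. \<alpha> (c *\<^sub>C x) = c * \<alpha> x) \<and> (\<forall>x. x \<notin> H \<longrightarrow> \<alpha> x = 0)}"

definition root_space :: "'g::lie_algebra set \<Rightarrow> ('g \<Rightarrow> complex) \<Rightarrow> 'g set"
  where "root_space H \<alpha> = {x. \<forall>t\<in>H. bracket t x = \<alpha> t *\<^sub>C x}"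

definition roots :: "'g::lie_algebra set \<Rightarrow> ('g \<Rightarrow> complex) set"
  where "roots H = {\<alpha> \<in> dual_space H. \<alpha> \<noteq> (\<lambda>_. 0) \<and> root_space H \<alpha> \<noteq> {0}}"

definition simple_system :: "'g::lie_algebra set \<Rightarrow> ('g \<Rightarrow> complex) set \<Rightarrow> bool"
  where "simple_system H \<Delta> \<longleftrightarrow> finite \<Delta> \<and> \<Delta> \<subseteq> roots H \<and>
    (\<forall>r :: ('g \<Rightarrow> complex) \<Rightarrow> real.
      (\<forall>t. (\<Sum>\<alpha>\<in>\<Delta>. of_real (r \<alpha>) * \<alpha> t) = 0) \<longrightarrow> (\<forall>\<alpha>\<in>\<Delta>. r \<alpha> = 0)) \<and>
    (\<forall>\<beta>\<in>roots H. \<exists>k :: ('g \<Rightarrow> complex) \<Rightarrow> int.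
      \<beta> = (\<lambda>t. \<Sum>\<alpha>\<in>\<Delta>. of_int (k \<alpha>) * \<alpha> t) \<and>
      ((\<forall>\<alpha>\<in>\<Delta>. k \<alpha> \<ge> 0) \<or> (\<forall>\<alpha>\<in>\<Delta>. k \<alpha> \<le> 0)))"

definition positive_roots :: "'g::lie_algebra set \<Rightarrow> ('g \<Rightarrow> complex) set \<Rightarrow> ('g \<Rightarrow> complex) set"
  where "positive_roots H \<Delta> = {\<beta> \<in> roots H. \<exists>k :: ('g \<Rightarrow> complex) \<Rightarrow> nat.
    \<beta> = (\<lambda>t. \<Sum>\<alpha>\<in>\<Delta>. of_nat (k \<alpha>) * \<alpha> t)}"

definition levi_roots :: "'g::lie_algebra set \<Rightarrow> ('g \<Rightarrow> complex) set \<Rightarrow> ('g \<Rightarrow> complex) set"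
  where "levi_roots H I = {\<beta> \<in> roots H. \<exists>k :: ('g \<Rightarrow> complex) \<Rightarrow> int.
    \<beta> = (\<lambda>t. \<Sum>\<alpha>\<in>I. of_int (k \<alpha>) * \<alpha> t)}"

definition levi :: "'g::lie_algebra set \<Rightarrow> ('g \<Rightarrow> complex) set \<Rightarrow> 'g set"
  where "levi H I = cspan (H \<union> (\<Union>\<alpha>\<in>levi_roots H I. root_space H \<alpha>))"

definition nilradical :: "'g::lie_algebra set \<Rightarrow> ('g \<Rightarrow> complex) set \<Rightarrow> ('g \<Rightarrow> complex) set \<Rightarrow> 'g set"
  where "nilradical H \<Delta> I =
    cspan (\<Union>\<alpha>\<in>positive_roots H \<Delta> - levi_roots H I. root_space H \<alpha>)"

definition opposite_nilradical ::
    "'g::lie_algebra set \<Rightarrow> ('g \<Rightarrow> complex) set \<Rightarrow> ('g \<Rightarrow> complex) set \<Rightarrow> 'g set"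
  where "opposite_nilradical H \<Delta> I =
    cspan (\<Union>\<alpha>\<in>positive_roots H \<Delta> - levi_roots H I. root_space H (\<lambda>t. - \<alpha> t))"

definition parabolic :: "'g::lie_algebra set \<Rightarrow> ('g \<Rightarrow> complex) set \<Rightarrow> ('g \<Rightarrow> complex) set \<Rightarrow> 'g set"
  where "parabolic H \<Delta> I = levi H I + nilradical H \<Delta> I"

text \<open>The space \<open>\<ss> = \<uu> \<oplus> \<uu>\<^sup>-\<close>.\<close>

definition levi_complement ::
    "'g::lie_algebra set \<Rightarrow> ('g \<Rightarrow> complex) set \<Rightarrow> ('g \<Rightarrow> complex) set \<Rightarrow> 'g set"
  where "levi_complement H \<Delta> I = nilradical H \<Delta> I + opposite_nilradical H \<Delta> I"

section \<open>Modules and the parabolic category O\<close>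

text \<open>
  A module over the enveloping algebra of a Lie algebra is the same as a module over the Lie
  algebra. For a subalgebra \<open>A\<close>, the \<open>U(A)\<close>-submodules of \<open>V\<close> are the subspaces stable under
  \<open>A\<close>, and the \<open>U(A)\<close>-submodule generated by \<open>F\<close> is the least such subspace containing \<open>F\<close>.
\<close>

definition lie_module :: "('g::lie_algebra \<Rightarrow> 'v::complex_vector \<Rightarrow> 'v) \<Rightarrow> bool"
  where "lie_module \<rho> \<longleftrightarrow> (\<forall>X. clinear (\<rho> X)) \<and> (\<forall>v. clinear (\<lambda>X. \<rho> X v)) \<and>
    (\<forall>X Y v. \<rho> (bracket X Y) v = \<rho> X (\<rho> Y v) - \<rho> Y (\<rho> X v))"

definition submodule ::
    "'g::lie_algebra set \<Rightarrow> ('g \<Rightarrow> 'v::complex_vector \<Rightarrow> 'v) \<Rightarrow> 'v set \<Rightarrow> bool"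
  where "submodule A \<rho> W \<longleftrightarrow> csubspace W \<and> (\<forall>X\<in>A. \<forall>w\<in>W. \<rho> X w \<in> W)"

definition simple_submodule ::
    "'g::lie_algebra set \<Rightarrow> ('g \<Rightarrow> 'v::complex_vector \<Rightarrow> 'v) \<Rightarrow> 'v set \<Rightarrow> bool"
  where "simple_submodule A \<rho> W \<longleftrightarrow> submodule A \<rho> W \<and> W \<noteq> {0} \<and>
    (\<forall>W'. submodule A \<rho> W' \<and> W' \<subseteq> W \<longrightarrow> W' = {0} \<or> W' = W)"

abbreviation simple_module :: "('g::lie_algebra \<Rightarrow> 'v::complex_vector \<Rightarrow> 'v) \<Rightarrow> bool"
  where "simple_module \<rho> \<equiv> simple_submodule UNIV \<rho> UNIV"

definition generated_submodule ::
    "'g::lie_algebra set \<Rightarrow> ('g \<Rightarrow> 'v::complex_vector \<Rightarrow> 'v) \<Rightarrow> 'v set \<Rightarrow> 'v set"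
  where "generated_submodule A \<rho> F = submodule A \<rho> hull F"

text \<open>The whole space is the (internal) direct sum of the subspaces in the family.\<close>

definition direct_sum :: "'v::complex_vector set set \<Rightarrow> bool"
  where "direct_sum \<W> \<longleftrightarrow> (\<forall>W\<in>\<W>. csubspace W) \<and> cspan (\<Union>\<W>) = UNIV \<and>
    (\<forall>\<F> w. finite \<F> \<and> \<F> \<subseteq> \<W> \<and> (\<forall>W\<in>\<F>. w W \<in> W) \<and> (\<Sum>W\<in>\<F>. w W) = 0
      \<longrightarrow> (\<forall>W\<in>\<F>. w W = 0))"

definition in_category_O ::
    "'g::lie_algebra set \<Rightarrow> ('g \<Rightarrow> complex) set \<Rightarrow> ('g \<Rightarrow> complex) set \<Rightarrow>
      ('g \<Rightarrow> 'v::complex_vector \<Rightarrow> 'v) \<Rightarrow> bool"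
  where "in_category_O H \<Delta> I \<rho> \<longleftrightarrow> lie_module \<rho> \<and>
    (\<exists>F. finite F \<and> generated_submodule UNIV \<rho> F = UNIV) \<and>
    (\<exists>\<W>. direct_sum \<W> \<and> (\<forall>W\<in>\<W>. cfinite_dim W \<and> simple_submodule (levi H I) \<rho> W)) \<and>
    (\<forall>v. cfinite_dim (generated_submodule (parabolic H \<Delta> I) \<rho> {v}))"

text \<open>
  Modules whose carrier need not be a whole type (quotients, in particular) are given by an
  explicit carrier and operations.
\<close>

record ('g, 'm) module_structure =
  mod_carrier :: "'m set"
  mod_add :: "'m \<Rightarrow> 'm \<Rightarrow> 'm"
  mod_scale :: "complex \<Rightarrow> 'm \<Rightarrow> 'm"
  mod_act :: "'g \<Rightarrow> 'm \<Rightarrow> 'm"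

definition module_iso ::
    "'g set \<Rightarrow> ('g, 'm) module_structure \<Rightarrow> ('g, 'n) module_structure \<Rightarrow> bool"
  where "module_iso A M N \<longleftrightarrow> (\<exists>f. bij_betw f (mod_carrier M) (mod_carrier N) \<and>
    (\<forall>x\<in>mod_carrier M. \<forall>y\<in>mod_carrier M. f (mod_add M x y) = mod_add N (f x) (f y)) \<and>
    (\<forall>c. \<forall>x\<in>mod_carrier M. f (mod_scale M c x) = mod_scale N c (f x)) \<and>
    (\<forall>X\<in>A. \<forall>x\<in>mod_carrier M. f (mod_act M X x) = mod_act N X (f x)))"

definition full_module :: "('g \<Rightarrow> 'v::complex_vector \<Rightarrow> 'v) \<Rightarrow> ('g, 'v) module_structure"
  where "full_module \<rho> =
    \<lparr>mod_carrier = UNIV, mod_add = (+), mod_scale = scaleC, mod_act = \<rho>\<rparr>"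

text \<open>
  The quotient \<open>K / N\<close>, as a set of cosets. Adding \<open>N\<close> in the last two operations turns the
  image of a coset, which is only contained in a coset, into that coset.
\<close>

definition quotient_module ::
    "('g \<Rightarrow> 'v::complex_vector \<Rightarrow> 'v) \<Rightarrow> 'v set \<Rightarrow> 'v set \<Rightarrow> ('g, 'v set) module_structure"
  where "quotient_module \<tau> K N =
    \<lparr>mod_carrier = (\<lambda>x. x +o N) ` K, mod_add = (+),
     mod_scale = (\<lambda>c C. scaleC c ` C + N), mod_act = (\<lambda>X C. \<tau> X ` C + N)\<rparr>"

section \<open>Dirac cohomology\<close>

definition orthonormal_basis :: "'g::lie_algebra set \<Rightarrow> nat \<Rightarrow> (nat \<Rightarrow> 'g) \<Rightarrow> bool"
  where "orthonormal_basis W m Z \<longleftrightarrow> cspan (Z ` {1..m}) = W \<and>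
    (\<forall>i\<in>{1..m}. \<forall>j\<in>{1..m}. killing (Z i) (Z j) = (if i = j then 1 else 0))"

text \<open>
  A module over the Clifford algebra of \<open>W\<close>, that is the algebra generated by the vector space
  \<open>W\<close> subject to \<open>u u' + u' u = -2 B(u, u')\<close>, amounts to a linear map \<open>\<gamma>\<close> from \<open>W\<close> to the
  endomorphisms of \<open>S\<close> satisfying these relations. Values of \<open>\<gamma>\<close> outside \<open>W\<close> are irrelevant.
\<close>

definition clifford_module ::
    "'g::lie_algebra set \<Rightarrow> ('g \<Rightarrow> 's::complex_vector \<Rightarrow> 's) \<Rightarrow> bool"
  where "clifford_module W \<gamma> \<longleftrightarrow> (\<forall>u\<in>W. clinear (\<gamma> u)) \<and>
    (\<forall>u\<in>W. \<forall>u'\<in>W. \<forall>s. \<gamma> (u + u') s = \<gamma> u s + \<gamma> u' s) \<and>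
    (\<forall>c. \<forall>u\<in>W. \<forall>s. \<gamma> (c *\<^sub>C u) s = c *\<^sub>C \<gamma> u s) \<and>
    (\<forall>u\<in>W. \<forall>u'\<in>W. \<forall>s. \<gamma> u (\<gamma> u' s) + \<gamma> u' (\<gamma> u s) = (- 2 * killing u u') *\<^sub>C s)"

text \<open>
  A spin module is a simple module over the Clifford algebra; for an even-dimensional
  nondegenerate \<open>W\<close> it is unique up to isomorphism.
\<close>

definition spin_module ::
    "'g::lie_algebra set \<Rightarrow> ('g \<Rightarrow> 's::complex_vector \<Rightarrow> 's) \<Rightarrow> bool"
  where "spin_module W \<gamma> \<longleftrightarrow> clifford_module W \<gamma> \<and> (UNIV :: 's set) \<noteq> {0} \<and>
    (\<forall>T. csubspace T \<and> (\<forall>u\<in>W. \<forall>s\<in>T. \<gamma> u s \<in> T) \<longrightarrow> T = {0} \<or> T = UNIV)"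

text \<open>
  The action on \<open>S\<close> of the elements
  \<open>v = 1/2 \<Sum>\<^bsub>i<j<k\<^esub> B([Z\<^sub>i, Z\<^sub>j], Z\<^sub>k) Z\<^sub>i Z\<^sub>j Z\<^sub>k\<close> and \<open>\<alpha>(X) = 1/2 \<Sum>\<^bsub>i<j\<^esub> B(X, [Z\<^sub>i, Z\<^sub>j]) Z\<^sub>i Z\<^sub>j\<close>
  of the Clifford algebra.
\<close>

definition cubic_term ::
    "nat \<Rightarrow> (nat \<Rightarrow> 'g::lie_algebra) \<Rightarrow> ('g \<Rightarrow> 's::complex_vector \<Rightarrow> 's) \<Rightarrow> 's \<Rightarrow> 's"
  where "cubic_term m Z \<gamma> s = (1/2) *\<^sub>C
    (\<Sum>(i, j, k) | 1 \<le> i \<and> i < j \<and> j < k \<and> k \<le> m.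
      killing (bracket (Z i) (Z j)) (Z k) *\<^sub>C \<gamma> (Z i) (\<gamma> (Z j) (\<gamma> (Z k) s)))"

definition spin_action ::
    "nat \<Rightarrow> (nat \<Rightarrow> 'g::lie_algebra) \<Rightarrow> ('g \<Rightarrow> 's::complex_vector \<Rightarrow> 's) \<Rightarrow> 'g \<Rightarrow> 's \<Rightarrow> 's"
  where "spin_action m Z \<gamma> X s = (1/2) *\<^sub>C
    (\<Sum>(i, j) | 1 \<le> i \<and> i < j \<and> j \<le> m.
      killing X (bracket (Z i) (Z j)) *\<^sub>C \<gamma> (Z i) (\<gamma> (Z j) s))"

text \<open>
  The operator by which \<open>D = \<Sum>\<^sub>i Z\<^sub>i \<otimes> Z\<^sub>i + 1 \<otimes> v\<close>, an element of \<open>U(\<gg>) \<otimes> C(\<ss>)\<close>, acts on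
  \<open>V \<otimes> S\<close>.
\<close>

definition dirac_operator ::
    "nat \<Rightarrow> (nat \<Rightarrow> 'g::lie_algebra) \<Rightarrow> ('g \<Rightarrow> 's::complex_vector \<Rightarrow> 's) \<Rightarrow>
      ('g \<Rightarrow> 'v::complex_vector \<Rightarrow> 'v) \<Rightarrow> ('v, 's) tensor \<Rightarrow> ('v, 's) tensor"
  where "dirac_operator m Z \<gamma> \<rho> t =
    (\<Sum>i = 1..m. tensor_map (\<rho> (Z i)) (\<gamma> (Z i)) t) + tensor_map id (cubic_term m Z \<gamma>) t"

definition diagonal_action ::
    "nat \<Rightarrow> (nat \<Rightarrow> 'g::lie_algebra) \<Rightarrow> ('g \<Rightarrow> 's::complex_vector \<Rightarrow> 's) \<Rightarrow>
      ('g \<Rightarrow> 'v::complex_vector \<Rightarrow> 'v) \<Rightarrow> 'g \<Rightarrow> ('v, 's) tensor \<Rightarrow> ('v, 's) tensor"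
  where "diagonal_action m Z \<gamma> \<rho> X t =
    tensor_map (\<rho> X) id t + tensor_map id (spin_action m Z \<gamma> X) t"

definition dirac_cohomology ::
    "nat \<Rightarrow> (nat \<Rightarrow> 'g::lie_algebra) \<Rightarrow> ('g \<Rightarrow> 's::complex_vector \<Rightarrow> 's) \<Rightarrow>
      ('g \<Rightarrow> 'v::complex_vector \<Rightarrow> 'v) \<Rightarrow> ('g, ('v, 's) tensor set) module_structure"
  where "dirac_cohomology m Z \<gamma> \<rho> =
    (let D = dirac_operator m Z \<gamma> \<rho>; K = {t. D t = 0}
     in quotient_module (diagonal_action m Z \<gamma> \<rho>) K (K \<inter> range D))"

end

theory Submission
  imports Defs "HOL-Computational_Algebra.Fundamental_Theorem_Algebra" "HOL-Library.Product_Plus"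
begin

text \<open>
  The content is that a simple module in the category can be recovered from its Dirac cohomology,
  and this is a statement about highest weights. Write \<open>\<le>\<close> for the order on weights given by
  the cone \<open>\<nat>\<Delta>\<close>. A simple \<open>V\<close> has a highest weight vector \<open>v\<close>, of weight \<open>\<nu>\<close>, say; the spin module
  has a vacuum \<open>s\<close>, killed by \<open>\<uu>\<close>, of some weight \<open>\<sigma>\<close> for the spin action of \<open>\<hh>\<close>. Both are top
  vectors (\<open>top_vector\<close>): they span their weight spaces and all other weights lie strictly below.
  Hence so is \<open>v \<otimes> s\<close> in \<open>V \<otimes> S\<close>, with weight \<open>\<nu> + \<sigma>\<close> (\<open>tensor_top_vector\<close>).

  The Dirac operator commutes with \<open>\<hh>\<close> (\<open>dirac_operator_invariant\<close>), so \<open>D (v \<otimes> s)\<close> has weight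
  \<open>\<nu> + \<sigma>\<close>. But \<open>D\<close> is odd in the Clifford variables, and odd Clifford elements send \<open>s\<close> into
  the span of the products of an odd number of elements of the opposite nilradical applied to \<open>s\<close>,
  all of weight strictly below \<open>\<sigma>\<close> (\<open>spin_top_vector\<close>). Hence \<open>D (v \<otimes> s) = 0\<close>. If
  \<open>v \<otimes> s = D t\<close>, then the component of \<open>t\<close> of weight \<open>\<nu> + \<sigma>\<close> is a multiple of \<open>v \<otimes> s\<close> and is
  killed by \<open>D\<close>, which is absurd. So \<open>\<nu> + \<sigma>\<close> is a weight of \<open>H\<^sub>D(V)\<close>
  (\<open>dirac_cohomology_top_weight\<close>), and all weights of \<open>H\<^sub>D(V)\<close> are \<open>\<le> \<nu> + \<sigma>\<close>
  (\<open>dirac_cohomology_weights_below\<close>). As \<open>\<sigma>\<close> depends on \<open>S\<close> only, isomorphic cohomologies force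
  \<open>\<nu> \<le> \<nu>'\<close> and \<open>\<nu>' \<le> \<nu>\<close>, and simple modules with the same highest weight are isomorphic
  (\<open>simple_highest_weight_iso\<close>). The other direction is functoriality (\<open>dirac_cohomology_iso\<close>).

  The argument uses that \<open>\<hh>\<close> is abelian and that \<open>\<gg>\<close> is spanned by \<open>\<hh>\<close> and genuine root vectors.
  With \<open>\<hh>\<close> given as a nilpotent self-normalizing subalgebra and \<open>\<gg>\<close> as a Lie algebra without
  nonzero solvable ideals, this is classical structure theory, developed from the generalized weight
  spaces of \<open>\<hh>\<close>: Engel's theorem (\<open>engel\<close>) gives \<open>\<gg>\<^sub>0 = \<hh>\<close>, traces over weight strings show that a
  perfect ideal in the radical of the Killing form consists of nilpotent elements
  (\<open>perfect_isotropic_ideal\<close>), so that the form is nondegenerate, and a summation by parts over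
  the weights (\<open>killing_bracket_weight\<close>) shows that \<open>\<hh>\<close> acts on each \<open>\<gg>\<^sub>\<alpha>\<close> by scalars.
\<close>

section \<open>Linear algebra over the complex numbers\<close>

lemmas csubspace_0 = complex_vector.subspace_0
  and csubspace_add = complex_vector.subspace_add
  and csubspace_diff = complex_vector.subspace_diff
  and csubspace_scale = complex_vector.subspace_scale
  and csubspace_sum = complex_vector.subspace_sum
  and csubspace_neg = complex_vector.subspace_neg
  and csubspace_cspan = complex_vector.subspace_span
  and cspan_base = complex_vector.span_base
  and cspan_0 = complex_vector.span_zero
  and cspan_add = complex_vector.span_add
  and cspan_scale = complex_vector.span_scale
  and cspan_sum = complex_vector.span_sum
  and cspan_mono = complex_vector.span_mono
  and cspan_minimal = complex_vector.span_minimal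

lemma csubspaceI:
  assumes "0 \<in> W" "\<And>x y. x \<in> W \<Longrightarrow> y \<in> W \<Longrightarrow> x + y \<in> W" "\<And>c x. x \<in> W \<Longrightarrow> c *\<^sub>C x \<in> W"
  shows "csubspace W"
  using assms by (simp add: complex_vector.subspace_def)

lemma cspan_csubspace [simp]: "csubspace W \<Longrightarrow> cspan W = W"
  by (simp add: complex_vector.span_eq_iff)

lemma cspan_induct [consumes 1, case_names zero add scale base]:
  assumes "x \<in> cspan S" "P 0" "\<And>x y. P x \<Longrightarrow> P y \<Longrightarrow> P (x + y)" "\<And>c x. P x \<Longrightarrow> P (c *\<^sub>C x)"
    and "\<And>x. x \<in> S \<Longrightarrow> P x"
  shows "P x"
proof -
  have "cspan S \<subseteq> {x. P x}"
    by (intro cspan_minimal csubspaceI) (use assms in auto)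
  then show ?thesis using assms(1) by auto
qed

lemma clinear_diff: "clinear f \<Longrightarrow> f (x - y) = f x - f y"
  by (metis add_diff_cancel_right' clinear_add diff_add_cancel)

lemma clinear_sum: "clinear f \<Longrightarrow> f (sum g A) = (\<Sum>x\<in>A. f (g x))"
  by (induction A rule: infinite_finite_induct) (auto simp: clinear_0 clinear_add)

lemma clinear_uminus: "clinear f \<Longrightarrow> f (- x) = - f x"
  by (metis clinear_0 clinear_diff diff_0)

lemma clinear_id [simp]: "clinear id" "clinear (\<lambda>x. x)"
  by (auto intro: clinearI)

lemma clinear_compose: "clinear f \<Longrightarrow> clinear g \<Longrightarrow> clinear (\<lambda>x. f (g x))"
  by (rule clinearI) (simp_all add: clinear_add clinear_scale)

lemma clinear_funpow: "clinear f \<Longrightarrow> clinear (f ^^ n)" for f :: "'v::complex_vector \<Rightarrow> 'v"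
proof (induction n)
  case 0
  show ?case by (rule clinearI) auto
next
  case (Suc n)
  then show ?case by (intro clinearI) (simp_all add: clinear_add clinear_scale)
qed

lemma clinear_plus: "clinear f \<Longrightarrow> clinear g \<Longrightarrow> clinear (\<lambda>x. f x + g x)"
  by (rule clinearI) (simp_all add: clinear_add clinear_scale scaleC_add_right)

lemma clinear_minus: "clinear f \<Longrightarrow> clinear g \<Longrightarrow> clinear (\<lambda>x. f x - g x)"
  by (rule clinearI)
    (simp_all add: clinear_add clinear_scale complex_vector.scale_right_diff_distrib)

lemma clinear_scaled: "clinear f \<Longrightarrow> clinear (\<lambda>x. c *\<^sub>C f x)"
  by (rule clinearI) (simp_all add: clinear_add clinear_scale scaleC_add_right scaleC_scaleC mult.commute)

lemma clinear_sums:
  assumes "\<And>i. i \<in> A \<Longrightarrow> clinear (f i)" shows "clinear (\<lambda>x. \<Sum>i\<in>A. f i x)"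
  by (rule clinearI)
    (simp_all add: clinear_add[OF assms] clinear_scale[OF assms] sum.distrib complex_vector.scale_sum_right)

lemma clinear_image_cspan:
  assumes "clinear f" "x \<in> cspan S" "\<And>y. y \<in> S \<Longrightarrow> f y \<in> W" "csubspace W"
  shows "f x \<in> W"
  using assms(2)
  by (induction rule: cspan_induct)
    (use assms in \<open>auto simp: clinear_0 clinear_add clinear_scale csubspace_0 csubspace_add csubspace_scale\<close>)

lemma csubspace_kernel: "clinear f \<Longrightarrow> csubspace {x. f x = 0}"
  by (rule csubspaceI) (auto simp: clinear_0 clinear_add clinear_scale)

lemma csubspace_vimage:
  assumes "clinear f" "csubspace W" shows "csubspace {x. f x \<in> W}"
  by (rule csubspaceI)
    (simp_all add: clinear_0[OF assms(1)] clinear_add[OF assms(1)] clinear_scale[OF assms(1)]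
      csubspace_0[OF assms(2)] csubspace_add[OF assms(2)] csubspace_scale[OF assms(2)])

lemma csubspace_Int: "csubspace V \<Longrightarrow> csubspace W \<Longrightarrow> csubspace (V \<inter> W)"
  by (rule complex_vector.subspace_inter)

lemma csubspace_image:
  assumes T: "clinear T" and M: "csubspace M" shows "csubspace (T ` M)"
proof (rule csubspaceI)
  show "0 \<in> T ` M" using csubspace_0[OF M] clinear_0[OF T] by (metis image_eqI)
  show "x + y \<in> T ` M" if xy: "x \<in> T ` M" "y \<in> T ` M" for x y
  proof -
    obtain a b where "a \<in> M" "b \<in> M" "x = T a" "y = T b" using xy by blast
    then show ?thesis by (intro image_eqI[of _ T "a + b"] csubspace_add[OF M]) (simp_all add: clinear_add[OF T])
  qed
  show "c *\<^sub>C x \<in> T ` M" if x: "x \<in> T ` M" for c x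
  proof -
    obtain a where "a \<in> M" "x = T a" using x by blast
    then show ?thesis by (intro image_eqI[of _ T "c *\<^sub>C a"] csubspace_scale[OF M]) (simp_all add: clinear_scale[OF T])
  qed
qed

lemma cspan_Union_decompose:
  assumes "x \<in> cspan (\<Union>i\<in>A. W i)" "\<And>i. i \<in> A \<Longrightarrow> csubspace (W i)"
  obtains F y where "finite F" "F \<subseteq> A" "\<And>i. i \<in> F \<Longrightarrow> y i \<in> W i" "x = (\<Sum>i\<in>F. y i)"
proof -
  have "\<exists>F y. finite F \<and> F \<subseteq> A \<and> (\<forall>i\<in>F. y i \<in> W i) \<and> x = (\<Sum>i\<in>F. y i)"
    using assms(1)
  proof (induction rule: cspan_induct)
    case zero
    show ?case by (intro exI[of _ "{}"]) auto
  next
    case (add u v)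
    then obtain F f G g where 1: "finite F" "F \<subseteq> A" "\<forall>i\<in>F. f i \<in> W i" "u = (\<Sum>i\<in>F. f i)"
       "finite G" "G \<subseteq> A" "\<forall>i\<in>G. g i \<in> W i" "v = (\<Sum>i\<in>G. g i)" by blast
    define h where "h i = (if i \<in> F then f i else 0) + (if i \<in> G then g i else 0)" for i
    have "u + v = (\<Sum>i\<in>F \<union> G. h i)"
      unfolding h_def sum.distrib
      using 1 by (simp add: sum.If_cases Int_absorb1 Int_absorb2 inf_sup_aci flip: sum.inter_restrict)
    moreover have "\<forall>i\<in>F \<union> G. h i \<in> W i"
      using 1 assms(2) unfolding h_def
      by (intro ballI csubspace_add) (auto intro!: csubspace_0)
    ultimately show ?case using 1 by (intro exI[of _ "F \<union> G"] exI[of _ h]) auto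
  next
    case (scale c u)
    then obtain F f where 1: "finite F" "F \<subseteq> A" "\<forall>i\<in>F. f i \<in> W i" "u = (\<Sum>i\<in>F. f i)" by blast
    then have "c *\<^sub>C u = (\<Sum>i\<in>F. c *\<^sub>C f i)" by (simp add: complex_vector.scale_sum_right)
    moreover have "\<forall>i\<in>F. c *\<^sub>C f i \<in> W i"
      using 1 assms(2) by (auto intro!: csubspace_scale)
    ultimately show ?case using 1 by (intro exI[of _ F] exI[of _ "\<lambda>i. c *\<^sub>C f i"]) auto
  next
    case (base u)
    then obtain i where "i \<in> A" "u \<in> W i" by auto
    then show ?case by (intro exI[of _ "{i}"] exI[of _ "\<lambda>_. u"]) auto
  qed
  then show ?thesis using that by blast
qed

subsection \<open>Finite-dimensional subspaces\<close>

lemma cfinite_dim_basis: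
  assumes "cfinite_dim M"
  obtains E where "finite E" "\<not> cdependent E" "cspan E = M"
proof -
  obtain F where F: "finite F" "M = cspan F" using assms by (auto simp: cfinite_dim_def)
  obtain E where "E \<subseteq> F" "\<not> cdependent E" "F \<subseteq> cspan E"
    using complex_vector.maximal_independent_subset[of F] by metis
  then show ?thesis using that[of E] F
    by (metis complex_vector.span_mono complex_vector.span_span finite_subset subset_antisym)
qed

lemma cfinite_dim_csubspace: "cfinite_dim M \<Longrightarrow> csubspace M"
  by (auto simp: cfinite_dim_def)

lemma independent_in_cfinite_dim:
  assumes "cfinite_dim M" "E \<subseteq> M" "\<not> cdependent E"
  shows "finite E" "card E \<le> complex_vector.dim M"
proof -
  obtain F where F: "finite F" "\<not> cdependent F" "cspan F = M" using cfinite_dim_basis[OF assms(1)] by metis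
  then have "finite E \<and> card E \<le> card F"
    using complex_vector.independent_span_bound[of F E] assms by auto
  moreover have "complex_vector.dim M = card F"
    using complex_vector.dim_span_eq_card_independent[OF F(2)] unfolding F(3) .
  ultimately show "finite E" "card E \<le> complex_vector.dim M" by auto
qed

lemma cfinite_dim_subspace:
  assumes "cfinite_dim M" "csubspace N" "N \<subseteq> M"
  shows "cfinite_dim N"
proof -
  obtain E where E: "E \<subseteq> N" "\<not> cdependent E" "N \<subseteq> cspan E"
    using complex_vector.maximal_independent_subset[of N] by metis
  then have "finite E" using independent_in_cfinite_dim(1)[OF assms(1), of E] assms(3) by simp
  moreover have "cspan E = N" by (rule complex_vector.span_subspace[OF E(1,3) assms(2)])
  ultimately show ?thesis by (auto simp: cfinite_dim_def)
qed

lemma basis_extend: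
  assumes "cfinite_dim M" "csubspace N" "N \<subseteq> M" "\<not> cdependent E" "cspan E = N"
  obtains E' where "E \<subseteq> E'" "finite E'" "\<not> cdependent E'" "cspan E' = M"
proof -
  have "E \<subseteq> M" using assms by (auto intro: cspan_base)
  then obtain E' where E': "E \<subseteq> E'" "E' \<subseteq> M" "\<not> cdependent E'" "M \<subseteq> cspan E'"
    using complex_vector.maximal_independent_subset_extend[of E M] assms(4) by metis
  have "cspan E' = M"
    by (rule complex_vector.span_subspace[OF E'(2,4) cfinite_dim_csubspace[OF assms(1)]])
  then show ?thesis using that E' independent_in_cfinite_dim(1)[OF assms(1) E'(2,3)] by simp
qed

lemma dim_less:
  assumes "cfinite_dim M" "csubspace N" "N \<subset> M"
  shows "complex_vector.dim N < complex_vector.dim M"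
proof -
  have "cfinite_dim N" using assms cfinite_dim_subspace by blast
  then obtain E where E: "finite E" "\<not> cdependent E" "cspan E = N" using cfinite_dim_basis by metis
  obtain E' where E': "E \<subseteq> E'" "finite E'" "\<not> cdependent E'" "cspan E' = M"
    using basis_extend[OF assms(1,2) _ E(2,3)] assms(3) by auto
  have "E \<noteq> E'" using assms E E' by auto
  then have "card E < card E'" using E' by (simp add: psubset_card_mono)
  then show ?thesis
    using complex_vector.dim_span_eq_card_independent[OF E(2)]
      complex_vector.dim_span_eq_card_independent[OF E'(3)] unfolding E(3) E'(4) by linarith
qed

lemma dim_pos:
  assumes "cfinite_dim M" "M \<noteq> {0}"
  shows "0 < complex_vector.dim M"
proof -
  have "{0} \<subset> M" using assms csubspace_0[OF cfinite_dim_csubspace[OF assms(1)]] by auto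
  from dim_less[OF assms(1) complex_vector.subspace_single_0 this] show ?thesis by linarith
qed

text \<open>Induction on dimension, packaged so that no dimension occurs in the statement.\<close>

lemma cfinite_dim_induct [consumes 1, case_names less]:
  assumes "cfinite_dim M"
    and "\<And>M. cfinite_dim M \<Longrightarrow> (\<And>N. csubspace N \<Longrightarrow> N \<subset> M \<Longrightarrow> P N) \<Longrightarrow> P M"
  shows "P M"
  using assms(1)
proof (induction "complex_vector.dim M" arbitrary: M rule: less_induct)
  case less
  show ?case
  proof (rule assms(2)[OF less.prems])
    fix N assume N: "csubspace N" "N \<subset> M"
    then show "P N" using less cfinite_dim_subspace[of M N] by (intro less.hyps dim_less) auto
  qed
qed

subsection \<open>Generalized eigenvectors\<close>

definition shifted :: "('v \<Rightarrow> 'v) \<Rightarrow> complex \<Rightarrow> 'v \<Rightarrow> 'v::complex_vector"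
  where "shifted T a x = T x - a *\<^sub>C x"

definition gen_eigen :: "('v \<Rightarrow> 'v) \<Rightarrow> complex \<Rightarrow> 'v::complex_vector set"
  where "gen_eigen T a = {x. \<exists>n. (shifted T a ^^ n) x = 0}"

lemma clinear_shifted: "clinear T \<Longrightarrow> clinear (shifted T a)"
  unfolding shifted_def by (intro clinear_minus clinear_scaled clinear_id)

lemma shifted_funpow_mono:
  assumes "clinear T" "(shifted T a ^^ n) x = 0" "n \<le> k"
  shows "(shifted T a ^^ k) x = 0"
proof -
  have "(shifted T a ^^ k) x = (shifted T a ^^ (k - n)) ((shifted T a ^^ n) x)"
    using assms(3) by (metis add.commute comp_apply funpow_add le_add_diff_inverse)
  then show ?thesis using assms by (simp add: clinear_0 clinear_funpow clinear_shifted)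
qed

lemma csubspace_gen_eigen: "clinear T \<Longrightarrow> csubspace (gen_eigen T a)"
proof (rule csubspaceI)
  assume T: "clinear T"
  show "0 \<in> gen_eigen T a" by (auto simp: gen_eigen_def intro: exI[of _ 0])
  fix x y c assume x: "x \<in> gen_eigen T a"
  then show "c *\<^sub>C x \<in> gen_eigen T a"
    using clinear_funpow[OF clinear_shifted[OF T]] by (auto simp: gen_eigen_def clinear_scale)
  assume y: "y \<in> gen_eigen T a"
  from x y obtain n k where "(shifted T a ^^ n) x = 0" "(shifted T a ^^ k) y = 0"
    by (auto simp: gen_eigen_def)
  then have "(shifted T a ^^ max n k) x = 0" "(shifted T a ^^ max n k) y = 0"
    using shifted_funpow_mono[OF T] by (meson max.cobounded1 max.cobounded2)+
  then show "x + y \<in> gen_eigen T a"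
    using clinear_funpow[OF clinear_shifted[OF T]] by (auto simp: gen_eigen_def clinear_add intro!: exI[of _ "max n k"])
qed

lemma shifted_gen_eigen_iff:
  assumes "clinear T"
  shows "shifted T a x \<in> gen_eigen T a \<longleftrightarrow> x \<in> gen_eigen T a"
proof
  assume "shifted T a x \<in> gen_eigen T a"
  then obtain n where "(shifted T a ^^ n) (shifted T a x) = 0" by (auto simp: gen_eigen_def)
  then have "(shifted T a ^^ Suc n) x = 0" by (simp add: funpow_swap1)
  then show "x \<in> gen_eigen T a" unfolding gen_eigen_def by blast
next
  assume "x \<in> gen_eigen T a"
  then obtain n where "(shifted T a ^^ n) x = 0" by (auto simp: gen_eigen_def)
  then have "shifted T a ((shifted T a ^^ n) x) = 0"
    using clinear_0[OF clinear_shifted[OF assms]] by simp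
  then show "shifted T a x \<in> gen_eigen T a" by (auto simp: gen_eigen_def funpow_swap1)
qed

lemma gen_eigen_induct [consumes 2, case_names zero step]:
  assumes "clinear T" "x \<in> gen_eigen T a" "P 0"
    and "\<And>x. x \<in> gen_eigen T a \<Longrightarrow> P (shifted T a x) \<Longrightarrow> P x"
  shows "P x"
proof -
  obtain n where "(shifted T a ^^ n) x = 0" using assms(2) by (auto simp: gen_eigen_def)
  then show ?thesis using assms(2)
  proof (induction n arbitrary: x)
    case (Suc n)
    then show ?case using assms(4)[of x] shifted_gen_eigen_iff[OF assms(1)]
      by (simp add: funpow_swap1)
  qed (use assms(3) in simp)
qed

text \<open>
  On the generalized eigenspace for \<open>b\<close> the operator \<open>T - a\<close> with \<open>a \<noteq> b\<close> is the sum of a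
  nonzero scalar and a nilpotent operator; both statements below express its invertibility.
\<close>

lemma shifted_surj_gen_eigen:
  assumes T: "clinear T" and M: "csubspace M" "\<And>x. x \<in> M \<Longrightarrow> T x \<in> M"
    and "a \<noteq> b" "y \<in> gen_eigen T b" "y \<in> M"
  shows "\<exists>z \<in> gen_eigen T b \<inter> M. shifted T a z = y"
  using assms(1,5,6)
proof (induction rule: gen_eigen_induct)
  case zero
  then show ?case using csubspace_0 csubspace_gen_eigen[OF T] M clinear_0[OF clinear_shifted[OF T]]
    by (intro bexI[of _ 0]) auto
next
  case (step y)
  have "shifted T b y \<in> M" using step M by (simp add: shifted_def csubspace_diff csubspace_scale)
  then obtain z where z: "z \<in> gen_eigen T b" "z \<in> M" "shifted T a z = shifted T b y"
    using step by auto
  let ?z = "(1 / (b - a)) *\<^sub>C (y - z)"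
  have "?z \<in> gen_eigen T b \<inter> M"
    using step z M csubspace_gen_eigen[OF T] by (simp add: csubspace_scale csubspace_diff)
  have "shifted T a y - shifted T b y = (b - a) *\<^sub>C y"
    by (simp add: shifted_def complex_vector.scale_left_diff_distrib)
  moreover have "shifted T a ?z = (1 / (b - a)) *\<^sub>C (shifted T a y - shifted T b y)"
    using z(3) clinear_shifted[OF T, of a] by (simp add: clinear_scale clinear_diff)
  ultimately have "shifted T a ?z = y" using assms(4) by (simp add: scaleC_scaleC scaleC_one)
  with \<open>?z \<in> gen_eigen T b \<inter> M\<close> show ?case by blast
qed

lemma shifted_inj_gen_eigen:
  assumes T: "clinear T" and N: "csubspace N" "\<And>x. x \<in> N \<Longrightarrow> T x \<in> N"
    and "a \<noteq> b" "y \<in> gen_eigen T b" "(shifted T a ^^ n) y \<in> N"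
  shows "y \<in> N"
proof -
  have one: "y \<in> N" if "y \<in> gen_eigen T b" "shifted T a y \<in> N" for y
    using T that
  proof (induction rule: gen_eigen_induct)
    case (step y)
    have "shifted T a (shifted T b y) = shifted T b (shifted T a y)"
      using T by (simp add: shifted_def clinear_diff clinear_scale
          complex_vector.scale_right_diff_distrib scaleC_scaleC mult.commute algebra_simps)
    moreover have "shifted T b (shifted T a y) \<in> N"
      using step N by (simp add: shifted_def[of T b] csubspace_diff csubspace_scale)
    ultimately have "shifted T b y \<in> N" using step by simp
    moreover have "shifted T a y - shifted T b y = (b - a) *\<^sub>C y"
      by (simp add: shifted_def complex_vector.scale_left_diff_distrib)
    ultimately have "(1 / (b - a)) *\<^sub>C (b - a) *\<^sub>C y \<in> N"
      using step N by (metis csubspace_diff csubspace_scale)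
    then show ?case using assms(4) by (simp add: scaleC_scaleC scaleC_one)
  qed (use N csubspace_0 in auto)
  show ?thesis using assms(5,6)
  proof (induction n arbitrary: y)
    case (Suc n)
    have "shifted T a y \<in> gen_eigen T b"
    proof -
      have "shifted T b y + (b - a) *\<^sub>C y \<in> gen_eigen T b"
        using Suc.prems(1) csubspace_gen_eigen[OF T, of b] shifted_gen_eigen_iff[OF T, of b y]
        by (intro csubspace_add csubspace_scale) auto
      moreover have "shifted T b y + (b - a) *\<^sub>C y = shifted T a y"
        by (simp add: shifted_def complex_vector.scale_left_diff_distrib)
      ultimately show ?thesis by simp
    qed
    then have "shifted T a y \<in> N" using Suc by (simp add: funpow_swap1)
    then show ?case using one Suc.prems by blast
  qed simp
qed

subsection \<open>Splitting into generalized eigenspaces\<close>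

definition poly_op :: "('v \<Rightarrow> 'v) \<Rightarrow> complex poly \<Rightarrow> 'v::complex_vector \<Rightarrow> 'v"
  where "poly_op T p x = (\<Sum>i\<le>degree p. coeff p i *\<^sub>C (T ^^ i) x)"

lemma poly_op_bound:
  assumes "degree p \<le> n" shows "poly_op T p x = (\<Sum>i\<le>n. coeff p i *\<^sub>C (T ^^ i) x)"
  unfolding poly_op_def using assms
  by (intro sum.mono_neutral_left) (auto simp: coeff_eq_0)

lemma poly_op_linear_factor:
  assumes T: "clinear T"
  shows "poly_op T ([:- a, 1:] * p) x = poly_op T p (shifted T a x)"
proof -
  let ?n = "degree p"
  have "degree ([:- a, 1:] * p) \<le> Suc ?n"
    using degree_mult_le[of "[:- a, 1:]" p] by simp
  then have "poly_op T ([:- a, 1:] * p) x = (\<Sum>i\<le>Suc ?n. coeff ([:- a, 1:] * p) i *\<^sub>C (T ^^ i) x)"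
    by (rule poly_op_bound)
  also have "\<dots> = (\<Sum>i\<le>Suc ?n. coeff (pCons 0 p) i *\<^sub>C (T ^^ i) x) - (\<Sum>i\<le>Suc ?n. (a * coeff p i) *\<^sub>C (T ^^ i) x)"
    by (simp add: sum_subtractf[symmetric] complex_vector.scale_left_diff_distrib algebra_simps del: sum.atMost_Suc)
  also have "(\<Sum>i\<le>Suc ?n. coeff (pCons 0 p) i *\<^sub>C (T ^^ i) x) = (\<Sum>i\<le>?n. coeff p i *\<^sub>C (T ^^ i) (T x))"
    by (subst sum.atMost_Suc_shift) (simp add: funpow_swap1)
  also have "(\<Sum>i\<le>Suc ?n. (a * coeff p i) *\<^sub>C (T ^^ i) x) = (\<Sum>i\<le>?n. (a * coeff p i) *\<^sub>C (T ^^ i) x)"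
    by (simp add: coeff_eq_0)
  also have "(\<Sum>i\<le>?n. coeff p i *\<^sub>C (T ^^ i) (T x)) - \<dots> = poly_op T p (shifted T a x)"
    using clinear_funpow[OF T]
    by (simp add: poly_op_def shifted_def clinear_diff clinear_scale sum_subtractf[symmetric]
        complex_vector.scale_right_diff_distrib scaleC_scaleC mult.commute)
  finally show ?thesis .
qed

text \<open>
  Induction on the degree of the annihilating polynomial: for a root \<open>a\<close>, the vector
  \<open>(T - a) x\<close> is annihilated by a polynomial of smaller degree and hence already decomposed.
\<close>

lemma gen_eigen_decomposition_poly:
  assumes T: "clinear T" and M: "csubspace M" "\<And>x. x \<in> M \<Longrightarrow> T x \<in> M"
    and "p \<noteq> 0" "x \<in> M" "poly_op T p x = 0"
  shows "x \<in> cspan (\<Union>a. gen_eigen T a \<inter> M)"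
  using assms(4-)
proof (induction "degree p" arbitrary: p x)
  case 0
  then obtain c where "p = [:c:]" "c \<noteq> 0" by (metis degree_eq_zeroE pCons_0_0)
  then have "x = 0" using 0 by (simp add: poly_op_def)
  then show ?case by (simp add: cspan_0)
next
  case (Suc n)
  have "\<not> constant (poly p)" using Suc.hyps(2) constant_degree[of p] by simp
  then obtain a where "poly p a = 0" using fundamental_theorem_of_algebra by blast
  then obtain q where q: "p = [:- a, 1:] * q" by (auto simp: poly_eq_0_iff_dvd)
  then have "q \<noteq> 0" using Suc.prems by auto
  then have "degree p = Suc (degree q)" unfolding q by (subst degree_mult_eq) auto
  then have "n = degree q" using Suc.hyps by simp
  let ?S = "\<Union>a. gen_eigen T a \<inter> M"
  have "shifted T a x \<in> M" using Suc.prems M by (simp add: shifted_def csubspace_diff csubspace_scale)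
  then have "shifted T a x \<in> cspan ?S"
    using Suc.hyps(1)[OF \<open>n = degree q\<close> \<open>q \<noteq> 0\<close>] Suc.prems(3) q poly_op_linear_factor[OF T] by simp
  then obtain F y where F: "finite F" "\<And>b. b \<in> F \<Longrightarrow> y b \<in> gen_eigen T b \<inter> M"
      "shifted T a x = (\<Sum>b\<in>F. y b)"
    by (rule cspan_Union_decompose[where W = "\<lambda>a. gen_eigen T a \<inter> M"])
      (auto intro!: csubspace_Int csubspace_gen_eigen[OF T] M(1))
  \<comment> \<open>solve \<open>(T - a) z = y b\<close> for each \<open>b \<noteq> a\<close>; what is left of \<open>x\<close> lies in the generalized
    eigenspace for \<open>a\<close>\<close>
  have "\<forall>b\<in>F - {a}. \<exists>z \<in> gen_eigen T b \<inter> M. shifted T a z = y b"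
    using shifted_surj_gen_eigen[OF T M] F by (metis DiffD1 DiffD2 IntD1 IntD2 singletonI)
  then obtain z where z: "\<And>b. b \<in> F - {a} \<Longrightarrow> z b \<in> gen_eigen T b \<inter> M \<and> shifted T a (z b) = y b"
    by metis
  define w where "w = (\<Sum>b\<in>F - {a}. z b)"
  have w: "w \<in> M" "w \<in> cspan ?S"
    unfolding w_def using z by (intro csubspace_sum[OF M(1)] cspan_sum cspan_base; blast)+
  have "shifted T a (x - w) = (\<Sum>b\<in>F. y b) - (\<Sum>b\<in>F - {a}. y b)"
    using z F clinear_shifted[OF T, of a] by (simp add: clinear_diff clinear_sum w_def)
  also have "\<dots> \<in> gen_eigen T a"
    using F csubspace_0[OF csubspace_gen_eigen[OF T]] by (cases "a \<in> F") (auto simp: sum.remove)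
  finally have "x - w \<in> gen_eigen T a \<inter> M"
    using shifted_gen_eigen_iff[OF T] Suc.prems M w by (auto intro: csubspace_diff)
  then have "(x - w) + w \<in> cspan ?S" using w by (intro cspan_add) (auto intro: cspan_base)
  then show ?case by simp
qed

lemma annihilating_polynomial:
  assumes "cfinite_dim M" "csubspace M" "\<And>x. x \<in> M \<Longrightarrow> T x \<in> M" "x \<in> M"
  obtains p where "p \<noteq> 0" "poly_op T p x = 0"
proof -
  let ?n = "complex_vector.dim M"
  have TM: "(T ^^ i) x \<in> M" for i by (induction i) (use assms in auto)
  show ?thesis
  proof (cases "inj_on (\<lambda>i. (T ^^ i) x) {..?n}")
    case True
    let ?B = "(\<lambda>i. (T ^^ i) x) ` {..?n}"
    have "cdependent ?B"
      using independent_in_cfinite_dim(2)[OF assms(1), of ?B] TM card_image[OF True] by auto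
    then obtain u v where u: "(\<Sum>v\<in>?B. u v *\<^sub>C v) = 0" "v \<in> ?B" "u v \<noteq> 0"
      using complex_vector.dependent_finite[of ?B] by auto
    define p where "p = (\<Sum>i\<le>?n. monom (u ((T ^^ i) x)) i)"
    have c: "coeff p i = (if i \<le> ?n then u ((T ^^ i) x) else 0)" for i
      by (simp add: p_def coeff_sum)
    have "p \<noteq> 0" using u c by (metis (no_types, lifting) atMost_iff coeff_0 imageE)
    moreover have "degree p \<le> ?n" using c by (simp add: degree_le)
    then have "poly_op T p x = (\<Sum>i\<le>?n. u ((T ^^ i) x) *\<^sub>C (T ^^ i) x)"
      using c by (simp add: poly_op_bound)
    then have "poly_op T p x = 0" using u(1) by (simp add: sum.reindex[OF True])
    ultimately show ?thesis using that by blast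
  next
    case False
    then obtain i j where ij: "i < j" "(T ^^ i) x = (T ^^ j) x"
      unfolding inj_on_def by (metis linorder_neqE_nat)
    define p where "p = monom (1::complex) j - monom 1 i"
    have c: "coeff p k = (if k = j then 1 else 0) - (if k = i then 1 else 0)" for k
      by (auto simp: p_def)
    have "degree p \<le> j" using ij c by (intro degree_le) auto
    then have "poly_op T p x = (\<Sum>k\<le>j. coeff p k *\<^sub>C (T ^^ k) x)" by (rule poly_op_bound)
    also have "\<dots> = (T ^^ j) x - (T ^^ i) x"
      using ij by (simp add: c complex_vector.scale_left_diff_distrib sum_subtractf if_distrib[of "\<lambda>c. c *\<^sub>C _"] sum.delta cong: if_cong)
    finally have "poly_op T p x = 0" using ij by simp
    moreover have "coeff p j \<noteq> 0" using ij c by simp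
    then have "p \<noteq> 0" by auto
    ultimately show ?thesis using that by blast
  qed
qed

lemma gen_eigen_decomposition:
  assumes "clinear T" "cfinite_dim M" "\<And>x. x \<in> M \<Longrightarrow> T x \<in> M"
  shows "M \<subseteq> cspan (\<Union>a. gen_eigen T a \<inter> M)"
proof
  fix x assume x: "x \<in> M"
  note M = cfinite_dim_csubspace[OF assms(2)]
  obtain p where p: "p \<noteq> 0" "poly_op T p x = 0"
    by (rule annihilating_polynomial[OF assms(2) M assms(3) x])
  show "x \<in> cspan (\<Union>a. gen_eigen T a \<inter> M)"
    by (rule gen_eigen_decomposition_poly[OF assms(1) M assms(3) p(1) x p(2)])
qed

lemma eigenvector_exists:
  assumes T: "clinear T" and "cfinite_dim M" "M \<noteq> {0}" "\<And>x. x \<in> M \<Longrightarrow> T x \<in> M"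
  obtains a x where "x \<in> M" "x \<noteq> 0" "T x = a *\<^sub>C x"
proof -
  have M: "csubspace M" using assms cfinite_dim_csubspace by blast
  have "\<exists>a. \<exists>x \<in> gen_eigen T a \<inter> M. x \<noteq> 0"
  proof (rule ccontr)
    assume "\<nexists>a. \<exists>x \<in> gen_eigen T a \<inter> M. x \<noteq> 0"
    then have "(\<Union>a. gen_eigen T a \<inter> M) \<subseteq> {0}" by auto
    then have "cspan (\<Union>a. gen_eigen T a \<inter> M) \<subseteq> {0}" by (simp add: cspan_minimal)
    then show False
      using gen_eigen_decomposition[OF T assms(2,4)] assms(3) csubspace_0[OF M] by blast
  qed
  then obtain a x where x: "x \<in> gen_eigen T a" "x \<in> M" "x \<noteq> 0" by auto
  have "x \<in> M \<longrightarrow> x \<noteq> 0 \<longrightarrow> (\<exists>y\<in>M. y \<noteq> 0 \<and> T y = a *\<^sub>C y)"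
    using T x(1)
  proof (induction rule: gen_eigen_induct)
    case (step x)
    show ?case
    proof (cases "shifted T a x = 0")
      case True
      then show ?thesis by (auto simp: shifted_def)
    next
      case False
      then show ?thesis using step M assms(4) by (simp add: shifted_def csubspace_diff csubspace_scale)
    qed
  qed simp
  then show ?thesis using x that by blast
qed

text \<open>
  Unless every operator is a scalar on \<open>M\<close>, some operator has an eigenspace that is a proper
  subspace; the others preserve it, and the dimension drops.
\<close>

lemma common_eigenvector:
  assumes "cfinite_dim M" "M \<noteq> {0}" "\<And>h. h \<in> A \<Longrightarrow> clinear (\<tau> h)"
    "\<And>h x. h \<in> A \<Longrightarrow> x \<in> M \<Longrightarrow> \<tau> h x \<in> M"
    "\<And>h k x. h \<in> A \<Longrightarrow> k \<in> A \<Longrightarrow> x \<in> M \<Longrightarrow> \<tau> h (\<tau> k x) = \<tau> k (\<tau> h x)"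
  shows "\<exists>x\<in>M. x \<noteq> 0 \<and> (\<forall>h\<in>A. \<exists>a. \<tau> h x = a *\<^sub>C x)"
  using assms
proof (induction rule: cfinite_dim_induct)
  case (less M)
  note M = cfinite_dim_csubspace[OF less.hyps(1)]
  show ?case
  proof (cases "\<forall>h\<in>A. \<exists>a. \<forall>x\<in>M. \<tau> h x = a *\<^sub>C x")
    case True
    moreover obtain x where "x \<in> M" "x \<noteq> 0" using less.prems(1) csubspace_0[OF M] by blast
    ultimately show ?thesis by blast
  next
    case False
    then obtain h where h: "h \<in> A" "\<And>a. \<exists>x\<in>M. \<tau> h x \<noteq> a *\<^sub>C x" by blast
    obtain a x where ax: "x \<in> M" "x \<noteq> 0" "\<tau> h x = a *\<^sub>C x"
      using eigenvector_exists[OF less.prems(2)[OF h(1)] less.hyps(1) less.prems(1) less.prems(3)[OF h(1)]]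
      by metis
    let ?N = "{x \<in> M. \<tau> h x = a *\<^sub>C x}"
    have "csubspace ?N"
      by (intro csubspaceI)
        (auto simp: csubspace_0[OF M] csubspace_add[OF M] csubspace_scale[OF M]
          clinear_0[OF less.prems(2)[OF h(1)]] clinear_add[OF less.prems(2)[OF h(1)]]
          clinear_scale[OF less.prems(2)[OF h(1)]] scaleC_add_right scaleC_scaleC mult.commute)
    moreover have "?N \<subset> M" using h(2)[of a] by auto
    moreover have "?N \<noteq> {0}" using ax by blast
    moreover have "\<tau> k x \<in> ?N" if k: "k \<in> A" and x: "x \<in> ?N" for k x
    proof -
      have "\<tau> h (\<tau> k x) = \<tau> k (\<tau> h x)" using less.prems(4)[OF h(1) k] x by blast
      then show ?thesis using x less.prems(3)[OF k] clinear_scale[OF less.prems(2)[OF k]] by simp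
    qed
    moreover have "\<tau> h (\<tau> k x) = \<tau> k (\<tau> h x)" if "h \<in> A" "k \<in> A" "x \<in> ?N" for h k x
      using less.prems(4) that by blast
    ultimately have "\<exists>x\<in>?N. x \<noteq> 0 \<and> (\<forall>h\<in>A. \<exists>a. \<tau> h x = a *\<^sub>C x)"
      using less.IH[OF _ _ _ less.prems(2), of ?N] by presburger
    then show ?thesis by blast
  qed
qed

subsection \<open>Simultaneous generalized eigenspaces\<close>

text \<open>
  Independence is stated modulo a stable subspace \<open>N\<close>: with \<open>N = 0\<close> the sum of the \<open>W \<mu>\<close> is
  direct, and in general a stable subspace contains the components of its elements. A power of
  \<open>\<tau> h - \<nu> h\<close> removes the component for \<open>\<nu>\<close>, and it can be cancelled on the component for \<open>\<mu>\<close> when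
  \<open>\<mu> h \<noteq> \<nu> h\<close>.
\<close>

lemma weights_independent:
  fixes \<tau> :: "'i \<Rightarrow> 'v::complex_vector \<Rightarrow> 'v"
  assumes "finite F"
    and lin: "\<And>h. h \<in> A \<Longrightarrow> clinear (\<tau> h)"
    and dist: "\<And>\<mu> \<nu>. \<mu> \<in> F \<Longrightarrow> \<nu> \<in> F \<Longrightarrow> \<mu> \<noteq> \<nu> \<Longrightarrow> \<exists>h\<in>A. \<mu> h \<noteq> \<nu> h"
    and sub: "\<And>\<mu>. \<mu> \<in> F \<Longrightarrow> csubspace (W \<mu>)"
    and eig: "\<And>\<mu> h. \<mu> \<in> F \<Longrightarrow> h \<in> A \<Longrightarrow> W \<mu> \<subseteq> gen_eigen (\<tau> h) (\<mu> h)"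
    and stab: "\<And>\<mu> h x. \<mu> \<in> F \<Longrightarrow> h \<in> A \<Longrightarrow> x \<in> W \<mu> \<Longrightarrow> \<tau> h x \<in> W \<mu>"
    and N: "csubspace N" "\<And>h x. h \<in> A \<Longrightarrow> x \<in> N \<Longrightarrow> \<tau> h x \<in> N"
    and "\<And>\<mu>. \<mu> \<in> F \<Longrightarrow> x \<mu> \<in> W \<mu>" "(\<Sum>\<mu>\<in>F. x \<mu>) \<in> N" "\<mu> \<in> F"
  shows "x \<mu> \<in> N"
  using assms(1,3-6) assms(9-)
proof (induction F arbitrary: x \<mu> rule: finite_induct)
  case (insert \<nu> F)
  have *: "x \<mu> \<in> N" if \<mu>: "\<mu> \<in> F" for \<mu>
  proof -
    obtain h where h: "h \<in> A" "\<mu> h \<noteq> \<nu> h" using insert \<mu> by (metis insertCI)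
    note lh = clinear_shifted[OF lin[OF h(1)]] note ln = clinear_funpow[OF lh]
    have sh: "shifted (\<tau> h) a y \<in> W \<kappa>" if "y \<in> W \<kappa>" "\<kappa> \<in> insert \<nu> F" for a y \<kappa>
      using that insert.prems(2)[OF that(2)] insert.prems(4)[OF that(2) h(1) that(1)]
      by (simp add: shifted_def csubspace_diff csubspace_scale)
    have shn: "(shifted (\<tau> h) a ^^ n) y \<in> W \<kappa>" if "y \<in> W \<kappa>" "\<kappa> \<in> insert \<nu> F" for a n y \<kappa>
      using that by (induction n) (simp_all add: sh)
    have sN: "(shifted (\<tau> h) a ^^ n) y \<in> N" if "y \<in> N" for a n y
      using that N(2)[OF h(1)]
      by (induction n) (simp_all add: shifted_def csubspace_diff[OF N(1)] csubspace_scale[OF N(1)])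
    have "x \<nu> \<in> gen_eigen (\<tau> h) (\<nu> h)" using insert.prems(3)[OF _ h(1), of \<nu>] insert.prems(5)[of \<nu>] by auto
    then obtain n where n: "(shifted (\<tau> h) (\<nu> h) ^^ n) (x \<nu>) = 0" by (auto simp: gen_eigen_def)
    define y where "y \<kappa> = (shifted (\<tau> h) (\<nu> h) ^^ n) (x \<kappa>)" for \<kappa>
    have "(\<Sum>\<kappa>\<in>F. y \<kappa>) = (shifted (\<tau> h) (\<nu> h) ^^ n) (\<Sum>\<kappa>\<in>insert \<nu> F. x \<kappa>)"
      using insert.hyps n unfolding y_def by (simp add: clinear_add[OF ln] clinear_sum[OF ln])
    then have "(\<Sum>\<kappa>\<in>F. y \<kappa>) \<in> N" using sN insert.prems(6) by simp
    moreover have "y \<kappa> \<in> W \<kappa>" if "\<kappa> \<in> F" for \<kappa>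
      using that insert.prems(5) shn unfolding y_def by simp
    ultimately have "y \<mu> \<in> N" using insert.IH[of y \<mu>] insert.prems(1-4) \<mu> by simp
    moreover have "x \<mu> \<in> gen_eigen (\<tau> h) (\<mu> h)"
      using insert.prems(3)[OF _ h(1), of \<mu>] insert.prems(5)[of \<mu>] \<mu> by auto
    ultimately show ?thesis
      using shifted_inj_gen_eigen[OF lin[OF h(1)] N(1) N(2)[OF h(1)], of "\<nu> h" "\<mu> h" "x \<mu>" n] h(2)
      unfolding y_def by simp
  qed
  have "(\<Sum>\<kappa>\<in>insert \<nu> F. x \<kappa>) - (\<Sum>\<kappa>\<in>F. x \<kappa>) \<in> N"
    by (intro csubspace_diff[OF N(1)] csubspace_sum[OF N(1)] insert.prems(6) *)
  then have "x \<nu> \<in> N" using insert.hyps by simp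
  then show ?case using * insert.prems(7) by auto
qed simp

definition gen_weight :: "'i set \<Rightarrow> ('i \<Rightarrow> 'v \<Rightarrow> 'v) \<Rightarrow> ('i \<Rightarrow> complex) \<Rightarrow> 'v::complex_vector set"
  where "gen_weight A \<tau> \<mu> = {x. \<forall>h\<in>A. x \<in> gen_eigen (\<tau> h) (\<mu> h)}"

lemma csubspace_gen_weight:
  assumes "\<And>h. h \<in> A \<Longrightarrow> clinear (\<tau> h)" shows "csubspace (gen_weight A \<tau> \<mu>)"
  using csubspace_gen_eigen[OF assms]
  by (auto simp: gen_weight_def complex_vector.subspace_def)

text \<open>
  If some \<open>\<tau> h\<close> has two eigenvalues on \<open>M\<close>, then its generalized eigenspaces in \<open>M\<close> are proper
  stable subspaces, to which induction applies. Weights, being functions on \<open>A\<close>, are represented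
  by functions on the whole type that vanish outside \<open>A\<close>.
\<close>

lemma gen_weight_decomposition:
  fixes \<tau> :: "'i \<Rightarrow> 'v::complex_vector \<Rightarrow> 'v"
  assumes "cfinite_dim M"
    and lin: "\<And>h. h \<in> A \<Longrightarrow> clinear (\<tau> h)"
    and M: "\<And>h x. h \<in> A \<Longrightarrow> x \<in> M \<Longrightarrow> \<tau> h x \<in> M"
    and stab: "\<And>h k a x. h \<in> A \<Longrightarrow> k \<in> A \<Longrightarrow> x \<in> gen_eigen (\<tau> h) a \<Longrightarrow> \<tau> k x \<in> gen_eigen (\<tau> h) a"
  shows "M \<subseteq> cspan (\<Union>\<mu>\<in>{\<mu>. \<forall>h. h \<notin> A \<longrightarrow> \<mu> h = 0}. gen_weight A \<tau> \<mu> \<inter> M)"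
  using assms(1,3)
proof (induction rule: cfinite_dim_induct)
  case (less M)
  show ?case
  proof (cases "\<forall>h\<in>A. \<exists>a. M \<subseteq> gen_eigen (\<tau> h) a")
    case True
    then obtain \<mu> where \<mu>: "\<And>h. h \<in> A \<Longrightarrow> M \<subseteq> gen_eigen (\<tau> h) (\<mu> h)" by metis
    define \<mu>' where "\<mu>' h = (if h \<in> A then \<mu> h else 0)" for h
    have "M \<subseteq> gen_weight A \<tau> \<mu>' \<inter> M" using \<mu> by (auto simp: gen_weight_def \<mu>'_def)
    also have "\<dots> \<subseteq> (\<Union>\<mu>\<in>{\<mu>. \<forall>h. h \<notin> A \<longrightarrow> \<mu> h = 0}. gen_weight A \<tau> \<mu> \<inter> M)"
      by (rule UN_upper[of \<mu>' _ "\<lambda>\<mu>. gen_weight A \<tau> \<mu> \<inter> M"]) (simp add: \<mu>'_def)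
    also have "\<dots> \<subseteq> cspan \<dots>" by (rule complex_vector.span_superset)
    finally show ?thesis .
  next
    case False
    then obtain h where h: "h \<in> A" "\<And>a. \<not> M \<subseteq> gen_eigen (\<tau> h) a" by blast
    have "gen_eigen (\<tau> h) a \<inter> M \<subseteq> cspan (\<Union>\<mu>\<in>{\<mu>. \<forall>h. h \<notin> A \<longrightarrow> \<mu> h = 0}. gen_weight A \<tau> \<mu> \<inter> M)" for a
    proof -
      let ?N = "gen_eigen (\<tau> h) a \<inter> M"
      have "csubspace ?N" "?N \<subset> M"
        using h csubspace_Int[OF csubspace_gen_eigen[OF lin[OF h(1)]] cfinite_dim_csubspace[OF less.hyps]]
        by auto
      moreover have "\<tau> k x \<in> ?N" if "k \<in> A" "x \<in> ?N" for k x
        using stab[OF h(1) that(1)] less.prems that by simp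
      ultimately have "?N \<subseteq> cspan (\<Union>\<mu>\<in>{\<mu>. \<forall>h. h \<notin> A \<longrightarrow> \<mu> h = 0}. gen_weight A \<tau> \<mu> \<inter> ?N)"
        by (rule less.IH)
      also have "\<dots> \<subseteq> cspan (\<Union>\<mu>\<in>{\<mu>. \<forall>h. h \<notin> A \<longrightarrow> \<mu> h = 0}. gen_weight A \<tau> \<mu> \<inter> M)"
        by (intro cspan_mono UN_mono) auto
      finally show ?thesis .
    qed
    then have "cspan (\<Union>a. gen_eigen (\<tau> h) a \<inter> M) \<subseteq> cspan (\<Union>\<mu>\<in>{\<mu>. \<forall>h. h \<notin> A \<longrightarrow> \<mu> h = 0}. gen_weight A \<tau> \<mu> \<inter> M)"
      by (intro cspan_minimal UN_least csubspace_cspan)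
    then show ?thesis
      using gen_eigen_decomposition[OF lin[OF h(1)] less.hyps less.prems[OF h(1)]] by blast
  qed
qed

lemma finite_weights:
  fixes \<tau> :: "'i \<Rightarrow> 'v::complex_vector \<Rightarrow> 'v"
  assumes M: "cfinite_dim M"
    and lin: "\<And>h. h \<in> A \<Longrightarrow> clinear (\<tau> h)"
    and sub: "\<And>\<mu>. \<mu> \<in> \<Lambda> \<Longrightarrow> csubspace (W \<mu>)"
    and eig: "\<And>\<mu> h. \<mu> \<in> \<Lambda> \<Longrightarrow> h \<in> A \<Longrightarrow> W \<mu> \<subseteq> gen_eigen (\<tau> h) (\<mu> h)"
    and stab: "\<And>\<mu> h x. \<mu> \<in> \<Lambda> \<Longrightarrow> h \<in> A \<Longrightarrow> x \<in> W \<mu> \<Longrightarrow> \<tau> h x \<in> W \<mu>"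
    and \<Lambda>: "\<Lambda> \<subseteq> {\<mu>. \<forall>h. h \<notin> A \<longrightarrow> \<mu> h = 0}" "\<And>\<mu>. \<mu> \<in> \<Lambda> \<Longrightarrow> W \<mu> \<inter> M \<noteq> {0}"
  shows "finite \<Lambda>"
proof -
  have "\<exists>x. x \<in> W \<mu> \<inter> M \<and> x \<noteq> 0" if "\<mu> \<in> \<Lambda>" for \<mu>
    using that \<Lambda>(2) sub csubspace_0[OF cfinite_dim_csubspace[OF M]] csubspace_0[OF sub] by blast
  then obtain x where x: "\<And>\<mu>. \<mu> \<in> \<Lambda> \<Longrightarrow> x \<mu> \<in> W \<mu>" "\<And>\<mu>. \<mu> \<in> \<Lambda> \<Longrightarrow> x \<mu> \<in> M" "\<And>\<mu>. \<mu> \<in> \<Lambda> \<Longrightarrow> x \<mu> \<noteq> 0"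
    by (metis IntD1 IntD2)
  have dist: "\<exists>h\<in>A. \<mu> h \<noteq> \<nu> h" if mn: "\<mu> \<in> \<Lambda>" "\<nu> \<in> \<Lambda>" "\<mu> \<noteq> \<nu>" for \<mu> \<nu>
  proof -
    obtain h where h: "\<mu> h \<noteq> \<nu> h" using mn(3) by blast
    have "\<mu> h = 0 \<and> \<nu> h = 0" if "h \<notin> A" using \<Lambda>(1) mn(1,2) that by blast
    then show ?thesis using h by metis
  qed
  have ind: "c \<mu> = 0" if "finite F" "F \<subseteq> \<Lambda>" "(\<Sum>\<mu>\<in>F. c \<mu> *\<^sub>C x \<mu>) = 0" "\<mu> \<in> F" for F c \<mu>
  proof -
    have sF: "\<And>\<mu>. \<mu> \<in> F \<Longrightarrow> \<mu> \<in> \<Lambda>" using that(2) by auto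
    have "c \<mu> *\<^sub>C x \<mu> \<in> {0}"
    proof (rule weights_independent[of F A \<tau> W "{0}" "\<lambda>\<mu>. c \<mu> *\<^sub>C x \<mu>"])
      show "c \<mu> *\<^sub>C x \<mu> \<in> W \<mu>" if "\<mu> \<in> F" for \<mu>
        using x(1)[OF sF[OF that]] by (rule csubspace_scale[OF sub[OF sF[OF that]]])
      show "(\<Sum>\<mu>\<in>F. c \<mu> *\<^sub>C x \<mu>) \<in> {0}" using that(3) by simp
      show "\<tau> h x \<in> {0}" if "h \<in> A" "x \<in> {0}" for h x using that clinear_0[OF lin[OF that(1)]] by simp
    qed (use that(1,4) lin dist sub eig stab sF in auto)
    then show ?thesis using x(3)[OF sF[OF that(4)]] by simp
  qed
  have inj: "inj_on x \<Lambda>"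
  proof (rule inj_onI, rule ccontr)
    fix \<mu> \<nu> assume *: "\<mu> \<in> \<Lambda>" "\<nu> \<in> \<Lambda>" "x \<mu> = x \<nu>" "\<mu> \<noteq> \<nu>"
    have "(\<Sum>\<kappa>\<in>{\<mu>, \<nu>}. (if \<kappa> = \<mu> then 1 else - 1) *\<^sub>C x \<kappa>) = 0"
      using * by (simp add: scaleC_one)
    then have "(if \<mu> = \<mu> then 1 else - 1 :: complex) = 0"
      using * by (intro ind[of "{\<mu>, \<nu>}" "\<lambda>\<kappa>. if \<kappa> = \<mu> then 1 else - 1" \<mu>]) auto
    then show False by simp
  qed
  have "\<not> cdependent (x ` \<Lambda>)"
  proof
    assume "cdependent (x ` \<Lambda>)"
    then obtain t u v where t: "finite t" "t \<subseteq> x ` \<Lambda>" "(\<Sum>v\<in>t. u v *\<^sub>C v) = 0" "v \<in> t" "u v \<noteq> 0"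
      unfolding complex_vector.dependent_explicit by blast
    obtain F where F: "F \<subseteq> \<Lambda>" "finite F" "t = x ` F" using t(1,2) by (meson finite_subset_image)
    then have "(\<Sum>\<mu>\<in>F. u (x \<mu>) *\<^sub>C x \<mu>) = 0"
      using t(3) inj by (simp add: sum.reindex inj_on_subset)
    then have "u (x \<mu>) = 0" if "\<mu> \<in> F" for \<mu>
      using ind[OF F(2,1), of "\<lambda>\<mu>. u (x \<mu>)"] that by simp
    then show False using t(4,5) F(3) by auto
  qed
  then have "finite (x ` \<Lambda>)" using independent_in_cfinite_dim(1)[OF M, of "x ` \<Lambda>"] x(2) by blast
  then show ?thesis using inj finite_imageD by blast
qed

subsection \<open>Traces on stable subspaces\<close>

text \<open>
  The trace of the restriction of \<open>T\<close> to a subspace \<open>M\<close> that it preserves; for the whole space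
  the right-hand side is literally that of \<^const>\<open>ctrace\<close>, so the Killing form is such a trace.
\<close>

definition trace_on :: "'v::complex_vector set \<Rightarrow> ('v \<Rightarrow> 'v) \<Rightarrow> complex"
  where "trace_on M T =
    (let E = (SOME E. \<not> cdependent E \<and> cspan E = M) in \<Sum>e\<in>E. crepresentation E (T e) e)"

text \<open>
  Both sides are the sum of all products of a matrix entry of \<open>A\<close> and the transposed entry of \<open>B\<close>.
  With \<open>B = id\<close> and two bases of the same space this is the independence of the basis.
\<close>

lemma trace_cyclic_bases:
  assumes E: "finite E" "\<not> cdependent E" and F: "finite F" "\<not> cdependent F"
    and A: "clinear A" "\<And>e. e \<in> E \<Longrightarrow> A e \<in> cspan F"
    and B: "clinear B" "\<And>f. f \<in> F \<Longrightarrow> B f \<in> cspan E"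
  shows "(\<Sum>e\<in>E. crepresentation E (B (A e)) e) = (\<Sum>f\<in>F. crepresentation F (A (B f)) f)"
proof -
  have *: "crepresentation E (B (A e)) e' = (\<Sum>f\<in>F. crepresentation F (A e) f * crepresentation E (B f) e')"
    if E: "finite E" "\<not> cdependent E" and F: "finite F" "\<not> cdependent F"
    and A: "A e \<in> cspan F"
    and B: "clinear B" "\<And>f. f \<in> F \<Longrightarrow> B f \<in> cspan E" for e e' E F A and B :: "'c::complex_vector \<Rightarrow> 'd::complex_vector"
  proof -
    have "A e = (\<Sum>f\<in>F. crepresentation F (A e) f *\<^sub>C f)"
      using complex_vector.sum_representation_eq[OF F(2) A F(1)] by simp
    then have "B (A e) = (\<Sum>f\<in>F. crepresentation F (A e) f *\<^sub>C B f)"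
      by (metis (no_types, lifting) B(1) clinear_scale clinear_sum sum.cong)
    then show ?thesis
      using B(2) E
      by (simp add: complex_vector.representation_sum complex_vector.representation_scale cspan_scale)
  qed
  have "(\<Sum>e\<in>E. crepresentation E (B (A e)) e)
      = (\<Sum>e\<in>E. \<Sum>f\<in>F. crepresentation F (A e) f * crepresentation E (B f) e)"
    by (intro sum.cong refl *) (use assms in auto)
  also have "\<dots> = (\<Sum>f\<in>F. \<Sum>e\<in>E. crepresentation E (B f) e * crepresentation F (A e) f)"
    by (subst sum.swap) (simp add: mult.commute)
  also have "\<dots> = (\<Sum>f\<in>F. crepresentation F (A (B f)) f)"
    by (intro sum.cong refl *[symmetric]) (use assms in auto)
  finally show ?thesis .
qed

lemma trace_on_basis:
  assumes E: "finite E" "\<not> cdependent E" "cspan E = M"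
    and T: "clinear T" "\<And>x. x \<in> M \<Longrightarrow> T x \<in> M"
  shows "trace_on M T = (\<Sum>e\<in>E. crepresentation E (T e) e)"
proof -
  define F where "F = (SOME E. \<not> cdependent E \<and> cspan E = M)"
  have F: "\<not> cdependent F" "cspan F = M"
    using someI[of "\<lambda>E. \<not> cdependent E \<and> cspan E = M" E] E by (auto simp: F_def)
  have FM: "F \<subseteq> M" "E \<subseteq> M" using F E complex_vector.span_superset by blast+
  then have "finite F" using independent_in_cfinite_dim(1)[of M F] E F by (auto simp: cfinite_dim_def)
  then have "(\<Sum>e\<in>F. crepresentation F (id (T e)) e) = (\<Sum>f\<in>E. crepresentation E (T (id f)) f)"
    using E F T FM by (intro trace_cyclic_bases) auto
  then show ?thesis by (simp add: trace_on_def F_def)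
qed

lemma trace_on_cyclic:
  assumes M: "cfinite_dim M" and N: "cfinite_dim N"
    and A: "clinear A" "\<And>x. x \<in> M \<Longrightarrow> A x \<in> N"
    and B: "clinear B" "\<And>x. x \<in> N \<Longrightarrow> B x \<in> M"
  shows "trace_on M (\<lambda>x. B (A x)) = trace_on N (\<lambda>x. A (B x))"
proof -
  obtain E where E: "finite E" "\<not> cdependent E" "cspan E = M" using cfinite_dim_basis[OF M] by metis
  obtain F where F: "finite F" "\<not> cdependent F" "cspan F = N" using cfinite_dim_basis[OF N] by metis
  have EF: "E \<subseteq> M" "F \<subseteq> N" using E F complex_vector.span_superset by blast+
  have "trace_on M (\<lambda>x. B (A x)) = (\<Sum>e\<in>E. crepresentation E (B (A e)) e)"
    using A B by (intro trace_on_basis E clinear_compose[OF B(1) A(1)]) auto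
  also have "\<dots> = (\<Sum>f\<in>F. crepresentation F (A (B f)) f)"
    using E F EF A B by (intro trace_cyclic_bases) auto
  also have "\<dots> = trace_on N (\<lambda>x. A (B x))"
    using A B by (intro trace_on_basis[symmetric] F clinear_compose[OF A(1) B(1)]) auto
  finally show ?thesis .
qed

lemma trace_on_cong:
  assumes "cfinite_dim M" "\<And>x. x \<in> M \<Longrightarrow> S x = T x"
  shows "trace_on M S = trace_on M T"
proof -
  define F where "F = (SOME E. \<not> cdependent E \<and> cspan E = M)"
  obtain E where E: "\<not> cdependent E \<and> cspan E = M" using cfinite_dim_basis[OF assms(1)] by metis
  then have "cspan F = M"
    using someI[of "\<lambda>E. \<not> cdependent E \<and> cspan E = M" E] by (auto simp: F_def)
  then have "F \<subseteq> M" using complex_vector.span_superset by blast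
  then show ?thesis unfolding trace_on_def F_def[symmetric] Let_def
    by (intro sum.cong refl) (use assms(2) in auto)
qed

lemma trace_on_add:
  assumes "cfinite_dim M" "clinear S" "clinear T" "\<And>x. x \<in> M \<Longrightarrow> S x \<in> M" "\<And>x. x \<in> M \<Longrightarrow> T x \<in> M"
  shows "trace_on M (\<lambda>x. S x + T x) = trace_on M S + trace_on M T"
proof -
  obtain E where E: "finite E" "\<not> cdependent E" "cspan E = M" using cfinite_dim_basis[OF assms(1)] by metis
  have EM: "E \<subseteq> M" using E complex_vector.span_superset by blast
  have "trace_on M (\<lambda>x. S x + T x) = (\<Sum>e\<in>E. crepresentation E (S e + T e) e)"
    using assms by (intro trace_on_basis E clinear_plus) (auto intro!: csubspace_add cfinite_dim_csubspace)
  also have "\<dots> = trace_on M S + trace_on M T"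
    using EM E assms
    by (simp add: trace_on_basis[OF E] complex_vector.representation_add sum.distrib[symmetric] subset_iff)
  finally show ?thesis .
qed

lemma trace_on_scale:
  assumes "cfinite_dim M" "clinear S" "\<And>x. x \<in> M \<Longrightarrow> S x \<in> M"
  shows "trace_on M (\<lambda>x. c *\<^sub>C S x) = c * trace_on M S"
proof -
  obtain E where E: "finite E" "\<not> cdependent E" "cspan E = M" using cfinite_dim_basis[OF assms(1)] by metis
  have EM: "E \<subseteq> M" using E complex_vector.span_superset by blast
  have "trace_on M (\<lambda>x. c *\<^sub>C S x) = (\<Sum>e\<in>E. crepresentation E (c *\<^sub>C S e) e)"
    using assms by (intro trace_on_basis E clinear_scaled) (auto intro!: csubspace_scale cfinite_dim_csubspace)
  also have "\<dots> = c * trace_on M S"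
    using EM E assms
    by (simp add: trace_on_basis[OF E] complex_vector.representation_scale sum_distrib_left subset_iff)
  finally show ?thesis .
qed

lemma trace_on_diff:
  assumes "cfinite_dim M" "clinear S" "clinear T" "\<And>x. x \<in> M \<Longrightarrow> S x \<in> M" "\<And>x. x \<in> M \<Longrightarrow> T x \<in> M"
  shows "trace_on M (\<lambda>x. S x - T x) = trace_on M S - trace_on M T"
proof -
  have M: "csubspace M" using assms(1) cfinite_dim_csubspace by blast
  have "trace_on M (\<lambda>x. S x + (- 1) *\<^sub>C T x) = trace_on M S + trace_on M (\<lambda>x. (- 1) *\<^sub>C T x)"
    by (rule trace_on_add[OF assms(1,2) clinear_scaled[OF assms(3)] assms(4)])
      (assumption, rule csubspace_scale[OF M assms(5)])
  then show ?thesis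
    using trace_on_scale[OF assms(1,3,5), of "- 1"] by (simp add: scaleC_one)
qed

lemma trace_on_id:
  assumes "cfinite_dim M"
  shows "trace_on M (\<lambda>x. x) = of_nat (complex_vector.dim M)"
proof -
  obtain E where E: "finite E" "\<not> cdependent E" "cspan E = M" using cfinite_dim_basis[OF assms(1)] by metis
  have "trace_on M (\<lambda>x. x) = (\<Sum>e\<in>E. crepresentation E e e)"
    by (intro trace_on_basis E) auto
  also have "\<dots> = of_nat (card E)"
    using E(2) by (simp add: complex_vector.representation_basis)
  finally show ?thesis using complex_vector.dim_span_eq_card_independent[OF E(2)] E(3) by simp
qed

lemma trace_on_zero_space: "trace_on {0} T = 0"
proof -
  define F where "F = (SOME E. \<not> cdependent E \<and> cspan E = {0::'a})"
  have "\<not> cdependent {} \<and> cspan {} = {0::'a}" using complex_vector.independent_empty by simp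
  then have "\<not> cdependent F \<and> cspan F = {0}" unfolding F_def by (rule someI)
  then have "F = {}"
    using complex_vector.dependent_zero[of F] complex_vector.span_superset[of F] by (auto simp: subset_iff)
  then show ?thesis by (simp add: trace_on_def F_def)
qed

lemma uniformly_nilpotent:
  fixes T :: "'v::complex_vector \<Rightarrow> 'v"
  assumes M: "cfinite_dim M" and T: "clinear T" and nil: "\<And>x. x \<in> M \<Longrightarrow> \<exists>n. (T ^^ n) x = 0"
  shows "\<exists>k. \<forall>x\<in>M. (T ^^ k) x = 0"
proof -
  obtain E where E: "finite E" "\<not> cdependent E" "cspan E = M" using cfinite_dim_basis[OF M] by metis
  have "\<forall>e\<in>E. \<exists>n. (T ^^ n) e = 0" using E nil complex_vector.span_superset by blast
  then obtain n where n: "\<And>e. e \<in> E \<Longrightarrow> (T ^^ n e) e = 0" by metis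
  define k where "k = (\<Sum>e\<in>E. n e)"
  have "(T ^^ k) e = 0" if "e \<in> E" for e
  proof -
    have "n e \<le> k" unfolding k_def using that E by (intro member_le_sum) auto
    then have "(T ^^ k) e = (T ^^ (k - n e)) ((T ^^ n e) e)"
      by (metis comp_apply funpow_add le_add_diff_inverse2)
    then show ?thesis using n[OF that] clinear_0[OF clinear_funpow[OF T]] by simp
  qed
  then have "(T ^^ k) x = 0" if "x \<in> M" for x
    using clinear_image_cspan[OF clinear_funpow[OF T, of k], of x E "{0}"] E that by simp
  then show ?thesis by blast
qed

text \<open>
  A nilpotent operator maps \<open>M\<close> into the smaller space \<open>T M\<close>, and by cyclicity it has the same
  trace on both spaces.
\<close>

lemma trace_on_nilpotent:
  assumes "cfinite_dim M" and T: "clinear T" and "\<And>x. x \<in> M \<Longrightarrow> T x \<in> M"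
    and "\<And>x. x \<in> M \<Longrightarrow> \<exists>n. (T ^^ n) x = 0"
  shows "trace_on M T = 0"
  using assms(1,3,4)
proof (induction rule: cfinite_dim_induct)
  case (less M)
  note M = cfinite_dim_csubspace[OF less.hyps]
  have TM: "csubspace (T ` M)" by (rule csubspace_image[OF T M])
  show ?case
  proof (cases "T ` M = M")
    case True
    obtain k where "\<And>x. x \<in> M \<Longrightarrow> (T ^^ k) x = 0"
      using uniformly_nilpotent[OF less.hyps T less.prems(2)] by metis
    moreover have "(T ^^ k) ` M = M"
      using True by (induction k) (simp_all only: funpow.simps image_comp[symmetric] image_id id_apply)
    ultimately have "M \<subseteq> {0}" by auto
    then have "M = {0}" using csubspace_0[OF M] by auto
    then show ?thesis by (simp add: trace_on_zero_space)
  next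
    case False
    then have lt: "T ` M \<subset> M" using less.prems by auto
    then have "cfinite_dim (T ` M)" using cfinite_dim_subspace[OF less.hyps TM] by auto
    then have "trace_on M (\<lambda>x. id (T x)) = trace_on (T ` M) (\<lambda>x. T (id x))"
      using lt by (intro trace_on_cyclic less.hyps T clinear_id) auto
    also have "\<dots> = 0" using less.IH[OF TM lt] less.prems lt by fastforce
    finally show ?thesis by simp
  qed
qed

lemma trace_on_gen_eigen:
  assumes M: "cfinite_dim M" and T: "clinear T" and TM: "\<And>x. x \<in> M \<Longrightarrow> T x \<in> M"
    and "M \<subseteq> gen_eigen T a"
  shows "trace_on M T = a * of_nat (complex_vector.dim M)"
proof -
  note sM = cfinite_dim_csubspace[OF M]
  have 1: "trace_on M (shifted T a) = 0"
    using assms sM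
    by (intro trace_on_nilpotent clinear_shifted) (auto simp: shifted_def gen_eigen_def intro!: csubspace_diff csubspace_scale)
  have "trace_on M T = trace_on M (\<lambda>x. shifted T a x + a *\<^sub>C x)"
    by (rule trace_on_cong[OF M]) (simp add: shifted_def)
  also have "\<dots> = trace_on M (shifted T a) + trace_on M (\<lambda>x. a *\<^sub>C x)"
    using TM sM by (intro trace_on_add M clinear_shifted T clinear_scaled clinear_id)
      (auto simp: shifted_def intro!: csubspace_diff csubspace_scale)
  also have "trace_on M (\<lambda>x. a *\<^sub>C x) = a * trace_on M (\<lambda>x. x)"
    by (rule trace_on_scale[OF M]) auto
  finally show ?thesis using 1 trace_on_id[OF M] by simp
qed

text \<open>
  The union of bases of the summands is a basis of the sum, and the coefficient of a basis vector
  of one summand can be computed inside that summand.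
\<close>

lemma trace_on_direct_sum:
  assumes F: "finite F" and fd: "\<And>i. i \<in> F \<Longrightarrow> cfinite_dim (M i)"
    and ind: "\<And>x i. (\<And>i. i \<in> F \<Longrightarrow> x i \<in> M i) \<Longrightarrow> (\<Sum>i\<in>F. x i) = 0 \<Longrightarrow> i \<in> F \<Longrightarrow> x i = 0"
    and T: "clinear T" "\<And>i x. i \<in> F \<Longrightarrow> x \<in> M i \<Longrightarrow> T x \<in> M i"
  shows "trace_on (cspan (\<Union>i\<in>F. M i)) T = (\<Sum>i\<in>F. trace_on (M i) T)"
proof -
  have sub: "csubspace (M i)" if "i \<in> F" for i using fd[OF that] by (rule cfinite_dim_csubspace)
  have "\<forall>i\<in>F. \<exists>E. finite E \<and> \<not> cdependent E \<and> cspan E = M i"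
    using fd cfinite_dim_basis by metis
  then obtain E where E: "\<And>i. i \<in> F \<Longrightarrow> finite (E i)" "\<And>i. i \<in> F \<Longrightarrow> \<not> cdependent (E i)"
    "\<And>i. i \<in> F \<Longrightarrow> cspan (E i) = M i" by metis
  have EM: "e \<in> M i" if "e \<in> E i" "i \<in> F" for e i using E(3) that by (metis cspan_base)
  have disj: "E i \<inter> E j = {}" if ij: "i \<in> F" "j \<in> F" "i \<noteq> j" for i j
  proof (rule ccontr)
    assume "E i \<inter> E j \<noteq> {}"
    then obtain e where e: "e \<in> E i" "e \<in> E j" by auto
    define x where "x k = (if k = i then e else if k = j then - e else 0)" for k
    have "(\<Sum>k\<in>F. x k) = (\<Sum>k\<in>F. (if k = i then e else 0) - (if k = j then e else 0))"
      by (rule sum.cong) (use ij in \<open>auto simp: x_def\<close>)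
    also have "\<dots> = 0" using F ij by (simp add: sum_subtractf)
    finally have "(\<Sum>k\<in>F. x k) = 0" .
    moreover have "x k \<in> M k" if "k \<in> F" for k
      using EM e ij that sub[OF that] by (auto simp: x_def csubspace_0 intro!: csubspace_neg)
    ultimately have "x i = 0" using ind ij by blast
    then have "e = 0" by (simp add: x_def)
    then show False using E(2)[OF ij(1)] e complex_vector.dependent_zero by blast
  qed
  let ?E = "\<Union>i\<in>F. E i"
  have finE: "finite ?E" using F E by auto
  have sumE: "(\<Sum>e\<in>?E. g e) = (\<Sum>i\<in>F. \<Sum>e\<in>E i. g e)" for g :: "_ \<Rightarrow> 'z::comm_monoid_add"
    by (rule sum.UNION_disjoint) (use F E disj in auto)
  have indE: "\<not> cdependent ?E"
  proof
    assume "cdependent ?E"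
    then obtain u v where u: "(\<Sum>v\<in>?E. u v *\<^sub>C v) = 0" "v \<in> ?E" "u v \<noteq> 0"
      using complex_vector.dependent_finite[OF finE] by auto
    define x where "x i = (\<Sum>v\<in>E i. u v *\<^sub>C v)" for i
    have "x i \<in> M i" if "i \<in> F" for i
      unfolding x_def using that by (intro csubspace_sum[OF sub] csubspace_scale[OF sub] EM)
    moreover have "(\<Sum>i\<in>F. x i) = 0" using u(1) unfolding x_def sumE by simp
    moreover obtain i where i: "i \<in> F" "v \<in> E i" using u(2) by auto
    ultimately have "x i = 0" using ind by blast
    then have "cdependent (E i)"
      using i u(3) complex_vector.dependent_finite[OF E(1)[OF i(1)]] unfolding x_def by blast
    then show False using E(2) i by blast
  qed
  have sp: "cspan ?E = cspan (\<Union>i\<in>F. M i)"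
  proof
    show "cspan ?E \<subseteq> cspan (\<Union>i\<in>F. M i)"
      by (rule cspan_mono, rule UN_mono) (use EM in auto)
    have "M i \<subseteq> cspan ?E" if "i \<in> F" for i
      unfolding E(3)[OF that, symmetric] by (rule cspan_mono, rule UN_upper[OF that])
    then show "cspan (\<Union>i\<in>F. M i) \<subseteq> cspan ?E"
      by (intro cspan_minimal UN_least csubspace_cspan)
  qed
  have TM: "T x \<in> cspan (\<Union>i\<in>F. M i)" if "x \<in> cspan (\<Union>i\<in>F. M i)" for x
  proof (rule clinear_image_cspan[OF T(1) that _ csubspace_cspan])
    fix y assume "y \<in> (\<Union>i\<in>F. M i)"
    then have "T y \<in> (\<Union>i\<in>F. M i)" using T(2) by blast
    then show "T y \<in> cspan (\<Union>i\<in>F. M i)" by (rule cspan_base)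
  qed
  have "trace_on (cspan (\<Union>i\<in>F. M i)) T = (\<Sum>e\<in>?E. crepresentation ?E (T e) e)"
    by (rule trace_on_basis[OF finE indE sp T(1) TM])
  also have "\<dots> = (\<Sum>i\<in>F. \<Sum>e\<in>E i. crepresentation ?E (T e) e)" by (rule sumE)
  also have "\<dots> = (\<Sum>i\<in>F. \<Sum>e\<in>E i. crepresentation (E i) (T e) e)"
  proof (intro sum.cong refl)
    fix i e assume ie: "i \<in> F" "e \<in> E i"
    have "T e \<in> cspan (E i)" using E(3) T(2) EM ie by simp
    then have "crepresentation ?E (T e) = crepresentation (E i) (T e)"
      using ie by (intro complex_vector.representation_extend indE) auto
    then show "crepresentation ?E (T e) e = crepresentation (E i) (T e) e" by simp
  qed
  also have "\<dots> = (\<Sum>i\<in>F. trace_on (M i) T)"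
    by (intro sum.cong refl trace_on_basis[symmetric] E T(1) T(2))
  finally show ?thesis .
qed

section \<open>Lie algebras\<close>

lemma clinear_bracket_right: "clinear (bracket x)" for x :: "'g::lie_algebra"
  by (rule clinearI) (simp_all add: bracket_add_right bracket_scale_right)

lemma clinear_bracket_left: "clinear (\<lambda>x. bracket x y)" for y :: "'g::lie_algebra"
  by (rule clinearI) (simp_all add: bracket_add_left bracket_scale_left)

lemmas bracket_0_left [simp] = clinear_0[OF clinear_bracket_left]
  and bracket_0_right [simp] = clinear_0[OF clinear_bracket_right]
  and bracket_diff_left = clinear_diff[OF clinear_bracket_left]
  and bracket_diff_right = clinear_diff[OF clinear_bracket_right]
  and bracket_uminus_right = clinear_uminus[OF clinear_bracket_right]

lemma bracket_antisym: "bracket x y = - bracket y x" for x y :: "'g::lie_algebra"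
  using bracket_self[of "x + y"] bracket_self[of x] bracket_self[of y]
  by (simp add: bracket_add_left bracket_add_right eq_neg_iff_add_eq_0 add.commute)

lemma bracket_derivation:
  "bracket x (bracket y z) = bracket (bracket x y) z + bracket y (bracket x z)"
  for x y z :: "'g::lie_algebra"
proof -
  have "bracket y (bracket z x) = - bracket y (bracket x z)"
    by (subst bracket_antisym[of z x]) (rule bracket_uminus_right)
  moreover have "bracket z (bracket x y) = - bracket (bracket x y) z" by (rule bracket_antisym)
  ultimately show ?thesis using jacobi[of x y z] by (simp add: algebra_simps)
qed

lemma bracket_of_bracket:
  "bracket (bracket x y) z = bracket x (bracket y z) - bracket y (bracket x z)"
  for x y z :: "'g::lie_algebra"
  using bracket_derivation[of x y z] by simp

lemma in_bracket_span: "x \<in> A \<Longrightarrow> y \<in> B \<Longrightarrow> bracket x y \<in> bracket_span A B"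
  unfolding bracket_span_def by (rule cspan_base) blast

lemma bracket_span_minimal:
  assumes "\<And>x y. x \<in> A \<Longrightarrow> y \<in> B \<Longrightarrow> bracket x y \<in> W" "csubspace W"
  shows "bracket_span A B \<subseteq> W"
  unfolding bracket_span_def by (rule cspan_minimal) (use assms in auto)

lemma csubspace_bracket_span [simp]: "csubspace (bracket_span A B)"
  unfolding bracket_span_def by simp

lemma bracket_span_mono: "A \<subseteq> A' \<Longrightarrow> B \<subseteq> B' \<Longrightarrow> bracket_span A B \<subseteq> bracket_span A' B'"
  unfolding bracket_span_def by (rule cspan_mono) blast

lemma bracket_cspan_closed:
  assumes x: "x \<in> cspan A" and y: "y \<in> cspan B"
    and closed: "\<And>a b. a \<in> A \<Longrightarrow> b \<in> B \<Longrightarrow> bracket a b \<in> W" and W: "csubspace W"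
  shows "bracket x y \<in> W"
proof -
  have "bracket a y \<in> W" if "a \<in> A" for a
    by (rule clinear_image_cspan[OF clinear_bracket_right y closed[OF that] W])
  then show ?thesis by (rule clinear_image_cspan[OF clinear_bracket_left x _ W])
qed

text \<open>
  By the derivation rule \<open>(ad h - a - b) [x, z] = [(ad h - a) x, z] + [x, (ad h - b) z]\<close>, so a
  double induction on the nilpotency orders applies.
\<close>

lemma gen_eigen_bracket:
  fixes h :: "'g::lie_algebra"
  assumes x: "x \<in> gen_eigen (bracket h) a" and z: "z \<in> gen_eigen (bracket h) b"
  shows "bracket x z \<in> gen_eigen (bracket h) (a + b)"
proof -
  note sub = csubspace_gen_eigen[OF clinear_bracket_right[of h]]
  have "\<forall>z\<in>gen_eigen (bracket h) b. bracket x z \<in> gen_eigen (bracket h) (a + b)"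
    using clinear_bracket_right x
  proof (induction rule: gen_eigen_induct)
    case zero
    show ?case using csubspace_0[OF sub] by simp
  next
    case (step x)
    show ?case
    proof
      fix z assume "z \<in> gen_eigen (bracket h) b"
      with clinear_bracket_right show "bracket x z \<in> gen_eigen (bracket h) (a + b)"
      proof (induction rule: gen_eigen_induct)
        case zero
        show ?case using csubspace_0[OF sub] by simp
      next
        case (step z)
        have "shifted (bracket h) (a + b) (bracket x z)
            = bracket (shifted (bracket h) a x) z + bracket x (shifted (bracket h) b z)"
          by (simp add: shifted_def bracket_derivation[of h x z] bracket_diff_left bracket_diff_right
              bracket_scale_left bracket_scale_right scaleC_add_left)
        also have "\<dots> \<in> gen_eigen (bracket h) (a + b)"
          using step \<open>\<forall>z\<in>gen_eigen (bracket h) b. bracket (shifted (bracket h) a x) z \<in> _\<close>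
          by (intro csubspace_add[OF sub]) auto
        finally show ?case using shifted_gen_eigen_iff[OF clinear_bracket_right] by blast
      qed
    qed
  qed
  then show ?thesis using z by blast
qed

subsection \<open>The Killing form\<close>

lemma killing_trace: "killing x y = trace_on UNIV (\<lambda>z. bracket x (bracket y z))"
  by (simp add: killing_def ctrace_def trace_on_def)

locale fd_lie_algebra =
  fixes ty :: "'g::lie_algebra itself"
  assumes fd: "cfinite_dim (UNIV :: 'g set)"
begin

lemma fd_subspace: "csubspace M \<Longrightarrow> cfinite_dim M" for M :: "'g set"
  using cfinite_dim_subspace[OF fd] by simp

lemma clinear_bracket2: "clinear (\<lambda>z. bracket x (bracket y z))" for x y :: 'g
  by (rule clinear_compose[OF clinear_bracket_right clinear_bracket_right])

lemma killing_add_left: "killing (x + y) z = killing x z + killing y z" for x y z :: 'g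
  unfolding killing_trace bracket_add_left
  by (rule trace_on_add[OF fd clinear_bracket2 clinear_bracket2]) auto

lemma killing_scale_left: "killing (c *\<^sub>C x) z = c * killing x z" for x z :: 'g
  unfolding killing_trace bracket_scale_left
  by (rule trace_on_scale[OF fd clinear_bracket2]) auto

lemma killing_sym: "killing x y = killing y x" for x y :: 'g
  unfolding killing_trace
  by (rule trace_on_cyclic[OF fd fd clinear_bracket_right _ clinear_bracket_right]) auto

lemma killing_add_right: "killing z (x + y) = killing z x + killing z y" for x y z :: 'g
  using killing_add_left killing_sym by metis

lemma killing_scale_right: "killing z (c *\<^sub>C x) = c * killing z x" for x z :: 'g
  using killing_scale_left killing_sym by metis

lemma killing_0 [simp]: "killing 0 x = 0" "killing x 0 = 0" for x :: 'g
  using killing_scale_left[of 0 0 x] killing_scale_right[of x 0 0] by simp_all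

lemma killing_diff_left: "killing (x - y) z = killing x z - killing y z" for x y z :: 'g
  using killing_add_left[of "x - y" y z] by simp

lemma killing_diff_right: "killing z (x - y) = killing z x - killing z y" for x y z :: 'g
  using killing_add_right[of z "x - y" y] by simp

lemma killing_uminus_left: "killing (- x) z = - killing x z" for x z :: 'g
  using killing_diff_left[of 0 x z] by simp

lemma killing_uminus_right: "killing z (- x) = - killing z x" for x z :: 'g
  using killing_diff_right[of z 0 x] by simp

lemma killing_invariant: "killing (bracket x y) z = killing x (bracket y z)" for x y z :: 'g
proof -
  have 3: "clinear (\<lambda>u. bracket x (bracket y (bracket z u)))" for x y z :: 'g
    by (rule clinear_compose[OF clinear_bracket_right clinear_bracket2])
  have "killing (bracket x y) z = trace_on UNIV (\<lambda>u. bracket x (bracket y (bracket z u)))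
      - trace_on UNIV (\<lambda>u. bracket y (bracket x (bracket z u)))"
    unfolding killing_trace bracket_of_bracket[of x y] by (rule trace_on_diff[OF fd 3 3]) auto
  also have "trace_on UNIV (\<lambda>u. bracket y (bracket x (bracket z u)))
      = trace_on UNIV (\<lambda>u. bracket x (bracket z (bracket y u)))"
    by (rule trace_on_cyclic[OF fd fd clinear_bracket2 _ clinear_bracket_right]) auto
  also have "trace_on UNIV (\<lambda>u. bracket x (bracket y (bracket z u))) - \<dots> = killing x (bracket y z)"
    unfolding killing_trace bracket_of_bracket[of y z] bracket_diff_right
    by (rule trace_on_diff[OF fd 3 3, symmetric]) auto
  finally show ?thesis .
qed

text \<open>
  Invariance gives \<open>B((ad h - a) x, y) + B(x, (ad h - b) y) = - (a + b) B(x, y)\<close>, and the left-hand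
  side vanishes by induction on the nilpotency orders.
\<close>

lemma killing_gen_eigen_orthogonal:
  fixes h :: 'g
  assumes x: "x \<in> gen_eigen (bracket h) a" and y: "y \<in> gen_eigen (bracket h) b" and "a + b \<noteq> 0"
  shows "killing x y = 0"
proof -
  have "\<forall>y\<in>gen_eigen (bracket h) b. killing x y = 0"
    using clinear_bracket_right x
  proof (induction rule: gen_eigen_induct)
    case (step x)
    show ?case
    proof
      fix y assume "y \<in> gen_eigen (bracket h) b"
      with clinear_bracket_right show "killing x y = 0"
      proof (induction rule: gen_eigen_induct)
        case (step y)
        have "killing (bracket h x) y = - killing x (bracket h y)"
          by (subst bracket_antisym) (simp add: killing_uminus_left killing_invariant)
        then have "killing (shifted (bracket h) a x) y + killing x (shifted (bracket h) b y)
            = - ((a + b) * killing x y)"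
          by (simp add: shifted_def killing_diff_left killing_diff_right killing_scale_left
              killing_scale_right algebra_simps)
        moreover have "killing (shifted (bracket h) a x) y = 0"
          using \<open>\<forall>y\<in>gen_eigen (bracket h) b. killing (shifted (bracket h) a x) y = 0\<close> step by blast
        ultimately show ?case using step \<open>a + b \<noteq> 0\<close> by simp
      qed simp
    qed
  qed simp
  then show ?thesis using y by blast
qed

subsection \<open>Engel's theorem\<close>

fun ad_series :: "'g set \<Rightarrow> 'g set \<Rightarrow> nat \<Rightarrow> 'g set"
  where
    "ad_series Q M 0 = M"
  | "ad_series Q M (Suc k) = bracket_span Q (ad_series Q M k)"

lemma csubspace_ad_series: "csubspace M \<Longrightarrow> csubspace (ad_series Q M k)"
  by (cases k) auto

text \<open>
  Starting in \<open>X\<close> outside \<open>N\<close> and applying elements of \<open>Q\<close> again and again without entering \<open>N\<close>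
  would produce a nonzero element of every term of the series.
\<close>

lemma ad_series_escape:
  assumes "ad_series Q M k = {0}" "0 \<in> N" "X \<subseteq> M"
    and esc: "\<And>x. x \<in> X \<Longrightarrow> x \<notin> N \<Longrightarrow> \<exists>a\<in>Q. bracket a x \<in> X \<and> bracket a x \<notin> N"
  shows "X \<subseteq> N"
proof (rule ccontr)
  assume "\<not> X \<subseteq> N"
  then have "\<exists>x. x \<in> X \<and> x \<notin> N \<and> x \<in> ad_series Q M k" for k
  proof (induction k)
    case 0
    then show ?case using assms(3) by auto
  next
    case (Suc k)
    then obtain x where x: "x \<in> X" "x \<notin> N" "x \<in> ad_series Q M k" by auto
    obtain a where "a \<in> Q" "bracket a x \<in> X" "bracket a x \<notin> N" using esc x by blast
    moreover have "bracket a x \<in> bracket_span Q (ad_series Q M k)"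
      by (rule in_bracket_span) fact+
    ultimately show ?case by auto
  qed
  then show False using assms(1,2) by (metis singletonD)
qed

text \<open>
  The operator \<open>ad w\<close> preserves every term \<open>L\<^sub>k\<close> of the series of \<open>Q\<close>, and modulo \<open>L\<^sub>k\<^sub>+\<^sub>1\<close> the
  elements of \<open>Q\<close> kill \<open>L\<^sub>k\<close>. So if \<open>(ad w)\<^sup>n = 0\<close> on \<open>M\<close>, then \<open>n\<close> steps of the series of
  \<open>Q + \<complex>w\<close> lead from \<open>L\<^sub>k\<close> into \<open>L\<^sub>k\<^sub>+\<^sub>1\<close>.
\<close>

lemma engel_step:
  assumes M: "csubspace M" and Q: "csubspace Q"
    and QM: "\<And>q z. q \<in> Q \<Longrightarrow> z \<in> M \<Longrightarrow> bracket q z \<in> M"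
    and wQ: "\<And>q. q \<in> Q \<Longrightarrow> bracket w q \<in> Q" and wM: "\<And>z. z \<in> M \<Longrightarrow> bracket w z \<in> M"
    and nil: "\<And>z. z \<in> M \<Longrightarrow> \<exists>n. (bracket w ^^ n) z = 0"
    and k: "ad_series Q M k = {0}"
  shows "\<exists>j. ad_series (cspan (insert w Q)) M j = {0}"
proof -
  let ?Q = "cspan (insert w Q)"
  let ?L = "ad_series Q M" and ?L' = "ad_series ?Q M"
  have sL: "csubspace (?L k)" "csubspace (?L' k)" for k by (intro csubspace_ad_series M)+
  have anti: "?L (Suc k) \<subseteq> ?L k" for k
  proof (induction k)
    case 0
    then show ?case using QM M by (auto intro: bracket_span_minimal[THEN subsetD])
  next
    case (Suc k)
    then show ?case by (auto intro: bracket_span_mono[THEN subsetD])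
  qed
  have wL: "bracket w z \<in> ?L k" if "z \<in> ?L k" for k z
    using that
  proof (induction k arbitrary: z)
    case 0
    then show ?case using wM by simp
  next
    case (Suc k)
    then have "z \<in> cspan {bracket x y |x y. x \<in> Q \<and> y \<in> ?L k}" by (simp add: bracket_span_def)
    then show ?case
    proof (rule clinear_image_cspan[OF clinear_bracket_right])
      fix u assume "u \<in> {bracket x y |x y. x \<in> Q \<and> y \<in> ?L k}"
      then obtain x y where u: "u = bracket x y" "x \<in> Q" "y \<in> ?L k" by auto
      have "bracket w u = bracket (bracket w x) y + bracket x (bracket w y)"
        unfolding u by (rule bracket_derivation)
      also have "\<dots> \<in> ?L (Suc k)"
        using u wQ Suc.IH by (intro csubspace_add[OF sL(1)]) (auto intro: in_bracket_span)
      finally show "bracket w u \<in> ?L (Suc k)" .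
    qed (rule sL)
  qed
  obtain n where n: "\<And>z. z \<in> M \<Longrightarrow> (bracket w ^^ n) z = 0"
    using uniformly_nilpotent[OF fd_subspace[OF M] clinear_bracket_right nil] by metis
  have LM: "?L k \<subseteq> M" for k
    by (induction k) (use anti in auto)
  have main: "\<exists>j. ?L' j \<subseteq> ?L k" for k
  proof (induction k)
    case 0
    show ?case by (rule exI[of _ 0]) simp
  next
    case (Suc k)
    then obtain j where j: "?L' j \<subseteq> ?L k" by auto
    have "?L' (j + i) \<subseteq> cspan (?L (Suc k) \<union> (bracket w ^^ i) ` ?L k)" for i
    proof (induction i)
      case 0
      then show ?case using j by (auto intro: cspan_base)
    next
      case (Suc i)
      let ?X = "?L (Suc k) \<union> (bracket w ^^ i) ` ?L k"
      let ?Y = "?L (Suc k) \<union> (bracket w ^^ Suc i) ` ?L k"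
      have wi: "(bracket w ^^ i) z \<in> ?L k" if "z \<in> ?L k" for z i
        using that by (induction i) (auto intro: wL)
      have XL: "cspan ?X \<subseteq> ?L k" using anti[of k] wi by (intro cspan_minimal sL) auto
      have br: "bracket a z \<in> cspan ?Y" if a: "a \<in> ?Q" and z: "z \<in> ?L' (j + i)" for a z
      proof (rule clinear_image_cspan[OF clinear_bracket_left a])
        fix q assume "q \<in> insert w Q"
        then consider "q = w" | "q \<in> Q" by auto
        then show "bracket q z \<in> cspan ?Y"
        proof cases
          case 1
          have "bracket w z \<in> cspan ?Y"
          proof (rule clinear_image_cspan[OF clinear_bracket_right])
            show "z \<in> cspan ?X" using Suc z by blast
            fix u assume "u \<in> ?X"
            then have "bracket w u \<in> ?Y" using wL[of u "Suc k"] by auto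
            then show "bracket w u \<in> cspan ?Y" by (rule cspan_base)
          qed (rule csubspace_cspan)
          then show ?thesis using 1 by simp
        next
          case 2
          have "z \<in> ?L k" using XL Suc z by blast
          then have "bracket q z \<in> ?L (Suc k)" using 2 by (auto intro: in_bracket_span)
          then show ?thesis by (intro cspan_base) simp
        qed
      qed (rule csubspace_cspan)
      have "bracket_span ?Q (?L' (j + i)) \<subseteq> cspan ?Y"
        by (rule bracket_span_minimal[OF br csubspace_cspan])
      then show ?case by simp
    qed
    from this[of n] have "?L' (j + n) \<subseteq> cspan (?L (Suc k) \<union> (bracket w ^^ n) ` ?L k)" .
    also have "\<dots> \<subseteq> ?L (Suc k)"
    proof (rule cspan_minimal[OF _ sL(1)], rule Un_least[OF subset_refl], rule image_subsetI)
      fix z assume "z \<in> ?L k"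
      then have "(bracket w ^^ n) z = 0" using n LM by blast
      then show "(bracket w ^^ n) z \<in> ?L (Suc k)" using csubspace_0[OF sL(1)] by metis
    qed
    finally show ?case by blast
  qed
  then obtain j where "?L' j \<subseteq> {0}" using k by metis
  then have "?L' j = {0}" using csubspace_0[OF sL(2)] by auto
  then show ?thesis by blast
qed

text \<open>
  Engel's theorem in Jacobson's form: it suffices that a bracket-closed spanning set
  consists of nilpotent operators. A maximal span of a bracket-closed subset on which the
  conclusion holds would otherwise be enlarged by one more element of \<open>\<W>\<close> that normalizes it.
\<close>

lemma engel:
  assumes M: "csubspace M" and WM: "\<W> \<subseteq> M"
    and WW: "\<And>x y. x \<in> \<W> \<Longrightarrow> y \<in> \<W> \<Longrightarrow> bracket x y \<in> \<W>"
    and stab: "\<And>x z. x \<in> \<W> \<Longrightarrow> z \<in> M \<Longrightarrow> bracket x z \<in> M"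
    and nil: "\<And>x z. x \<in> \<W> \<Longrightarrow> z \<in> M \<Longrightarrow> \<exists>n. (bracket x ^^ n) z = 0"
  shows "\<exists>k. ad_series (cspan \<W>) M k = {0}"
proof -
  define good where "good Q \<longleftrightarrow> Q = cspan (\<W> \<inter> Q) \<and> (\<forall>x\<in>Q. \<forall>y\<in>Q. bracket x y \<in> Q) \<and>
      (\<exists>k. ad_series Q M k = {0})" for Q
  have "ad_series {0} M (Suc 0) \<subseteq> {0}"
    unfolding ad_series.simps by (rule bracket_span_minimal) simp_all
  then have "ad_series {0} M (Suc 0) = {0}"
    using csubspace_0[OF csubspace_ad_series[OF M]] by blast
  moreover have "cspan (\<W> \<inter> {0}) \<subseteq> {0}" by (rule cspan_minimal) auto
  then have "{0} = cspan (\<W> \<inter> {0})" using cspan_0 by blast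
  ultimately have "good {0}" unfolding good_def by (metis bracket_0_left singletonD singletonI)
  moreover have "complex_vector.dim Q \<le> complex_vector.dim (UNIV::'g set)" if "good Q" for Q
  proof -
    have "Q = cspan (\<W> \<inter> Q)" using that unfolding good_def by blast
    then have "csubspace Q" using csubspace_cspan[of "\<W> \<inter> Q"] by argo
    from dim_less[OF fd this] show ?thesis by (cases "Q = UNIV") (simp_all add: top.not_eq_extremum order_less_imp_le)
  qed
  ultimately obtain Q where Q: "good Q" and max: "\<And>Q'. good Q' \<Longrightarrow> complex_vector.dim Q' \<le> complex_vector.dim Q"
    using ex_has_greatest_nat[of good "{0}" complex_vector.dim "Suc (complex_vector.dim (UNIV::'g set))"]
    by (metis le_imp_less_Suc)
  have gen: "cspan (\<W> \<inter> Q) = Q" and QQ: "\<And>x y. x \<in> Q \<Longrightarrow> y \<in> Q \<Longrightarrow> bracket x y \<in> Q"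
    using Q unfolding good_def by auto
  have sQ: "csubspace Q" using csubspace_cspan[of "\<W> \<inter> Q"] gen by argo
  obtain k where k: "ad_series Q M k = {0}" using Q unfolding good_def by auto
  have "\<W> \<subseteq> Q"
  proof (rule ad_series_escape[OF k csubspace_0[OF sQ] WM], rule ccontr)
    fix w assume w: "w \<in> \<W>" "w \<notin> Q" and "\<not> (\<exists>a\<in>Q. bracket a w \<in> \<W> \<and> bracket a w \<notin> Q)"
    then have "bracket a w \<in> Q" if "a \<in> \<W> \<inter> Q" for a using that WW by blast
    then have Qw: "bracket a w \<in> Q" if "a \<in> Q" for a
      using clinear_image_cspan[OF clinear_bracket_left, of a "\<W> \<inter> Q" w Q] gen sQ that by metis
    have wQ: "bracket w a \<in> Q" if "a \<in> Q" for a
      using csubspace_neg[OF sQ Qw[OF that]] bracket_antisym[of w a] by simp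
    let ?Q = "cspan (insert w Q)"
    have QM: "bracket q z \<in> M" if "q \<in> Q" "z \<in> M" for q z
      using clinear_image_cspan[OF clinear_bracket_left, of q "\<W> \<inter> Q" z M] gen M stab that by auto
    have "\<exists>j. ad_series ?Q M j = {0}"
      by (rule engel_step[OF M sQ QM wQ stab[OF w(1)] nil[OF w(1)] k])
    moreover have "bracket x y \<in> ?Q" if "x \<in> ?Q" "y \<in> ?Q" for x y
    proof (rule bracket_cspan_closed[OF that])
      fix a b assume "a \<in> insert w Q" "b \<in> insert w Q"
      then have "bracket a b \<in> Q"
        using QQ wQ Qw csubspace_0[OF sQ] bracket_self[of w] by auto
      then show "bracket a b \<in> ?Q" by (intro cspan_base) simp
    qed (rule csubspace_cspan)
    moreover have "?Q = cspan (\<W> \<inter> ?Q)"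
    proof
      have "Q \<subseteq> cspan (\<W> \<inter> ?Q)"
        by (subst gen[symmetric], rule cspan_mono) (auto intro: cspan_base)
      moreover have "w \<in> cspan (\<W> \<inter> ?Q)" using w by (intro cspan_base) (auto intro: cspan_base)
      ultimately show "?Q \<subseteq> cspan (\<W> \<inter> ?Q)" by (intro cspan_minimal) auto
      show "cspan (\<W> \<inter> ?Q) \<subseteq> ?Q" by (intro cspan_minimal) auto
    qed
    ultimately have "good ?Q" unfolding good_def by blast
    moreover have "Q \<subset> ?Q" using w by (auto intro: cspan_base)
    then have "complex_vector.dim Q < complex_vector.dim ?Q"
      by (intro dim_less fd_subspace sQ) auto
    ultimately show False using max[of ?Q] by simp
  qed
  then have "cspan \<W> = Q" using gen by (metis Int_absorb2)
  then show ?thesis using k by blast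
qed

end

section \<open>The root space decomposition of a semisimple Lie algebra\<close>

locale cartan_pair = fd_lie_algebra "TYPE('g::lie_algebra)" for H :: "'g::lie_algebra set" +
  assumes ss: "semisimple TYPE('g)" and cartan: "cartan_subalgebra H"
begin

lemma csubspace_H: "csubspace H" and bracket_H: "x \<in> H \<Longrightarrow> y \<in> H \<Longrightarrow> bracket x y \<in> H"
  using cartan by (auto simp: cartan_subalgebra_def lie_subalgebra_def)

abbreviation gw :: "('g \<Rightarrow> complex) \<Rightarrow> 'g set"
  where "gw \<equiv> gen_weight H bracket"

abbreviation gwdim :: "('g \<Rightarrow> complex) \<Rightarrow> nat"
  where "gwdim \<alpha> \<equiv> complex_vector.dim (gw \<alpha>)"

definition funs_on :: "('g \<Rightarrow> complex) set"
  where "funs_on = {\<alpha>. \<forall>h. h \<notin> H \<longrightarrow> \<alpha> h = 0}"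

definition wts :: "('g \<Rightarrow> complex) set"
  where "wts = {\<alpha> \<in> funs_on. gw \<alpha> \<noteq> {0}}"

lemma gw_subspace: "csubspace (gw \<alpha>)"
  by (rule csubspace_gen_weight) (rule clinear_bracket_right)

lemma gw_fd: "cfinite_dim (gw \<alpha>)"
  by (rule fd_subspace[OF gw_subspace])

lemma gwI: "(\<And>h. h \<in> H \<Longrightarrow> x \<in> gen_eigen (bracket h) (\<alpha> h)) \<Longrightarrow> x \<in> gw \<alpha>"
  and gwD: "x \<in> gw \<alpha> \<Longrightarrow> h \<in> H \<Longrightarrow> x \<in> gen_eigen (bracket h) (\<alpha> h)"
  by (auto simp: gen_weight_def)

lemma gw_cong: "(\<And>h. h \<in> H \<Longrightarrow> \<alpha> h = \<beta> h) \<Longrightarrow> gw \<alpha> = gw \<beta>"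
  by (auto simp: gen_weight_def)

lemma bracket_gw: "x \<in> gw \<alpha> \<Longrightarrow> y \<in> gw \<beta> \<Longrightarrow> bracket x y \<in> gw (\<lambda>t. \<alpha> t + \<beta> t)"
  by (auto intro!: gwI gen_eigen_bracket dest: gwD)

lemma funs_on_add: "\<alpha> \<in> funs_on \<Longrightarrow> \<beta> \<in> funs_on \<Longrightarrow> (\<lambda>t. \<alpha> t + \<beta> t) \<in> funs_on"
  and funs_on_diff: "\<alpha> \<in> funs_on \<Longrightarrow> \<beta> \<in> funs_on \<Longrightarrow> (\<lambda>t. \<alpha> t - \<beta> t) \<in> funs_on"
  and funs_on_zero: "(\<lambda>t. 0) \<in> funs_on"
  by (auto simp: funs_on_def)

lemma funs_on_eqI: "\<alpha> \<in> funs_on \<Longrightarrow> \<beta> \<in> funs_on \<Longrightarrow> (\<And>h. h \<in> H \<Longrightarrow> \<alpha> h = \<beta> h) \<Longrightarrow> \<alpha> = \<beta>"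
  unfolding funs_on_def by (rule ext) (metis (mono_tags, lifting) mem_Collect_eq)

lemma funs_on_distinct: "\<alpha> \<in> funs_on \<Longrightarrow> \<beta> \<in> funs_on \<Longrightarrow> \<alpha> \<noteq> \<beta> \<Longrightarrow> \<exists>h\<in>H. \<alpha> h \<noteq> \<beta> h"
  using funs_on_eqI by blast

lemma wts_funs_on: "\<alpha> \<in> wts \<Longrightarrow> \<alpha> \<in> funs_on"
  by (simp add: wts_def)

lemma gw_trivial: "\<alpha> \<in> funs_on \<Longrightarrow> \<alpha> \<notin> wts \<Longrightarrow> gw \<alpha> = {0}"
  by (simp add: wts_def)

lemma dim_gw_pos: "\<alpha> \<in> wts \<Longrightarrow> 0 < gwdim \<alpha>"
  by (rule dim_pos[OF gw_fd]) (simp add: wts_def)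

lemma H_nilpotent_on_H:
  assumes "h \<in> H" "k \<in> H" shows "k \<in> gen_eigen (bracket h) 0"
proof -
  obtain n where n: "lower_central_series H n = {0}"
    using cartan by (auto simp: cartan_subalgebra_def nilpotent_def)
  have "(bracket h ^^ m) k \<in> lower_central_series H m" for m
    by (induction m) (use assms in \<open>auto intro: in_bracket_span\<close>)
  then have "(bracket h ^^ n) k = 0" using n by (metis singletonD)
  moreover have "shifted (bracket h) 0 = bracket h" by (rule ext) (simp add: shifted_def)
  ultimately show ?thesis by (auto simp: gen_eigen_def)
qed

lemma H_gw_zero: "H \<subseteq> gw (\<lambda>_. 0)"
  using H_nilpotent_on_H by (auto intro: gwI)

lemma bracket_H_gw: "h \<in> H \<Longrightarrow> x \<in> gw \<alpha> \<Longrightarrow> bracket h x \<in> gw \<alpha>"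
  using bracket_gw[of h "\<lambda>_. 0" x \<alpha>] H_gw_zero by auto

lemma bracket_H_gen_eigen:
  "h \<in> H \<Longrightarrow> k \<in> H \<Longrightarrow> x \<in> gen_eigen (bracket h) a \<Longrightarrow> bracket k x \<in> gen_eigen (bracket h) a"
  using gen_eigen_bracket[OF H_nilpotent_on_H, of h k x a] by simp

lemma gw_decomposition:
  assumes "csubspace M" "\<And>h x. h \<in> H \<Longrightarrow> x \<in> M \<Longrightarrow> bracket h x \<in> M"
  shows "M \<subseteq> cspan (\<Union>\<alpha>\<in>funs_on. gw \<alpha> \<inter> M)"
  unfolding funs_on_def
  by (rule gen_weight_decomposition[OF fd_subspace[OF assms(1)] clinear_bracket_right assms(2)])
    (auto intro: bracket_H_gen_eigen)

lemma gw_spans: "cspan (\<Union>\<alpha>\<in>wts. gw \<alpha>) = UNIV"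
proof -
  have "UNIV \<subseteq> cspan (\<Union>\<alpha>\<in>funs_on. gw \<alpha> \<inter> UNIV)" by (rule gw_decomposition) auto
  also have "\<dots> \<subseteq> cspan (\<Union>\<alpha>\<in>wts. gw \<alpha>)"
  proof (intro cspan_minimal UN_least csubspace_cspan)
    fix \<alpha> assume \<alpha>: "\<alpha> \<in> funs_on"
    show "gw \<alpha> \<inter> UNIV \<subseteq> cspan (\<Union>\<alpha>\<in>wts. gw \<alpha>)"
    proof (cases "\<alpha> \<in> wts")
      case True
      then show ?thesis using complex_vector.span_superset[of "\<Union>\<alpha>\<in>wts. gw \<alpha>"] by blast
    next
      case False
      then show ?thesis using gw_trivial[OF \<alpha>] cspan_0 by auto
    qed
  qed
  finally show ?thesis by auto
qed

lemma gw_induct [case_names subspace base]: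
  assumes "csubspace W" "\<And>\<alpha> x. \<alpha> \<in> wts \<Longrightarrow> x \<in> gw \<alpha> \<Longrightarrow> x \<in> W"
  shows "x \<in> W"
proof -
  have "cspan (\<Union>\<alpha>\<in>wts. gw \<alpha>) \<subseteq> W" by (rule cspan_minimal) (use assms in auto)
  then show ?thesis by (auto simp: gw_spans)
qed

lemma gw_independent:
  assumes "finite F" "F \<subseteq> funs_on" "csubspace N" "\<And>h x. h \<in> H \<Longrightarrow> x \<in> N \<Longrightarrow> bracket h x \<in> N"
    "\<And>\<mu>. \<mu> \<in> F \<Longrightarrow> x \<mu> \<in> gw \<mu>" "(\<Sum>\<mu>\<in>F. x \<mu>) \<in> N" "\<mu> \<in> F"
  shows "x \<mu> \<in> N"
proof (rule weights_independent[where A = H and \<tau> = bracket and W = gw and F = F])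
  show "\<exists>h\<in>H. \<mu> h \<noteq> \<nu> h" if "\<mu> \<in> F" "\<nu> \<in> F" "\<mu> \<noteq> \<nu>" for \<mu> \<nu>
    using that assms(2) by (intro funs_on_distinct) auto
  show "gw \<mu> \<subseteq> gen_eigen (bracket h) (\<mu> h)" if "h \<in> H" for \<mu> h using that by (auto dest: gwD)
qed (use assms in \<open>auto intro: clinear_bracket_right gw_subspace bracket_H_gw\<close>)

lemma finite_wts: "finite wts"
proof (rule finite_weights[OF fd, of H bracket wts gw])
  show "gw \<mu> \<subseteq> gen_eigen (bracket h) (\<mu> h)" if "h \<in> H" for \<mu> h using that by (auto dest: gwD)
qed (auto intro: clinear_bracket_right gw_subspace bracket_H_gw simp: wts_def funs_on_def)

text \<open>
  Otherwise Engel's theorem, for the nilpotent action of \<open>H\<close> on its generalized null space, would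
  give an element outside \<open>H\<close> that normalizes \<open>H\<close>.
\<close>

lemma gw_zero: "gw (\<lambda>_. 0) = H"
proof (rule antisym[OF _ H_gw_zero])
  let ?M = "gw (\<lambda>_. 0)"
  have "\<exists>n. (bracket h ^^ n) z = 0" if "h \<in> H" "z \<in> ?M" for h z
  proof -
    have "shifted (bracket h) 0 = bracket h" by (rule ext) (simp add: shifted_def)
    then show ?thesis using gwD[OF that(2,1)] by (simp add: gen_eigen_def)
  qed
  then obtain k where "ad_series (cspan H) ?M k = {0}"
    using engel[OF gw_subspace H_gw_zero bracket_H bracket_H_gw] by blast
  then have k: "ad_series H ?M k = {0}" using csubspace_H by simp
  show "?M \<subseteq> H"
  proof (rule ad_series_escape[OF k csubspace_0[OF csubspace_H] subset_refl], rule ccontr)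
    fix x assume x: "x \<in> ?M" "x \<notin> H" and "\<not> (\<exists>a\<in>H. bracket a x \<in> ?M \<and> bracket a x \<notin> H)"
    then have "bracket a x \<in> H" if "a \<in> H" for a using that bracket_H_gw[OF that x(1)] by blast
    then have "bracket x a \<in> H" if "a \<in> H" for a
      using that bracket_antisym[of x a] csubspace_neg[OF csubspace_H] by metis
    then have "x \<in> {x. \<forall>y\<in>H. bracket x y \<in> H}" by blast
    then show False using cartan x(2) by (auto simp: cartan_subalgebra_def)
  qed
qed

subsection \<open>Weights are linear and describe the Killing form\<close>

lemma trace_ad_H_gw: "h \<in> H \<Longrightarrow> trace_on (gw \<alpha>) (bracket h) = \<alpha> h * of_nat (gwdim \<alpha>)"
  by (rule trace_on_gen_eigen[OF gw_fd clinear_bracket_right]) (auto intro: bracket_H_gw dest: gwD)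

text \<open>
  Weights are linear because \<open>\<alpha>(h) dim \<gg>\<^sub>\<alpha>\<close> is the trace of \<open>ad h\<close> on \<open>\<gg>\<^sub>\<alpha>\<close>.
\<close>

lemma wts_add:
  assumes "\<alpha> \<in> wts" "h \<in> H" "k \<in> H" shows "\<alpha> (h + k) = \<alpha> h + \<alpha> k"
proof -
  let ?d = "of_nat (gwdim \<alpha>) :: complex"
  have "\<alpha> (h + k) * ?d = trace_on (gw \<alpha>) (bracket (h + k))"
    using assms by (simp add: trace_ad_H_gw csubspace_add[OF csubspace_H])
  also have "bracket (h + k) = (\<lambda>x. bracket h x + bracket k x)" by (rule ext) (rule bracket_add_left)
  also have "trace_on (gw \<alpha>) \<dots> = trace_on (gw \<alpha>) (bracket h) + trace_on (gw \<alpha>) (bracket k)"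
    by (rule trace_on_add[OF gw_fd clinear_bracket_right clinear_bracket_right])
      (use assms in \<open>auto intro: bracket_H_gw\<close>)
  finally have "\<alpha> (h + k) * ?d = (\<alpha> h + \<alpha> k) * ?d"
    using assms by (simp add: trace_ad_H_gw algebra_simps)
  then show ?thesis using dim_gw_pos[OF assms(1)] by simp
qed

lemma wts_scale:
  assumes "\<alpha> \<in> wts" "h \<in> H" shows "\<alpha> (c *\<^sub>C h) = c * \<alpha> h"
proof -
  let ?d = "of_nat (gwdim \<alpha>) :: complex"
  have "\<alpha> (c *\<^sub>C h) * ?d = trace_on (gw \<alpha>) (bracket (c *\<^sub>C h))"
    using assms by (simp add: trace_ad_H_gw csubspace_scale[OF csubspace_H])
  also have "bracket (c *\<^sub>C h) = (\<lambda>x. c *\<^sub>C bracket h x)" by (rule ext) (rule bracket_scale_left)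
  also have "trace_on (gw \<alpha>) \<dots> = c * trace_on (gw \<alpha>) (bracket h)"
    by (rule trace_on_scale[OF gw_fd clinear_bracket_right])
      (use assms in \<open>auto intro: bracket_H_gw\<close>)
  finally have "\<alpha> (c *\<^sub>C h) * ?d = (c * \<alpha> h) * ?d" using assms by (simp add: trace_ad_H_gw)
  then show ?thesis using dim_gw_pos[OF assms(1)] by simp
qed

lemma wts_csubspace: "\<alpha> \<in> wts \<Longrightarrow> csubspace {h \<in> H. \<alpha> h = 0}"
  by (rule csubspaceI)
    (auto simp: wts_add wts_scale csubspace_0[OF csubspace_H] csubspace_add[OF csubspace_H]
      csubspace_scale[OF csubspace_H] wts_scale[of \<alpha> 0 0, simplified])

lemma trace_on_wts:
  assumes S: "S \<subseteq> wts" and T: "clinear T" "\<And>\<alpha> x. \<alpha> \<in> S \<Longrightarrow> x \<in> gw \<alpha> \<Longrightarrow> T x \<in> gw \<alpha>"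
  shows "trace_on (cspan (\<Union>\<alpha>\<in>S. gw \<alpha>)) T = (\<Sum>\<alpha>\<in>S. trace_on (gw \<alpha>) T)"
proof (rule trace_on_direct_sum[OF _ gw_fd _ T])
  show fS: "finite S" using finite_wts S finite_subset by blast
  fix x \<alpha> assume x: "\<And>\<alpha>. \<alpha> \<in> S \<Longrightarrow> x \<alpha> \<in> gw \<alpha>" "(\<Sum>\<alpha>\<in>S. x \<alpha>) = 0" "\<alpha> \<in> S"
  have "x \<alpha> \<in> {0}"
    by (rule gw_independent[OF fS]) (use x S wts_funs_on in auto)
  then show "x \<alpha> = 0" by simp
qed

text \<open>
  On \<open>\<gg>\<^sub>\<alpha>\<close> the operator \<open>(ad h)\<^sup>2\<close> has the single eigenvalue \<open>\<alpha>(h)\<^sup>2\<close>. Only squares are computed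
  here: for two elements \<open>h\<close> and \<open>k\<close>, whose adjoint actions may not commute, the formula follows
  by polarization.
\<close>

lemma killing_square:
  assumes h: "h \<in> H"
  shows "killing h h = (\<Sum>\<alpha>\<in>wts. of_nat (gwdim \<alpha>) * (\<alpha> h)\<^sup>2)"
proof -
  let ?T = "\<lambda>z. bracket h (bracket h z)"
  have T: "clinear ?T" by (rule clinear_bracket2)
  have sT: "csubspace (gen_eigen ?T a)" for a by (rule csubspace_gen_eigen[OF T])
  have "x \<in> gen_eigen ?T (a\<^sup>2)" if "x \<in> gen_eigen (bracket h) a" for x a
    using clinear_bracket_right that
  proof (induction rule: gen_eigen_induct)
    case zero
    show ?case by (rule csubspace_0[OF sT])
  next
    case (step x)
    \<comment> \<open>\<open>T - a\<^sup>2 = (ad h + a) (ad h - a)\<close>, and \<open>ad h + a\<close> commutes with \<open>T\<close>\<close>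
    have com: "bracket h y \<in> gen_eigen ?T (a\<^sup>2)" if "y \<in> gen_eigen ?T (a\<^sup>2)" for y
      using T that
    proof (induction rule: gen_eigen_induct)
      case zero
      show ?case using csubspace_0[OF sT] by simp
    next
      case (step y)
      then have "shifted ?T (a\<^sup>2) (bracket h y) \<in> gen_eigen ?T (a\<^sup>2)"
        by (simp add: shifted_def bracket_diff_right bracket_scale_right)
      then show ?case using shifted_gen_eigen_iff[OF T] by blast
    qed
    let ?y = "shifted (bracket h) a x"
    have "shifted ?T (a\<^sup>2) x = bracket h ?y + a *\<^sub>C ?y"
      by (simp add: shifted_def bracket_diff_right bracket_scale_right
          complex_vector.scale_right_diff_distrib scaleC_scaleC power2_eq_square)
    also have "\<dots> \<in> gen_eigen ?T (a\<^sup>2)"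
      using step com by (intro csubspace_add[OF sT] csubspace_scale[OF sT])
    finally show ?case using shifted_gen_eigen_iff[OF T] by blast
  qed
  then have tr: "trace_on (gw \<alpha>) ?T = (\<alpha> h)\<^sup>2 * of_nat (gwdim \<alpha>)" for \<alpha>
    using h by (intro trace_on_gen_eigen[OF gw_fd T]) (auto intro: bracket_H_gw dest: gwD)
  have "killing h h = trace_on (cspan (\<Union>\<alpha>\<in>wts. gw \<alpha>)) ?T" by (simp add: killing_trace gw_spans)
  also have "\<dots> = (\<Sum>\<alpha>\<in>wts. trace_on (gw \<alpha>) ?T)"
    by (rule trace_on_wts[OF subset_refl T]) (use h in \<open>auto intro: bracket_H_gw\<close>)
  finally show ?thesis by (simp add: tr mult.commute)
qed

lemma killing_on_H:
  assumes h: "h \<in> H" and k: "k \<in> H"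
  shows "killing h k = (\<Sum>\<alpha>\<in>wts. of_nat (gwdim \<alpha>) * (\<alpha> h * \<alpha> k))"
proof -
  have "killing (h + k) (h + k) = killing h h + 2 * killing h k + killing k k"
    by (simp add: killing_add_left killing_add_right killing_sym[of k h])
  moreover have "killing (h + k) (h + k) =
      killing h h + 2 * (\<Sum>\<alpha>\<in>wts. of_nat (gwdim \<alpha>) * (\<alpha> h * \<alpha> k)) + killing k k"
    unfolding killing_square[OF h] killing_square[OF k] killing_square[OF csubspace_add[OF csubspace_H h k]]
      sum_distrib_left sum.distrib[symmetric]
    by (rule sum.cong) (use h k in \<open>auto simp: wts_add power2_eq_square algebra_simps\<close>)
  ultimately show ?thesis by simp
qed

lemma killing_gw_orthogonal:
  assumes "x \<in> gw \<alpha>" "y \<in> gw \<beta>" "h \<in> H" "\<alpha> h + \<beta> h \<noteq> 0"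
  shows "killing x y = 0"
  using killing_gen_eigen_orthogonal[OF gwD gwD] assms by blast

subsection \<open>Nondegeneracy of the Killing form\<close>

text \<open>
  The trace of \<open>[x, y]\<close> on the \<open>\<alpha>\<close>-string of weights through \<open>\<gamma>\<close> vanishes, which expresses
  \<open>\<gamma> [x, y]\<close> as a real multiple of \<open>\<alpha> [x, y]\<close>.
\<close>

lemma wts_real_multiple:
  assumes x: "x \<in> gw \<alpha>" and y: "y \<in> gw \<beta>" and \<alpha>: "\<alpha> \<in> funs_on"
    and opp: "\<And>h. h \<in> H \<Longrightarrow> \<alpha> h + \<beta> h = 0" and \<gamma>: "\<gamma> \<in> wts"
  shows "\<exists>r::real. \<gamma> (bracket x y) = of_real r * \<alpha> (bracket x y)"
proof -
  let ?h = "bracket x y"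
  define S where "S = {\<mu> \<in> wts. \<exists>k::int. \<forall>t\<in>H. \<mu> t = \<gamma> t + of_int k * \<alpha> t}"
  define M where "M = cspan (\<Union>\<mu>\<in>S. gw \<mu>)"
  have Sw: "S \<subseteq> wts" and fS: "finite S" using finite_wts by (auto simp: S_def)
  have \<gamma>S: "\<gamma> \<in> S" using \<gamma> by (auto simp: S_def intro!: exI[of _ 0])
  have "?h \<in> gw (\<lambda>_. 0)"
    using bracket_gw[OF x y] gw_cong[of "\<lambda>t. \<alpha> t + \<beta> t" "\<lambda>_. 0"] opp by simp
  then have h: "?h \<in> H" by (simp add: gw_zero)
  have M: "csubspace M" "cfinite_dim M" unfolding M_def by (auto intro: fd_subspace)
  have shift: "bracket u z \<in> M" if u: "u \<in> gw \<nu>" and \<nu>: "\<And>t. t \<in> H \<Longrightarrow> \<nu> t = of_int e * \<alpha> t"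
    and z: "z \<in> M" for u \<nu> z and e :: int
  proof (rule clinear_image_cspan[OF clinear_bracket_right z[unfolded M_def] _ M(1)])
    fix w assume "w \<in> (\<Union>\<mu>\<in>S. gw \<mu>)"
    then obtain \<mu> k where w: "w \<in> gw \<mu>" "\<mu> \<in> wts" "\<And>t. t \<in> H \<Longrightarrow> \<mu> t = \<gamma> t + of_int k * \<alpha> t"
      by (auto simp: S_def)
    define \<kappa> where "\<kappa> t = \<mu> t + of_int e * \<alpha> t" for t
    have \<kappa>f: "\<kappa> \<in> funs_on" using wts_funs_on[OF w(2)] \<alpha> by (simp add: funs_on_def \<kappa>_def)
    have bw: "bracket u w \<in> gw \<kappa>"
      using bracket_gw[OF u w(1)] gw_cong[of "\<lambda>t. \<nu> t + \<mu> t" \<kappa>] \<nu> by (simp add: \<kappa>_def add.commute)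
    show "bracket u w \<in> M"
    proof (cases "\<kappa> \<in> wts")
      case True
      moreover have "\<forall>t\<in>H. \<kappa> t = \<gamma> t + of_int (k + e) * \<alpha> t" using w(3) by (simp add: \<kappa>_def algebra_simps)
      ultimately have "\<kappa> \<in> S" unfolding S_def by blast
      then show ?thesis unfolding M_def using bw by (intro cspan_base) blast
    next
      case False
      then have "bracket u w = 0" using bw gw_trivial[OF \<kappa>f] by auto
      then show ?thesis using csubspace_0[OF M(1)] by simp
    qed
  qed
  have xM: "bracket x z \<in> M" if "z \<in> M" for z using shift[OF x _ that, of 1] by simp
  have "\<beta> t = of_int (- 1) * \<alpha> t" if "t \<in> H" for t using opp[OF that] by (simp add: eq_neg_iff_add_eq_0 add.commute)
  then have yM: "bracket y z \<in> M" if "z \<in> M" for z using shift[OF y _ that, of "- 1"] by blast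
  have "trace_on M (bracket ?h) = trace_on M (\<lambda>z. bracket x (bracket y z) - bracket y (bracket x z))"
    by (rule trace_on_cong[OF M(2)]) (rule bracket_of_bracket)
  also have "\<dots> = trace_on M (\<lambda>z. bracket x (bracket y z)) - trace_on M (\<lambda>z. bracket y (bracket x z))"
    by (rule trace_on_diff[OF M(2) clinear_bracket2 clinear_bracket2]) (simp_all add: xM yM)
  also have "trace_on M (\<lambda>z. bracket x (bracket y z)) = trace_on M (\<lambda>z. bracket y (bracket x z))"
    by (rule trace_on_cyclic[OF M(2) M(2) clinear_bracket_right yM clinear_bracket_right xM])
  finally have "trace_on M (bracket ?h) = 0" by simp
  moreover have "trace_on M (bracket ?h) = (\<Sum>\<mu>\<in>S. trace_on (gw \<mu>) (bracket ?h))"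
    unfolding M_def by (rule trace_on_wts[OF Sw clinear_bracket_right]) (use h in \<open>auto intro: bracket_H_gw\<close>)
  ultimately have 0: "(\<Sum>\<mu>\<in>S. \<mu> ?h * of_nat (gwdim \<mu>)) = 0"
    using h by (simp add: trace_ad_H_gw)
  have "\<forall>\<mu>\<in>S. \<exists>k::int. \<mu> ?h = \<gamma> ?h + of_int k * \<alpha> ?h" using h unfolding S_def by blast
  then obtain k :: "_ \<Rightarrow> int" where k: "\<And>\<mu>. \<mu> \<in> S \<Longrightarrow> \<mu> ?h = \<gamma> ?h + of_int (k \<mu>) * \<alpha> ?h" by metis
  define d where "d = (\<Sum>\<mu>\<in>S. gwdim \<mu>)"
  define K where "K = (\<Sum>\<mu>\<in>S. k \<mu> * int (gwdim \<mu>))"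
  have "0 = (\<Sum>\<mu>\<in>S. (\<gamma> ?h + of_int (k \<mu>) * \<alpha> ?h) * of_nat (gwdim \<mu>))"
    using 0 k by simp
  also have "\<dots> = \<gamma> ?h * of_nat d + of_int K * \<alpha> ?h"
    by (simp add: d_def K_def sum_distrib_left sum_distrib_right sum.distrib algebra_simps)
  finally have 1: "\<gamma> ?h * of_nat d = - of_int K * \<alpha> ?h" by (simp add: eq_neg_iff_add_eq_0)
  have "gwdim \<gamma> \<le> d" unfolding d_def using \<gamma>S fS by (intro member_le_sum) auto
  then have "d > 0" using dim_gw_pos[OF \<gamma>] by simp
  then have "\<gamma> ?h = of_real (- of_int K / of_nat d) * \<alpha> ?h" using 1 by (simp add: field_simps)
  then show ?thesis by blast
qed

text \<open>
  By the previous lemma \<open>B(h, h)\<close>, for \<open>h = [x, y]\<close>, is \<open>\<alpha>(h)\<^sup>2\<close> times a sum of squares of real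
  numbers with positive coefficients.
\<close>

lemma wts_vanish:
  assumes x: "x \<in> gw \<alpha>" and y: "y \<in> gw \<beta>" and \<alpha>: "\<alpha> \<in> funs_on"
    and opp: "\<And>h. h \<in> H \<Longrightarrow> \<alpha> h + \<beta> h = 0" and \<gamma>: "\<gamma> \<in> wts"
    and "killing (bracket x y) (bracket x y) = 0"
  shows "\<gamma> (bracket x y) = 0"
proof -
  let ?h = "bracket x y"
  have "?h \<in> gw (\<lambda>_. 0)"
    using bracket_gw[OF x y] gw_cong[of "\<lambda>t. \<alpha> t + \<beta> t" "\<lambda>_. 0"] opp by simp
  then have h: "?h \<in> H" by (simp add: gw_zero)
  obtain r :: "_ \<Rightarrow> real" where r: "\<And>\<gamma>. \<gamma> \<in> wts \<Longrightarrow> \<gamma> ?h = of_real (r \<gamma>) * \<alpha> ?h"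
    using wts_real_multiple[OF x y \<alpha> opp] by metis
  have "killing ?h ?h = (\<Sum>\<gamma>\<in>wts. of_nat (gwdim \<gamma>) * (of_real (r \<gamma>) * \<alpha> ?h)\<^sup>2)"
    unfolding killing_square[OF h] by (rule sum.cong) (simp_all add: r)
  also have "\<dots> = of_real (\<Sum>\<gamma>\<in>wts. of_nat (gwdim \<gamma>) * (r \<gamma>)\<^sup>2) * (\<alpha> ?h)\<^sup>2"
    unfolding of_real_sum sum_distrib_right by (rule sum.cong) (simp_all add: power_mult_distrib)
  finally have "\<alpha> ?h = 0 \<or> (\<Sum>\<gamma>\<in>wts. of_nat (gwdim \<gamma>) * (r \<gamma>)\<^sup>2) = 0"
    using assms(6) of_real_eq_0_iff by fastforce
  then show ?thesis
  proof
    assume "\<alpha> ?h = 0" then show ?thesis using r[OF \<gamma>] by simp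
  next
    assume "(\<Sum>\<gamma>\<in>wts. of_nat (gwdim \<gamma>) * (r \<gamma>)\<^sup>2) = 0"
    then have "of_nat (gwdim \<gamma>) * (r \<gamma>)\<^sup>2 = 0"
      using finite_wts \<gamma> by (subst (asm) sum_nonneg_eq_0_iff) auto
    then have "r \<gamma> = 0" using dim_gw_pos[OF \<gamma>] by simp
    then show ?thesis using r[OF \<gamma>] by simp
  qed
qed

text \<open>
  For \<open>\<alpha> \<noteq> 0\<close> the powers of \<open>ad x\<close> lead out of the finite set of weights; for \<open>\<alpha> = 0\<close> the
  hypothesis says that \<open>0\<close> is the only eigenvalue of \<open>ad x\<close>.
\<close>

lemma gw_ad_nilpotent:
  assumes x: "x \<in> gw \<alpha>" and \<alpha>: "\<alpha> \<in> funs_on" and zero: "\<And>\<gamma>. \<alpha> = (\<lambda>_. 0) \<Longrightarrow> \<gamma> \<in> wts \<Longrightarrow> \<gamma> x = 0"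
  shows "\<exists>n. (bracket x ^^ n) z = 0"
proof -
  have s0: "shifted (bracket x) 0 = bracket x" by (rule ext) (simp add: shifted_def)
  have "z \<in> gen_eigen (bracket x) 0"
  proof (rule gw_induct[OF csubspace_gen_eigen[OF clinear_bracket_right]])
    fix \<mu> z assume \<mu>: "\<mu> \<in> wts" and z: "z \<in> gw \<mu>"
    show "z \<in> gen_eigen (bracket x) 0"
    proof (cases "\<alpha> = (\<lambda>_. 0)")
      case True
      then have "x \<in> H" using x gw_zero by simp
      then show ?thesis using gwD[OF z, of x] zero[OF True \<mu>] by simp
    next
      case False
      then obtain h where h: "h \<in> H" "\<alpha> h \<noteq> 0" using funs_on_distinct[OF \<alpha> funs_on_zero] by auto
      define \<kappa> where "\<kappa> n t = \<mu> t + of_nat n * \<alpha> t" for n :: nat and t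
      have \<kappa>f: "\<kappa> n \<in> funs_on" for n using wts_funs_on[OF \<mu>] \<alpha> by (simp add: funs_on_def \<kappa>_def)
      have pow: "(bracket x ^^ n) z \<in> gw (\<kappa> n)" for n
      proof (induction n)
        case 0
        then show ?case using z by (simp add: \<kappa>_def)
      next
        case (Suc n)
        have "gw (\<lambda>t. \<alpha> t + \<kappa> n t) = gw (\<kappa> (Suc n))" by (rule gw_cong) (simp add: \<kappa>_def algebra_simps)
        then show ?case using bracket_gw[OF x Suc] by simp
      qed
      have "inj \<kappa>"
      proof (rule injI)
        fix i j assume "\<kappa> i = \<kappa> j"
        then have "\<kappa> i h = \<kappa> j h" by simp
        then show "i = j" using h by (simp add: \<kappa>_def)
      qed
      then have "\<not> range \<kappa> \<subseteq> wts" using finite_wts range_inj_infinite finite_subset by blast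
      then obtain n where "\<kappa> n \<notin> wts" by auto
      then have "(bracket x ^^ n) z = 0" using pow[of n] gw_trivial[OF \<kappa>f] by auto
      then show ?thesis by (auto simp: gen_eigen_def s0)
    qed
  qed
  then show ?thesis by (simp add: gen_eigen_def s0)
qed

text \<open>
  Since \<open>P = [P, P]\<close>, the intersection of \<open>P\<close> with \<open>H\<close> is spanned by brackets of elements of
  opposite weights, on which all weights vanish by isotropy. Hence every weight vector in \<open>P\<close> is
  nilpotent, and by Engel's theorem \<open>P\<close> acts nilpotently on the Lie algebra, which is incompatible
  with \<open>P = [P, P]\<close> unless \<open>P = 0\<close>.
\<close>

lemma perfect_isotropic_ideal:
  fixes P :: "'g set"
  assumes P: "lie_ideal P" and perfect: "bracket_span P P = P" and iso: "\<And>x y. x \<in> P \<Longrightarrow> killing x y = 0"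
  shows "P = {0}"
proof -
  have sP: "csubspace P" and PI: "\<And>x y. y \<in> P \<Longrightarrow> bracket x y \<in> P" using P by (auto simp: lie_ideal_def)
  have dec: "P \<subseteq> cspan (\<Union>\<alpha>\<in>funs_on. gw \<alpha> \<inter> P)" by (rule gw_decomposition[OF sP PI])
  define X where "X \<nu> = cspan {bracket a b | a b. \<exists>\<alpha>\<in>funs_on. \<exists>\<beta>\<in>funs_on.
      a \<in> gw \<alpha> \<inter> P \<and> b \<in> gw \<beta> \<inter> P \<and> \<nu> = (\<lambda>t. \<alpha> t + \<beta> t)}" for \<nu>
  have Xgw: "X \<nu> \<subseteq> gw \<nu>" for \<nu>
    unfolding X_def by (rule cspan_minimal[OF _ gw_subspace]) (auto intro: bracket_gw)
  have PX: "P \<subseteq> cspan (\<Union>\<nu>\<in>funs_on. X \<nu>)"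
  proof -
    have "bracket_span P P \<subseteq> cspan (\<Union>\<nu>\<in>funs_on. X \<nu>)"
    proof (rule bracket_span_minimal[OF _ csubspace_cspan])
      fix x y assume "x \<in> P" "y \<in> P"
      then show "bracket x y \<in> cspan (\<Union>\<nu>\<in>funs_on. X \<nu>)"
      proof (rule bracket_cspan_closed[OF dec[THEN subsetD] dec[THEN subsetD] _ csubspace_cspan])
        fix a b assume "a \<in> (\<Union>\<alpha>\<in>funs_on. gw \<alpha> \<inter> P)" "b \<in> (\<Union>\<alpha>\<in>funs_on. gw \<alpha> \<inter> P)"
        then obtain \<alpha> \<beta> where ab: "\<alpha> \<in> funs_on" "\<beta> \<in> funs_on" "a \<in> gw \<alpha> \<inter> P" "b \<in> gw \<beta> \<inter> P" by blast
        then have "bracket a b \<in> X (\<lambda>t. \<alpha> t + \<beta> t)" unfolding X_def by (intro cspan_base) blast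
        then show "bracket a b \<in> cspan (\<Union>\<nu>\<in>funs_on. X \<nu>)"
          using funs_on_add[OF ab(1,2)] by (intro cspan_base) blast
      qed
    qed
    then show ?thesis by (simp add: perfect)
  qed
  have XP0: "x \<in> X (\<lambda>_. 0)" if x: "x \<in> P" "x \<in> H" for x
  proof -
    obtain F y where F: "finite F" "F \<subseteq> funs_on" "\<And>i. i \<in> F \<Longrightarrow> y i \<in> X i" "x = (\<Sum>i\<in>F. y i)"
      by (rule cspan_Union_decompose[OF subsetD[OF PX x(1)]]) (auto simp: X_def)
    let ?F = "insert (\<lambda>_. 0) F"
    define y' where "y' \<nu> = (if \<nu> \<in> F then y \<nu> else 0)" for \<nu>
    define w where "w \<nu> = y' \<nu> - (if \<nu> = (\<lambda>_. 0) then x else 0)" for \<nu>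
    have y'X: "y' \<nu> \<in> X \<nu>" for \<nu> using F(3) by (auto simp: y'_def X_def cspan_0)
    have "(\<Sum>\<nu>\<in>?F. y' \<nu>) = (\<Sum>\<nu>\<in>F. y' \<nu>)"
      by (rule sum.mono_neutral_right) (use F in \<open>auto simp: y'_def\<close>)
    also have "\<dots> = x" unfolding F(4) by (rule sum.cong) (auto simp: y'_def)
    finally have w0: "(\<Sum>\<nu>\<in>?F. w \<nu>) \<in> {0}" using F(1) by (simp add: w_def sum_subtractf del: sum.insert)
    have wgw: "w \<nu> \<in> gw \<nu>" for \<nu>
    proof -
      have "(if \<nu> = (\<lambda>_. 0) then x else 0) \<in> gw \<nu>"
        using x(2) gw_zero csubspace_0[OF gw_subspace] by simp
      then show ?thesis unfolding w_def
        using subsetD[OF Xgw y'X] by (intro csubspace_diff[OF gw_subspace])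
    qed
    have "w (\<lambda>_. 0) \<in> {0}"
      by (rule gw_independent[of ?F "{0}" w, OF _ _ _ _ wgw w0]) (use F(1,2) funs_on_zero in simp_all)
    then have "x = y' (\<lambda>_. 0)" by (simp add: w_def)
    then show ?thesis using y'X by simp
  qed
  have van: "\<gamma> x = 0" if x: "x \<in> P" "x \<in> H" and \<gamma>: "\<gamma> \<in> wts" for x \<gamma>
  proof -
    have "X (\<lambda>_. 0) \<subseteq> {h \<in> H. \<gamma> h = 0}"
      unfolding X_def
    proof (rule cspan_minimal[OF _ wts_csubspace[OF \<gamma>]], safe)
      fix a b \<alpha> \<beta> assume ab: "\<alpha> \<in> funs_on" "\<beta> \<in> funs_on" "a \<in> gw \<alpha>" "a \<in> P" "b \<in> gw \<beta>" "b \<in> P"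
        and 0: "(\<lambda>_. 0) = (\<lambda>t. \<alpha> t + \<beta> t)"
      have opp: "\<alpha> t + \<beta> t = 0" for t using fun_cong[OF 0, of t] by simp
      show "bracket a b \<in> H" using bracket_gw[OF ab(3,5)] opp gw_zero by simp
      show "\<gamma> (bracket a b) = 0"
        by (rule wts_vanish[OF ab(3,5,1) opp \<gamma>]) (rule iso[OF PI[OF ab(6)]])
    qed
    then show ?thesis using XP0[OF x] by blast
  qed
  define \<W> where "\<W> = (\<Union>\<alpha>\<in>funs_on. gw \<alpha> \<inter> P)"
  have WP: "cspan \<W> = P"
    using dec cspan_minimal[of \<W> P] sP unfolding \<W>_def by blast
  have "\<exists>k. ad_series (cspan \<W>) UNIV k = {0}"
  proof (rule engel)
    show "bracket x y \<in> \<W>" if "x \<in> \<W>" "y \<in> \<W>" for x y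
      using that bracket_gw PI funs_on_add unfolding \<W>_def by (auto simp: Bex_def) blast
    show "\<exists>n. (bracket x ^^ n) z = 0" if "x \<in> \<W>" for x z
    proof -
      obtain \<alpha> where "\<alpha> \<in> funs_on" "x \<in> gw \<alpha>" "x \<in> P" using \<open>x \<in> \<W>\<close> by (auto simp: \<W>_def)
      then show ?thesis using van gw_zero by (intro gw_ad_nilpotent) auto
    qed
  qed auto
  then obtain k where k: "ad_series P UNIV k = {0}" by (auto simp: WP)
  have "P \<subseteq> ad_series P UNIV k" for k
  proof (induction k)
    case (Suc k)
    have "bracket_span P P \<subseteq> bracket_span P (ad_series P UNIV k)" using Suc by (rule bracket_span_mono[OF subset_refl])
    then show ?case by (simp add: perfect)
  qed simp
  then show ?thesis using k csubspace_0[OF sP] by blast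
qed

lemma lie_ideal_bracket_span: "lie_ideal P \<Longrightarrow> lie_ideal (bracket_span P P)"
  unfolding lie_ideal_def
proof (intro conjI allI ballI)
  assume P: "csubspace P \<and> (\<forall>x. \<forall>y\<in>P. bracket x y \<in> P)"
  fix x y assume "y \<in> bracket_span P P"
  then have "y \<in> cspan {bracket x y |x y. x \<in> P \<and> y \<in> P}" by (simp add: bracket_span_def)
  then show "bracket x y \<in> bracket_span P P"
  proof (rule clinear_image_cspan[OF clinear_bracket_right])
    fix z assume "z \<in> {bracket x y |x y. x \<in> P \<and> y \<in> P}"
    then obtain a b where z: "z = bracket a b" "a \<in> P" "b \<in> P" by auto
    show "bracket x z \<in> bracket_span P P"
      unfolding z bracket_derivation[of x a b] using P z
      by (intro csubspace_add[OF csubspace_bracket_span] in_bracket_span) auto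
  qed simp
qed simp

text \<open>
  The derived series of the radical of the Killing form consists of ideals and becomes
  stationary, at a perfect ideal, which is zero. So the radical is solvable.
\<close>

theorem killing_nondegenerate:
  fixes x :: 'g
  assumes "\<And>y. killing x y = 0"
  shows "x = 0"
proof -
  define K where "K = {x::'g. \<forall>y. killing x y = 0}"
  have K: "lie_ideal K"
    unfolding lie_ideal_def
  proof (intro conjI allI ballI csubspaceI)
    fix x y assume "y \<in> K"
    then have "killing y u = 0" for u by (simp add: K_def)
    then have "killing (bracket x y) z = 0" for z
      using killing_invariant[of y x z] bracket_antisym[of x y] by (simp add: killing_uminus_left)
    then show "bracket x y \<in> K" by (simp add: K_def)
  qed (auto simp: K_def killing_add_left killing_scale_left)
  have ideal: "lie_ideal (derived_series K n)" for n
    by (induction n) (auto intro: K lie_ideal_bracket_span)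
  have sub: "csubspace (derived_series K n)" for n using ideal by (auto simp: lie_ideal_def)
  have dec: "derived_series K (Suc n) \<subseteq> derived_series K n" for n
    unfolding derived_series.simps
    by (rule bracket_span_minimal[OF _ sub]) (use ideal[of n] in \<open>simp add: lie_ideal_def\<close>)
  have DK: "derived_series K n \<subseteq> K" for n
    by (induction n) (use dec in auto)
  obtain n where n: "\<And>k. complex_vector.dim (derived_series K n) \<le> complex_vector.dim (derived_series K k)"
    using ex_has_least_nat[of "\<lambda>_. True" 0 "\<lambda>n. complex_vector.dim (derived_series K n)"] by blast
  have "derived_series K (Suc n) = derived_series K n"
  proof (rule ccontr)
    assume "\<not> ?thesis"
    then have "complex_vector.dim (derived_series K (Suc n)) < complex_vector.dim (derived_series K n)"
      using dec[of n] by (intro dim_less fd_subspace sub) auto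
    then show False using n[of "Suc n"] by simp
  qed
  then have "derived_series K n = {0}"
    using DK[of n] by (intro perfect_isotropic_ideal ideal) (auto simp: K_def)
  then have "solvable K" unfolding solvable_def by (rule exI)
  then have "K = {0}" using ss K by (simp add: semisimple_def)
  moreover have "x \<in> K" using assms by (simp add: K_def)
  ultimately show ?thesis by simp
qed

subsection \<open>Semisimplicity of the Cartan subalgebra\<close>

text \<open>
  For \<open>x\<close>, \<open>y\<close> of opposite weights \<open>\<plusminus>\<alpha>\<close> the invariant form gives
  \<open>B([h, x], y) = B(h, [x, y]) = \<Sum>\<^sub>\<gamma> \<gamma>(h) tr\<^sub>\<gamma> [x, y]\<close>. Since
  \<open>tr\<^sub>\<gamma> (y x) = tr\<^bsub>\<gamma> + \<alpha>\<^esub> (x y)\<close>, summation by parts turns this into \<open>\<alpha>(h) B(x, y)\<close>. Hence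
  \<open>[h, x] - \<alpha>(h) x\<close> is orthogonal to everything. The case \<open>\<alpha> = 0\<close> says that \<open>H\<close> is abelian.
\<close>

lemma killing_bracket_weight:
  assumes x: "x \<in> gw \<alpha>" and y: "y \<in> gw \<beta>" and \<alpha>: "\<alpha> \<in> funs_on"
    and opp: "\<And>t. t \<in> H \<Longrightarrow> \<alpha> t + \<beta> t = 0" and h: "h \<in> H"
  shows "killing (bracket h x) y = \<alpha> h * killing x y"
proof -
  let ?z = "bracket x y"
  have "?z \<in> gw (\<lambda>_. 0)"
    using bracket_gw[OF x y] gw_cong[of "\<lambda>t. \<alpha> t + \<beta> t" "\<lambda>_. 0"] opp by simp
  then have z: "?z \<in> H" by (simp add: gw_zero)
  define a where "a \<gamma> = trace_on (gw \<gamma>) (\<lambda>u. bracket x (bracket y u))" for \<gamma>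
  have up: "bracket x u \<in> gw (\<lambda>t. \<gamma> t + \<alpha> t)" if "u \<in> gw \<gamma>" for u \<gamma>
    using bracket_gw[OF x that] by (simp add: add.commute)
  have down: "bracket y u \<in> gw \<gamma>" if "u \<in> gw (\<lambda>t. \<gamma> t + \<alpha> t)" for u \<gamma>
    using bracket_gw[OF y that] gw_cong[of "\<lambda>t. \<beta> t + (\<gamma> t + \<alpha> t)" \<gamma>] opp by (simp add: algebra_simps)
  have xy: "bracket x (bracket y u) \<in> gw \<gamma>" if "u \<in> gw \<gamma>" for u \<gamma>
    using up[OF down[of u "\<lambda>t. \<gamma> t - \<alpha> t"]] that by simp
  have yx: "bracket y (bracket x u) \<in> gw \<gamma>" if "u \<in> gw \<gamma>" for u \<gamma>
    using down[OF up[OF that]] .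
  have cyc: "trace_on (gw \<gamma>) (\<lambda>u. bracket y (bracket x u)) = a (\<lambda>t. \<gamma> t + \<alpha> t)" for \<gamma>
    unfolding a_def by (rule trace_on_cyclic[OF gw_fd gw_fd clinear_bracket_right up clinear_bracket_right down])
  have tz: "\<gamma> ?z * of_nat (gwdim \<gamma>) = a \<gamma> - a (\<lambda>t. \<gamma> t + \<alpha> t)" for \<gamma>
  proof -
    have "\<gamma> ?z * of_nat (gwdim \<gamma>) = trace_on (gw \<gamma>) (bracket ?z)"
      using z by (simp add: trace_ad_H_gw)
    also have "\<dots> = trace_on (gw \<gamma>) (\<lambda>u. bracket x (bracket y u) - bracket y (bracket x u))"
      by (rule trace_on_cong[OF gw_fd]) (rule bracket_of_bracket)
    also have "\<dots> = a \<gamma> - trace_on (gw \<gamma>) (\<lambda>u. bracket y (bracket x u))"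
      unfolding a_def by (rule trace_on_diff[OF gw_fd clinear_bracket2 clinear_bracket2 xy yx])
    finally show ?thesis by (simp add: cyc)
  qed
  have a0: "a \<gamma> = 0" if "\<gamma> \<in> funs_on" "\<gamma> \<notin> wts" for \<gamma>
    unfolding a_def gw_trivial[OF that] by (rule trace_on_zero_space)
  have a0': "a (\<lambda>t. \<gamma> t + \<alpha> t) = 0" if "\<gamma> \<in> funs_on" "\<gamma> \<notin> wts" for \<gamma>
    unfolding cyc[symmetric] gw_trivial[OF that] by (rule trace_on_zero_space)
  define V where "V = wts \<union> (\<lambda>\<gamma> t. \<gamma> t - \<alpha> t) ` wts"
  define s where "s \<gamma> = (\<lambda>t. \<gamma> t + \<alpha> t)" for \<gamma> :: "'g \<Rightarrow> complex"
  have fV: "finite V" using finite_wts by (simp add: V_def)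
  have Vf: "V \<subseteq> funs_on" using wts_funs_on funs_on_diff[OF _ \<alpha>] by (auto simp: V_def)
  have inj_s: "inj s" by (rule injI) (auto simp: s_def fun_eq_iff)
  have Ws: "wts \<subseteq> s ` V"
  proof
    fix \<gamma> assume "\<gamma> \<in> wts"
    moreover have "\<gamma> = s (\<lambda>t. \<gamma> t - \<alpha> t)" by (simp add: s_def)
    ultimately show "\<gamma> \<in> s ` V" unfolding V_def by blast
  qed
  have "(\<Sum>\<gamma>\<in>wts. \<gamma> h * a (s \<gamma>)) = (\<Sum>\<gamma>\<in>V. \<gamma> h * a (s \<gamma>))"
    by (rule sum.mono_neutral_left) (use fV Vf a0' in \<open>auto simp: V_def s_def\<close>)
  also have "\<dots> = (\<Sum>\<gamma>\<in>V. (s \<gamma> h - \<alpha> h) * a (s \<gamma>))" by (simp add: s_def)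
  also have "\<dots> = (\<Sum>\<gamma>\<in>s ` V. (\<gamma> h - \<alpha> h) * a \<gamma>)"
    by (rule sum.reindex_cong[symmetric, where l = s]) (use inj_s in \<open>auto intro: inj_on_subset\<close>)
  also have "\<dots> = (\<Sum>\<gamma>\<in>wts. (\<gamma> h - \<alpha> h) * a \<gamma>)"
    using fV Ws Vf a0 funs_on_add[OF _ \<alpha>]
    by (intro sum.mono_neutral_right) (auto simp: s_def)
  finally have parts: "(\<Sum>\<gamma>\<in>wts. \<gamma> h * a (s \<gamma>)) = (\<Sum>\<gamma>\<in>wts. (\<gamma> h - \<alpha> h) * a \<gamma>)" .
  have "killing (bracket h x) y = killing h ?z" by (rule killing_invariant)
  also have "\<dots> = (\<Sum>\<gamma>\<in>wts. \<gamma> h * (\<gamma> ?z * of_nat (gwdim \<gamma>)))"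
    unfolding killing_on_H[OF h z] by (simp add: algebra_simps)
  also have "\<dots> = (\<Sum>\<gamma>\<in>wts. \<gamma> h * a \<gamma>) - (\<Sum>\<gamma>\<in>wts. \<gamma> h * a (s \<gamma>))"
    unfolding tz by (simp add: s_def right_diff_distrib sum_subtractf)
  also have "\<dots> = \<alpha> h * (\<Sum>\<gamma>\<in>wts. a \<gamma>)"
    unfolding parts by (simp add: sum_subtractf[symmetric] sum_distrib_left algebra_simps)
  also have "(\<Sum>\<gamma>\<in>wts. a \<gamma>) = trace_on (cspan (\<Union>\<gamma>\<in>wts. gw \<gamma>)) (\<lambda>u. bracket x (bracket y u))"
    unfolding a_def by (rule trace_on_wts[symmetric, OF subset_refl clinear_bracket2 xy])
  also have "\<dots> = killing x y" by (simp add: gw_spans killing_trace)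
  finally show ?thesis .
qed

lemma bracket_H_weight:
  assumes x: "x \<in> gw \<alpha>" and \<alpha>: "\<alpha> \<in> funs_on" and h: "h \<in> H"
  shows "bracket h x = \<alpha> h *\<^sub>C x"
proof -
  let ?x = "bracket h x - \<alpha> h *\<^sub>C x"
  have x': "?x \<in> gw \<alpha>"
    using x h by (intro csubspace_diff[OF gw_subspace] csubspace_scale[OF gw_subspace] bracket_H_gw)
  have "y \<in> {y. killing ?x y = 0}" for y
  proof (rule gw_induct)
    show "csubspace {y. killing ?x y = 0}"
      by (rule csubspaceI) (auto simp: killing_add_right killing_scale_right)
    fix \<beta> y assume \<beta>: "\<beta> \<in> wts" and y: "y \<in> gw \<beta>"
    show "y \<in> {y. killing ?x y = 0}"
    proof (cases "\<forall>t\<in>H. \<alpha> t + \<beta> t = 0")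
      case True
      then show ?thesis
        using killing_bracket_weight[OF x y \<alpha> _ h] by (simp add: killing_diff_left killing_scale_left)
    next
      case False
      then show ?thesis using killing_gw_orthogonal[OF x' y] by auto
    qed
  qed
  then have "?x = 0" using killing_nondegenerate by blast
  then show ?thesis by simp
qed

theorem H_abelian: "h \<in> H \<Longrightarrow> k \<in> H \<Longrightarrow> bracket h k = 0"
  using bracket_H_weight[of k "\<lambda>_. 0" h] gw_zero funs_on_zero by simp

theorem root_space_decomposition: "cspan (H \<union> (\<Union>\<alpha>\<in>roots H. root_space H \<alpha>)) = UNIV"
proof -
  have "x \<in> cspan (H \<union> (\<Union>\<alpha>\<in>roots H. root_space H \<alpha>))" for x
  proof (rule gw_induct)
    fix \<alpha> x assume \<alpha>: "\<alpha> \<in> wts" and x: "x \<in> gw \<alpha>"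
    show "x \<in> cspan (H \<union> (\<Union>\<alpha>\<in>roots H. root_space H \<alpha>))"
    proof (cases "\<alpha> = (\<lambda>_. 0)")
      case True
      then show ?thesis using x gw_zero by (auto intro: cspan_base)
    next
      case False
      have sub: "gw \<alpha> \<subseteq> root_space H \<alpha>"
        using bracket_H_weight[OF _ wts_funs_on[OF \<alpha>]] by (auto simp: root_space_def)
      have "gw \<alpha> \<noteq> {0}" using \<alpha> by (simp add: wts_def)
      then have "root_space H \<alpha> \<noteq> {0}" using sub csubspace_0[OF gw_subspace, of \<alpha>] by blast
      moreover have "\<alpha> \<in> dual_space H"
        using wts_add[OF \<alpha>] wts_scale[OF \<alpha>] wts_funs_on[OF \<alpha>] by (auto simp: dual_space_def funs_on_def)
      ultimately have "\<alpha> \<in> roots H" using False by (simp add: roots_def)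
      then show ?thesis using sub x by (intro cspan_base) blast
    qed
  qed simp
  then show ?thesis by blast
qed

end

section \<open>Highest weight modules\<close>

instantiation prod :: (complex_vector, complex_vector) complex_vector
begin

definition scaleC_prod :: "complex \<Rightarrow> 'a \<times> 'b \<Rightarrow> 'a \<times> 'b"
  where "scaleC_prod c x = (c *\<^sub>C fst x, c *\<^sub>C snd x)"

instance
  by standard (simp_all add: scaleC_prod_def prod_eq_iff scaleC_add_right scaleC_add_left scaleC_scaleC scaleC_one)

end

lemma fst_scaleC [simp]: "fst (c *\<^sub>C x) = c *\<^sub>C fst x"
  and snd_scaleC [simp]: "snd (c *\<^sub>C x) = c *\<^sub>C snd x"
  by (simp_all add: scaleC_prod_def)

lemma submodule_hull: "submodule A \<rho> (submodule A \<rho> hull F)"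
  unfolding hull_def submodule_def
  by (auto intro!: complex_vector.subspace_Inter)

lemma submodule_vimage:
  assumes "clinear f" "\<And>X x. f (\<rho> X x) = \<pi> X (f x)" "submodule A \<pi> W"
  shows "submodule A \<rho> {x. f x \<in> W}"
  using assms csubspace_vimage[OF assms(1)] by (simp add: submodule_def)

lemma submodule_image:
  assumes "clinear f" "\<And>X x. f (\<pi> X x) = \<rho> X (f x)" "submodule A \<pi> W"
  shows "submodule A \<rho> (f ` W)"
  unfolding submodule_def
proof (intro conjI ballI)
  show "csubspace (f ` W)" using assms(3) by (intro csubspace_image[OF assms(1)]) (simp add: submodule_def)
  fix X y assume X: "X \<in> A" and "y \<in> f ` W"
  then obtain w where w: "w \<in> W" "y = f w" by blast
  then have "\<pi> X w \<in> W" using assms(3) X by (simp add: submodule_def)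
  then show "\<rho> X y \<in> f ` W" unfolding w(2) assms(2)[symmetric] by (rule imageI)
qed

locale lie_simple_roots = cartan_pair H for H :: "'g::lie_algebra set" +
  fixes \<Delta> :: "('g \<Rightarrow> complex) set"
  assumes simple: "simple_system H \<Delta>"
begin

definition Qplus :: "('g \<Rightarrow> complex) set"
  where "Qplus = {\<lambda>t. \<Sum>\<alpha>\<in>\<Delta>. of_nat (k \<alpha>) * \<alpha> t | k :: ('g \<Rightarrow> complex) \<Rightarrow> nat. True}"

lemma Qplus_zero: "(\<lambda>t. 0) \<in> Qplus"
  unfolding Qplus_def by (rule CollectI, rule exI[of _ "\<lambda>_. 0"]) simp

lemma Qplus_add: "a \<in> Qplus \<Longrightarrow> b \<in> Qplus \<Longrightarrow> (\<lambda>t. a t + b t) \<in> Qplus"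
  unfolding Qplus_def
proof safe
  fix k l :: "('g \<Rightarrow> complex) \<Rightarrow> nat"
  show "\<exists>m. (\<lambda>t. (\<Sum>\<alpha>\<in>\<Delta>. of_nat (k \<alpha>) * \<alpha> t) + (\<Sum>\<alpha>\<in>\<Delta>. of_nat (l \<alpha>) * \<alpha> t)) =
      (\<lambda>t. \<Sum>\<alpha>\<in>\<Delta>. of_nat (m \<alpha>) * \<alpha> t) \<and> True"
    by (rule exI[of _ "\<lambda>\<alpha>. k \<alpha> + l \<alpha>"]) (simp add: sum.distrib distrib_right)
qed

lemma Qplus_sum_zero:
  assumes "a \<in> Qplus" "b \<in> Qplus" "\<And>t. a t + b t = 0"
  shows "a = (\<lambda>t. 0)"
proof -
  obtain k l :: "('g \<Rightarrow> complex) \<Rightarrow> nat" where k: "a = (\<lambda>t. \<Sum>\<alpha>\<in>\<Delta>. of_nat (k \<alpha>) * \<alpha> t)"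
    and l: "b = (\<lambda>t. \<Sum>\<alpha>\<in>\<Delta>. of_nat (l \<alpha>) * \<alpha> t)" using assms(1,2) unfolding Qplus_def by blast
  have "(\<Sum>\<alpha>\<in>\<Delta>. of_real (real (k \<alpha> + l \<alpha>)) * \<alpha> t) = 0" for t
    using assms(3)[of t] by (simp add: k l sum.distrib distrib_right)
  moreover have "(\<forall>t. (\<Sum>\<alpha>\<in>\<Delta>. of_real (r \<alpha>) * \<alpha> t) = 0) \<longrightarrow> (\<forall>\<alpha>\<in>\<Delta>. r \<alpha> = 0)"
    for r :: "('g \<Rightarrow> complex) \<Rightarrow> real"
    using simple unfolding simple_system_def by blast
  from this[of "\<lambda>\<alpha>. real (k \<alpha> + l \<alpha>)"]
  have "(\<forall>t. (\<Sum>\<alpha>\<in>\<Delta>. of_real (real (k \<alpha> + l \<alpha>)) * \<alpha> t) = 0) \<longrightarrow> (\<forall>\<alpha>\<in>\<Delta>. real (k \<alpha> + l \<alpha>) = 0)" .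
  ultimately have "\<forall>\<alpha>\<in>\<Delta>. real (k \<alpha> + l \<alpha>) = 0" by simp
  then show ?thesis by (simp add: k add_nonneg_eq_0_iff)
qed

lemma roots_funs_on: "\<beta> \<in> roots H \<Longrightarrow> \<beta> \<in> funs_on"
  by (auto simp: roots_def dual_space_def funs_on_def)

lemma roots_nonzero: "\<beta> \<in> roots H \<Longrightarrow> \<beta> \<noteq> (\<lambda>t. 0)"
  by (auto simp: roots_def)

lemma positive_roots_iff: "\<beta> \<in> positive_roots H \<Delta> \<longleftrightarrow> \<beta> \<in> roots H \<and> \<beta> \<in> Qplus"
  unfolding positive_roots_def Qplus_def by blast

text \<open>
  Being in the cone or in its negative is all that is retained of a simple system, together with
  \<open>Qplus_sum_zero\<close>, which makes the order induced by the cone antisymmetric.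
\<close>

lemma roots_cases:
  assumes "\<beta> \<in> roots H"
  shows "\<beta> \<in> Qplus \<or> (\<lambda>t. - \<beta> t) \<in> Qplus"
proof -
  obtain k :: "('g \<Rightarrow> complex) \<Rightarrow> int" where k: "\<beta> = (\<lambda>t. \<Sum>\<alpha>\<in>\<Delta>. of_int (k \<alpha>) * \<alpha> t)"
    "(\<forall>\<alpha>\<in>\<Delta>. k \<alpha> \<ge> 0) \<or> (\<forall>\<alpha>\<in>\<Delta>. k \<alpha> \<le> 0)"
    using simple assms unfolding simple_system_def by blast
  show ?thesis
    using k(2)
  proof
    assume "\<forall>\<alpha>\<in>\<Delta>. k \<alpha> \<ge> 0"
    then have "\<beta> = (\<lambda>t. \<Sum>\<alpha>\<in>\<Delta>. of_nat (nat (k \<alpha>)) * \<alpha> t)"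
      unfolding k(1) by (intro ext sum.cong refl) simp
    then have "\<beta> \<in> Qplus" unfolding Qplus_def by (intro CollectI exI[of _ "\<lambda>\<alpha>. nat (k \<alpha>)"]) simp
    then show ?thesis ..
  next
    assume "\<forall>\<alpha>\<in>\<Delta>. k \<alpha> \<le> 0"
    then have "(\<lambda>t. - \<beta> t) = (\<lambda>t. \<Sum>\<alpha>\<in>\<Delta>. of_nat (nat (- k \<alpha>)) * \<alpha> t)"
      unfolding k(1) sum_negf[symmetric] by (intro ext sum.cong refl) (simp add: of_nat_nat)
    then have "(\<lambda>t. - \<beta> t) \<in> Qplus" unfolding Qplus_def by (intro CollectI exI[of _ "\<lambda>\<alpha>. nat (- k \<alpha>)"]) simp
    then show ?thesis ..
  qed
qed

lemma bracket_root_space: "h \<in> H \<Longrightarrow> x \<in> root_space H \<alpha> \<Longrightarrow> bracket h x = \<alpha> h *\<^sub>C x"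
  by (simp add: root_space_def)

subsection \<open>Weight spaces\<close>

definition weight_space :: "('g \<Rightarrow> 'v \<Rightarrow> 'v) \<Rightarrow> ('g \<Rightarrow> complex) \<Rightarrow> 'v::complex_vector set"
  where "weight_space \<tau> \<mu> = {x. \<forall>h\<in>H. \<tau> h x = \<mu> h *\<^sub>C x}"

lemma weight_spaceD: "x \<in> weight_space \<tau> \<mu> \<Longrightarrow> h \<in> H \<Longrightarrow> \<tau> h x = \<mu> h *\<^sub>C x"
  by (simp add: weight_space_def)

lemma csubspace_weight_space:
  assumes "\<And>h. h \<in> H \<Longrightarrow> clinear (\<tau> h)"
  shows "csubspace (weight_space \<tau> \<mu>)"
  by (rule csubspaceI)
    (auto simp: weight_space_def clinear_0[OF assms] clinear_add[OF assms] clinear_scale[OF assms]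
      scaleC_add_right scaleC_scaleC mult.commute)

lemma weight_space_gen_eigen: "h \<in> H \<Longrightarrow> weight_space \<tau> \<mu> \<subseteq> gen_eigen (\<tau> h) (\<mu> h)"
  by (auto simp: weight_space_def gen_eigen_def shifted_def intro!: exI[of _ 1])

lemma weight_spaces_independent:
  assumes lin: "\<And>h. h \<in> H \<Longrightarrow> clinear (\<tau> h)"
    and "finite F" "F \<subseteq> funs_on" "csubspace N" "\<And>h x. h \<in> H \<Longrightarrow> x \<in> N \<Longrightarrow> \<tau> h x \<in> N"
    "\<And>\<mu>. \<mu> \<in> F \<Longrightarrow> x \<mu> \<in> weight_space \<tau> \<mu>" "(\<Sum>\<mu>\<in>F. x \<mu>) \<in> N" "\<mu> \<in> F"
  shows "x \<mu> \<in> N"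
proof (rule weights_independent[where A = H and \<tau> = \<tau> and W = "weight_space \<tau>" and F = F])
  show "\<exists>h\<in>H. \<mu> h \<noteq> \<nu> h" if "\<mu> \<in> F" "\<nu> \<in> F" "\<mu> \<noteq> \<nu>" for \<mu> \<nu>
    using that assms(3) by (intro funs_on_distinct) auto
  show "\<tau> h x \<in> weight_space \<tau> \<mu>" if "h \<in> H" "x \<in> weight_space \<tau> \<mu>" for h x \<mu>
    using csubspace_scale[OF csubspace_weight_space[OF lin] that(2)] weight_spaceD[OF that(2,1)] by simp
qed (use assms in \<open>simp_all add: csubspace_weight_space weight_space_gen_eigen\<close>)

lemma weight_spaces_disjoint:
  assumes lin: "\<And>h. h \<in> H \<Longrightarrow> clinear (\<tau> h)" and S: "S \<subseteq> funs_on"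
    and x: "x \<in> cspan (\<Union>\<mu>\<in>S. weight_space \<tau> \<mu>)" "x \<in> weight_space \<tau> \<nu>" and \<nu>: "\<nu> \<in> funs_on" "\<nu> \<notin> S"
  shows "x = 0"
proof -
  obtain F y where F: "finite F" "F \<subseteq> S" "\<And>\<mu>. \<mu> \<in> F \<Longrightarrow> y \<mu> \<in> weight_space \<tau> \<mu>" "x = (\<Sum>\<mu>\<in>F. y \<mu>)"
    by (rule cspan_Union_decompose[OF x(1)]) (auto intro: csubspace_weight_space lin)
  define z where "z \<mu> = (if \<mu> = \<nu> then - x else y \<mu>)" for \<mu>
  have nF: "\<nu> \<notin> F" using F(2) \<nu>(2) by blast
  have "(\<Sum>\<mu>\<in>F. z \<mu>) = x" unfolding F(4) by (rule sum.cong) (use nF in \<open>auto simp: z_def\<close>)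
  then have "(\<Sum>\<mu>\<in>insert \<nu> F. z \<mu>) \<in> {0}" using nF F(1) by (simp add: z_def)
  moreover have "z \<mu> \<in> weight_space \<tau> \<mu>" if "\<mu> \<in> insert \<nu> F" for \<mu>
    using that F(3) x(2) csubspace_neg[OF csubspace_weight_space[OF lin]] by (auto simp: z_def)
  moreover have "insert \<nu> F \<subseteq> funs_on" using F(2) S \<nu>(1) by blast
  moreover have "\<tau> h x \<in> {0}" if "h \<in> H" "x \<in> {0}" for h x using that clinear_0[OF lin[OF that(1)]] by simp
  ultimately have "z \<nu> \<in> {0}"
    using F(1) by (intro weight_spaces_independent[where \<tau> = \<tau> and F = "insert \<nu> F" and N = "{0}" and x = z]) (auto intro: lin)
  then show ?thesis by (simp add: z_def)
qed

text \<open>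
  Highest weight modules and the spin module are both obtained from one vector by operators that
  lower weights: negative root vectors in the first case, Clifford multiplication by elements of
  the opposite nilradical in the second. The following notions cover both. The counter of
  \<open>lowered\<close> is what defines odd and even parts of the spin module.
\<close>

definition lowering :: "('g \<Rightarrow> 'v \<Rightarrow> 'v) \<Rightarrow> (('v::complex_vector \<Rightarrow> 'v) \<times> ('g \<Rightarrow> complex)) set \<Rightarrow> bool"
  where "lowering \<tau> L \<longleftrightarrow> (\<forall>(f, \<beta>)\<in>L. \<beta> \<in> Qplus \<and> \<beta> \<in> funs_on \<and> \<beta> \<noteq> (\<lambda>t. 0) \<and>
    (\<forall>\<mu>. \<forall>x\<in>weight_space \<tau> \<mu>. f x \<in> weight_space \<tau> (\<lambda>t. \<mu> t - \<beta> t)))"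

inductive lowered :: "(('v::complex_vector \<Rightarrow> 'v) \<times> ('g \<Rightarrow> complex)) set \<Rightarrow> 'v \<Rightarrow> ('g \<Rightarrow> complex) \<Rightarrow>
    nat \<Rightarrow> 'v \<Rightarrow> ('g \<Rightarrow> complex) \<Rightarrow> bool"
  for L v \<nu>
  where
    start: "lowered L v \<nu> 0 v \<nu>"
  | step: "lowered L v \<nu> n w \<mu> \<Longrightarrow> (f, \<beta>) \<in> L \<Longrightarrow> lowered L v \<nu> (Suc n) (f w) (\<lambda>t. \<mu> t - \<beta> t)"

definition below :: "('g \<Rightarrow> complex) \<Rightarrow> ('g \<Rightarrow> complex) set"
  where "below \<nu> = {\<lambda>t. \<nu> t - q t | q. q \<in> Qplus \<and> q \<in> funs_on}"

lemma belowI: "q \<in> Qplus \<Longrightarrow> q \<in> funs_on \<Longrightarrow> (\<And>t. \<mu> t = \<nu> t - q t) \<Longrightarrow> \<mu> \<in> below \<nu>"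
  unfolding below_def by (rule CollectI, rule exI[of _ q]) auto

lemma belowE:
  assumes "\<mu> \<in> below \<nu>"
  obtains q where "q \<in> Qplus" "q \<in> funs_on" "\<And>t. \<mu> t = \<nu> t - q t"
  using assms unfolding below_def by auto

abbreviation lower_span :: "('g \<Rightarrow> 'v \<Rightarrow> 'v) \<Rightarrow> ('g \<Rightarrow> complex) \<Rightarrow> 'v::complex_vector set"
  where "lower_span \<tau> \<nu> \<equiv> cspan (\<Union>\<mu>\<in>below \<nu> - {\<nu>}. weight_space \<tau> \<mu>)"

lemma below_refl: "\<nu> \<in> below \<nu>"
  by (rule belowI[OF Qplus_zero funs_on_zero]) simp

lemma below_minus:
  assumes "\<mu> \<in> below \<nu>" "\<beta> \<in> Qplus" "\<beta> \<in> funs_on" shows "(\<lambda>t. \<mu> t - \<beta> t) \<in> below \<nu>"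
proof -
  obtain q where q: "q \<in> Qplus" "q \<in> funs_on" "\<And>t. \<mu> t = \<nu> t - q t" using belowE[OF assms(1)] by metis
  show ?thesis
    by (rule belowI[OF Qplus_add[OF q(1) assms(2)] funs_on_add[OF q(2) assms(3)]]) (simp add: q(3))
qed

lemma below_antisym:
  assumes "\<mu> \<in> below \<nu>" "\<nu> \<in> below \<mu>" shows "\<mu> = \<nu>"
proof -
  obtain q where q: "q \<in> Qplus" "\<And>t. \<mu> t = \<nu> t - q t" using belowE[OF assms(1)] by metis
  obtain r where r: "r \<in> Qplus" "\<And>t. \<nu> t = \<mu> t - r t" using belowE[OF assms(2)] by metis
  have "q t + r t = 0" for t using q(2)[of t] r(2)[of t] by algebra
  then have "q = (\<lambda>t. 0)" by (rule Qplus_sum_zero[OF q(1) r(1)])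
  then show "\<mu> = \<nu>" using q(2) by auto
qed

lemma below_trans:
  assumes "\<mu> \<in> below \<nu>" "\<nu> \<in> below \<kappa>" shows "\<mu> \<in> below \<kappa>"
proof -
  obtain q where q: "q \<in> Qplus" "q \<in> funs_on" "\<And>t. \<mu> t = \<nu> t - q t" using belowE[OF assms(1)] by metis
  obtain r where r: "r \<in> Qplus" "r \<in> funs_on" "\<And>t. \<nu> t = \<kappa> t - r t" using belowE[OF assms(2)] by metis
  show ?thesis
    by (rule belowI[OF Qplus_add[OF r(1) q(1)] funs_on_add[OF r(2) q(2)]]) (simp add: q(3) r(3))
qed

lemma below_funs_on: "\<mu> \<in> below \<nu> \<Longrightarrow> \<nu> \<in> funs_on \<Longrightarrow> \<mu> \<in> funs_on"
  using funs_on_diff[of \<nu>] by (auto simp: below_def)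

lemma below_add:
  assumes "\<mu> \<in> below \<nu>" "\<mu>' \<in> below \<nu>'"
  shows "(\<lambda>t. \<mu> t + \<mu>' t) \<in> below (\<lambda>t. \<nu> t + \<nu>' t)"
proof -
  obtain q where q: "q \<in> Qplus" "q \<in> funs_on" "\<And>t. \<mu> t = \<nu> t - q t" using belowE[OF assms(1)] by metis
  obtain r where r: "r \<in> Qplus" "r \<in> funs_on" "\<And>t. \<mu>' t = \<nu>' t - r t" using belowE[OF assms(2)] by metis
  show ?thesis
    by (rule belowI[OF Qplus_add[OF q(1) r(1)] funs_on_add[OF q(2) r(2)]]) (simp add: q(3) r(3))
qed

lemma below_cancel:
  assumes "(\<lambda>t. \<mu> t + \<sigma> t) \<in> below (\<lambda>t. \<nu> t + \<sigma> t)"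
  shows "\<mu> \<in> below \<nu>"
proof -
  obtain q where q: "q \<in> Qplus" "q \<in> funs_on" "\<And>t. \<mu> t + \<sigma> t = (\<nu> t + \<sigma> t) - q t"
    using belowE[OF assms] by metis
  show ?thesis by (rule belowI[OF q(1,2)]) (use q(3) in \<open>simp add: algebra_simps\<close>)
qed

lemma lowered_weight:
  assumes "lowering \<tau> L" "v \<in> weight_space \<tau> \<nu>" "lowered L v \<nu> n w \<mu>"
  shows "w \<in> weight_space \<tau> \<mu>" "\<mu> \<in> below \<nu>" "n > 0 \<Longrightarrow> \<mu> \<noteq> \<nu>"
proof -
  have "w \<in> weight_space \<tau> \<mu> \<and> \<mu> \<in> below \<nu> \<and> (n > 0 \<longrightarrow> \<mu> \<noteq> \<nu>)"
    using assms(3)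
  proof induction
    case start
    then show ?case using assms(2) below_refl by simp
  next
    case (step n w \<mu> f \<beta>)
    then have \<beta>: "\<beta> \<in> Qplus" "\<beta> \<in> funs_on" "\<beta> \<noteq> (\<lambda>t. 0)"
      "f w \<in> weight_space \<tau> (\<lambda>t. \<mu> t - \<beta> t)"
      using assms(1) unfolding lowering_def by blast+
    have "(\<lambda>t. \<mu> t - \<beta> t) \<noteq> \<nu>"
    proof
      assume "(\<lambda>t. \<mu> t - \<beta> t) = \<nu>"
      then have "\<nu> \<in> below \<mu>" using belowI[OF \<beta>(1,2)] by metis
      then have "\<mu> = \<nu>" using step below_antisym by blast
      then have "\<beta> t = 0" for t using fun_cong[OF \<open>(\<lambda>t. \<mu> t - \<beta> t) = \<nu>\<close>, of t] by simp
      then show False using \<beta>(3) by blast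
    qed
    then show ?case using \<beta> below_minus step by blast
  qed
  then show "w \<in> weight_space \<tau> \<mu>" "\<mu> \<in> below \<nu>" "n > 0 \<Longrightarrow> \<mu> \<noteq> \<nu>" by auto
qed

definition lowered_span :: "(('v::complex_vector \<Rightarrow> 'v) \<times> ('g \<Rightarrow> complex)) set \<Rightarrow> 'v \<Rightarrow> ('g \<Rightarrow> complex) \<Rightarrow> 'v set"
  where "lowered_span L v \<nu> = cspan {w. \<exists>n \<mu>. lowered L v \<nu> n w \<mu>}"

lemma lowered_in_span: "lowered L v \<nu> n w \<mu> \<Longrightarrow> w \<in> lowered_span L v \<nu>"
  unfolding lowered_span_def by (rule cspan_base) blast

lemma csubspace_lowered_span: "csubspace (lowered_span L v \<nu>)"
  unfolding lowered_span_def by simp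

lemma lowered_span_below:
  assumes "lowering \<tau> L" "v \<in> weight_space \<tau> \<nu>"
  shows "lowered_span L v \<nu> \<subseteq> cspan (insert v (\<Union>\<mu>\<in>below \<nu> - {\<nu>}. weight_space \<tau> \<mu>))"
  unfolding lowered_span_def
proof (rule cspan_mono, clarify)
  fix w n \<mu> assume w: "lowered L v \<nu> n w \<mu>" "w \<notin> (\<Union>\<mu>\<in>below \<nu> - {\<nu>}. weight_space \<tau> \<mu>)"
  have "n = 0" using lowered_weight[OF assms w(1)] w(2) by auto
  with w(1) show "w = v" by (cases rule: lowered.cases) auto
qed

text \<open>
  The vector spans its weight space and all other weights are strictly below its weight. Expressed
  by a spanning set, this passes to tensor products.
\<close>

definition top_vector :: "('g \<Rightarrow> 'v \<Rightarrow> 'v) \<Rightarrow> ('g \<Rightarrow> complex) \<Rightarrow> 'v::complex_vector \<Rightarrow> bool"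
  where "top_vector \<tau> \<nu> v \<longleftrightarrow> \<nu> \<in> funs_on \<and> v \<noteq> 0 \<and> v \<in> weight_space \<tau> \<nu> \<and>
    cspan (insert v (\<Union>\<mu>\<in>below \<nu> - {\<nu>}. weight_space \<tau> \<mu>)) = UNIV"

text \<open>
  Modulo \<open>v\<close> the vector \<open>x\<close> is a sum of vectors of weights different from \<open>\<nu>\<close>, and weight spaces
  are independent.
\<close>

lemma top_weight_line:
  assumes lin: "\<And>h. h \<in> H \<Longrightarrow> clinear (\<tau> h)" and v: "v \<in> weight_space \<tau> \<nu>" and \<nu>: "\<nu> \<in> funs_on"
    and x: "x \<in> cspan (insert v (\<Union>\<mu>\<in>below \<nu> - {\<nu>}. weight_space \<tau> \<mu>))" "x \<in> weight_space \<tau> \<nu>"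
  shows "\<exists>c. x = c *\<^sub>C v"
proof -
  let ?S = "below \<nu> - {\<nu>}"
  obtain c where c: "x - c *\<^sub>C v \<in> cspan (\<Union>\<mu>\<in>?S. weight_space \<tau> \<mu>)"
    using x(1) unfolding complex_vector.span_breakdown_eq by blast
  moreover have "x - c *\<^sub>C v \<in> weight_space \<tau> \<nu>"
    using x(2) v csubspace_weight_space[OF lin] by (intro csubspace_diff csubspace_scale) auto
  moreover have "?S \<subseteq> funs_on" using below_funs_on \<nu> by blast
  ultimately have "x - c *\<^sub>C v = 0"
    using \<nu> by (intro weight_spaces_disjoint[where \<tau> = \<tau> and S = ?S and \<nu> = \<nu>]) (auto intro: lin)
  then show ?thesis by (intro exI[of _ c]) simp
qed

lemma top_vector_span_weights:
  assumes "top_vector \<tau> \<nu> v"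
  shows "cspan (\<Union>\<mu>\<in>below \<nu>. weight_space \<tau> \<mu>) = UNIV"
proof -
  have "insert v (\<Union>\<mu>\<in>below \<nu> - {\<nu>}. weight_space \<tau> \<mu>) \<subseteq> (\<Union>\<mu>\<in>below \<nu>. weight_space \<tau> \<mu>)"
    using assms below_refl by (auto simp: top_vector_def)
  from cspan_mono[OF this] show ?thesis using assms by (auto simp: top_vector_def)
qed

subsection \<open>Modules generated by a highest weight vector\<close>

lemma lie_moduleD:
  assumes "lie_module \<rho>"
  shows "clinear (\<rho> X)" "clinear (\<lambda>X. \<rho> X v)" "\<rho> (bracket X Y) v = \<rho> X (\<rho> Y v) - \<rho> Y (\<rho> X v)"
  using assms unfolding lie_module_def by blast+

definition highest_weight_vector :: "('g \<Rightarrow> 'v \<Rightarrow> 'v::complex_vector) \<Rightarrow> ('g \<Rightarrow> complex) \<Rightarrow> 'v \<Rightarrow> bool"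
  where "highest_weight_vector \<rho> \<nu> v \<longleftrightarrow> \<nu> \<in> funs_on \<and> v \<noteq> 0 \<and> v \<in> weight_space \<rho> \<nu> \<and>
    (\<forall>\<beta>\<in>positive_roots H \<Delta>. \<forall>e\<in>root_space H \<beta>. \<rho> e v = 0)"

definition negative_root_operators ::
    "('g \<Rightarrow> 'v \<Rightarrow> 'v::complex_vector) \<Rightarrow> (('v \<Rightarrow> 'v) \<times> ('g \<Rightarrow> complex)) set"
  where "negative_root_operators \<rho> = {(\<rho> f, \<beta>) | f \<beta>. (\<lambda>t. - \<beta> t) \<in> roots H \<and> \<beta> \<in> Qplus \<and>
    f \<in> root_space H (\<lambda>t. - \<beta> t)}"

lemma root_vector_weight:
  assumes "lie_module \<rho>" "x \<in> weight_space \<rho> \<mu>" "e \<in> root_space H \<beta>"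
  shows "\<rho> e x \<in> weight_space \<rho> (\<lambda>t. \<mu> t + \<beta> t)"
  unfolding weight_space_def
proof safe
  fix h assume h: "h \<in> H"
  note lin = lie_moduleD[OF assms(1)]
  have "\<rho> h (\<rho> e x) = \<rho> (bracket h e) x + \<rho> e (\<rho> h x)" using lin(3)[of h e x] by simp
  also have "\<dots> = \<beta> h *\<^sub>C \<rho> e x + \<mu> h *\<^sub>C \<rho> e x"
    using h assms(2,3) by (simp add: bracket_root_space weight_spaceD clinear_scale[OF lin(1)] clinear_scale[OF lin(2)])
  finally show "\<rho> h (\<rho> e x) = (\<mu> h + \<beta> h) *\<^sub>C \<rho> e x" by (simp add: scaleC_add_left)
qed

lemma lowering_negative_root_operators:
  assumes "lie_module \<rho>" shows "lowering \<rho> (negative_root_operators \<rho>)"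
  unfolding lowering_def
proof (clarify, intro conjI allI ballI)
  fix f \<beta> assume "(f, \<beta>) \<in> negative_root_operators \<rho>"
  then obtain y where y: "f = \<rho> y" "(\<lambda>t. - \<beta> t) \<in> roots H" "\<beta> \<in> Qplus" "y \<in> root_space H (\<lambda>t. - \<beta> t)"
    by (auto simp: negative_root_operators_def)
  show "\<beta> \<in> Qplus" by fact
  show "\<beta> \<in> funs_on" using roots_funs_on[OF y(2)] by (simp add: funs_on_def)
  show "\<beta> \<noteq> (\<lambda>t. 0)" using roots_nonzero[OF y(2)] by auto
  show "f x \<in> weight_space \<rho> (\<lambda>t. \<mu> t - \<beta> t)" if "x \<in> weight_space \<rho> \<mu>" for x \<mu>
    using root_vector_weight[OF assms that y(4)] y(1) by simp
qed

text \<open>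
  A raising operator is moved to the right, \<open>x f = f x + [x, f]\<close>, until it meets \<open>v\<close>; the
  commutators are covered by proving the claim for all \<open>x\<close> in the Lie algebra at once.
\<close>

lemma submodule_lowered_span:
  assumes \<rho>: "lie_module \<rho>" and v: "highest_weight_vector \<rho> \<nu> v"
  shows "submodule UNIV \<rho> (lowered_span (negative_root_operators \<rho>) v \<nu>)"
proof -
  let ?L = "negative_root_operators \<rho>" let ?W = "lowered_span ?L v \<nu>"
  note lin = lie_moduleD[OF \<rho>] and sW = csubspace_lowered_span[of ?L v \<nu>]
  note low = lowering_negative_root_operators[OF \<rho>]
  have v': "v \<in> weight_space \<rho> \<nu>" using v by (simp add: highest_weight_vector_def)
  have fW: "f w \<in> ?W" if "(f, \<beta>) \<in> ?L" "w \<in> ?W" for f \<beta> w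
  proof (rule clinear_image_cspan[OF _ that(2)[unfolded lowered_span_def] _ sW])
    show "clinear f" using that(1) lin by (auto simp: negative_root_operators_def)
    fix y assume "y \<in> {w. \<exists>n \<mu>. lowered ?L v \<nu> n w \<mu>}"
    then show "f y \<in> ?W" using that(1) by (auto intro: lowered_in_span lowered.step)
  qed
  have "\<forall>x. \<rho> x w \<in> ?W" if "lowered ?L v \<nu> n w \<mu>" for n w \<mu>
    using that
  proof induction
    case start
    show ?case
    proof
      fix x
      have "x \<in> cspan (H \<union> (\<Union>\<alpha>\<in>roots H. root_space H \<alpha>))" by (simp add: root_space_decomposition)
      then show "\<rho> x v \<in> ?W"
      proof (rule clinear_image_cspan[OF lin(2) _ _ sW])
        fix x assume "x \<in> H \<union> (\<Union>\<alpha>\<in>roots H. root_space H \<alpha>)"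
        then consider "x \<in> H" | \<beta> where "\<beta> \<in> roots H" "x \<in> root_space H \<beta>" "\<beta> \<in> Qplus"
          | \<beta> where "\<beta> \<in> roots H" "x \<in> root_space H \<beta>" "(\<lambda>t. - \<beta> t) \<in> Qplus"
          using roots_cases by blast
        then show "\<rho> x v \<in> ?W"
        proof cases
          case 1
          have "v \<in> ?W" by (rule lowered_in_span[OF lowered.start])
          then show ?thesis using weight_spaceD[OF v' 1] by (simp add: csubspace_scale[OF sW])
        next
          case (2 \<beta>)
          then have "\<rho> x v = 0" using v by (simp add: highest_weight_vector_def positive_roots_iff)
          then show ?thesis using csubspace_0[OF sW] by simp
        next
          case (3 \<beta>)
          then have "(\<rho> x, \<lambda>t. - \<beta> t) \<in> ?L" unfolding negative_root_operators_def by auto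
          then show ?thesis by (rule fW[OF _ lowered_in_span[OF lowered.start]])
        qed
      qed
    qed
  next
    case (step n w \<mu> f \<beta>)
    obtain y where y: "f = \<rho> y" using step.hyps(2) by (auto simp: negative_root_operators_def)
    show ?case
    proof
      fix x
      have "\<rho> x (f w) = \<rho> (bracket x y) w + f (\<rho> x w)" using lin(3)[of x y w] by (simp add: y)
      also have "\<dots> \<in> ?W" using step fW[OF step.hyps(2)] by (intro csubspace_add[OF sW]) auto
      finally show "\<rho> x (f w) \<in> ?W" .
    qed
  qed
  then have "\<rho> x w \<in> ?W" if "w \<in> ?W" for x w
    using clinear_image_cspan[OF lin(1) that[unfolded lowered_span_def] _ sW] by blast
  then show ?thesis using sW by (simp add: submodule_def)
qed

lemma simple_moduleD:
  assumes "simple_module \<rho>" "submodule UNIV \<rho> W" "w \<in> W" "w \<noteq> 0"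
  shows "W = UNIV"
  using assms unfolding simple_submodule_def by blast

lemma simple_highest_weight_span:
  assumes "lie_module \<rho>" "simple_module \<rho>" "highest_weight_vector \<rho> \<nu> v"
  shows "lowered_span (negative_root_operators \<rho>) v \<nu> = UNIV"
  using simple_moduleD[OF assms(2) submodule_lowered_span[OF assms(1,3)] lowered_in_span[OF lowered.start]] assms(3)
  by (simp add: highest_weight_vector_def)

lemma top_vector_highest_weight:
  assumes "lie_module \<rho>" "simple_module \<rho>" "highest_weight_vector \<rho> \<nu> v"
  shows "top_vector \<rho> \<nu> v"
proof -
  have v: "v \<in> weight_space \<rho> \<nu>" using assms(3) by (simp add: highest_weight_vector_def)
  show ?thesis
    using lowered_span_below[OF lowering_negative_root_operators[OF assms(1)] v]
      simple_highest_weight_span[OF assms] assms(3)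
    by (auto simp: top_vector_def highest_weight_vector_def)
qed

text \<open>
  If \<open>v\<close>, \<open>v'\<close> are highest weight vectors of the same weight, then the submodule of the direct
  sum generated by \<open>(v, v')\<close> has a one-dimensional top weight space. It therefore contains
  neither summand and is the graph of an isomorphism.
\<close>

lemma simple_highest_weight_iso:
  fixes \<rho> :: "'g \<Rightarrow> 'v::complex_vector \<Rightarrow> 'v" and \<rho>' :: "'g \<Rightarrow> 'w::complex_vector \<Rightarrow> 'w"
  assumes \<rho>: "lie_module \<rho>" "simple_module \<rho>" "highest_weight_vector \<rho> \<nu> v"
    and \<rho>': "lie_module \<rho>'" "simple_module \<rho>'" "highest_weight_vector \<rho>' \<nu> v'"
  shows "module_iso UNIV (full_module \<rho>) (full_module \<rho>')"
proof -
  define \<pi> where "\<pi> X p = (\<rho> X (fst p), \<rho>' X (snd p))" for X and p :: "'v \<times> 'w"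
  note lin = lie_moduleD[OF \<rho>(1)] and lin' = lie_moduleD[OF \<rho>'(1)]
  have v: "v \<noteq> 0" "v' \<noteq> 0" "\<nu> \<in> funs_on" using \<rho>(3) \<rho>'(3) by (auto simp: highest_weight_vector_def)
  have \<pi>: "lie_module \<pi>"
    unfolding lie_module_def \<pi>_def
    by (auto intro!: clinearI simp: lin(3) lin'(3) prod_eq_iff
        clinear_add[OF lin(1)] clinear_scale[OF lin(1)] clinear_add[OF lin'(1)] clinear_scale[OF lin'(1)]
        clinear_add[OF lin(2)] clinear_scale[OF lin(2)] clinear_add[OF lin'(2)] clinear_scale[OF lin'(2)])
  have wt: "p \<in> weight_space \<pi> \<mu> \<longleftrightarrow> fst p \<in> weight_space \<rho> \<mu> \<and> snd p \<in> weight_space \<rho>' \<mu>" for p \<mu>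
    by (auto simp: weight_space_def \<pi>_def prod_eq_iff)
  have hw: "highest_weight_vector \<pi> \<nu> (v, v')"
    using \<rho>(3) \<rho>'(3) unfolding highest_weight_vector_def wt by (simp add: \<pi>_def prod_eq_iff)
  define W where "W = lowered_span (negative_root_operators \<pi>) (v, v') \<nu>"
  have W: "submodule UNIV \<pi> W" unfolding W_def by (rule submodule_lowered_span[OF \<pi> hw])
  then have sW: "csubspace W" and \<pi>W: "\<And>X p. p \<in> W \<Longrightarrow> \<pi> X p \<in> W" by (auto simp: submodule_def)
  have vW: "(v, v') \<in> W" unfolding W_def by (rule lowered_in_span[OF lowered.start])
  have top: "\<exists>c. p = c *\<^sub>C (v, v')" if "p \<in> W" "p \<in> weight_space \<pi> \<nu>" for p
  proof (rule top_weight_line[OF lie_moduleD(1)[OF \<pi>] _ v(3) _ that(2)])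
    show vwt: "(v, v') \<in> weight_space \<pi> \<nu>" using hw by (simp add: highest_weight_vector_def)
    show "p \<in> cspan (insert (v, v') (\<Union>\<mu>\<in>below \<nu> - {\<nu>}. weight_space \<pi> \<mu>))"
      using lowered_span_below[OF lowering_negative_root_operators[OF \<pi>] vwt] that(1) by (auto simp: W_def)
  qed
  have 0: "(0 :: 'v) \<in> weight_space \<rho> \<nu>" "(0 :: 'w) \<in> weight_space \<rho>' \<nu>"
    by (rule csubspace_0[OF csubspace_weight_space], rule lin lin')+
  have inj2: "y = 0" if y: "(0, y) \<in> W" for y
  proof (rule ccontr)
    assume "y \<noteq> 0"
    have "submodule UNIV \<rho>' {y. (0, y) \<in> W}"
      by (rule submodule_vimage[OF _ _ W])
        (auto intro!: clinearI simp: scaleC_prod_def \<pi>_def clinear_0[OF lin(1)])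
    then have "{y. (0, y) \<in> W} = UNIV" using simple_moduleD[OF \<rho>'(2)] y \<open>y \<noteq> 0\<close> by blast
    then have "(0, v') \<in> W" by blast
    moreover have "(0, v') \<in> weight_space \<pi> \<nu>"
      using \<rho>'(3) 0 by (simp add: wt highest_weight_vector_def)
    ultimately obtain c where "(0, v') = c *\<^sub>C (v, v')" using top by blast
    then show False using v by (auto simp: scaleC_prod_def)
  qed
  have inj1: "x = 0" if x: "(x, 0) \<in> W" for x
  proof (rule ccontr)
    assume "x \<noteq> 0"
    have "submodule UNIV \<rho> {x. (x, 0) \<in> W}"
      by (rule submodule_vimage[OF _ _ W])
        (auto intro!: clinearI simp: scaleC_prod_def \<pi>_def clinear_0[OF lin'(1)])
    then have "{x. (x, 0) \<in> W} = UNIV" using simple_moduleD[OF \<rho>(2)] x \<open>x \<noteq> 0\<close> by blast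
    then have "(v, 0) \<in> W" by blast
    moreover have "(v, 0) \<in> weight_space \<pi> \<nu>"
      using \<rho>(3) 0 by (simp add: wt highest_weight_vector_def)
    ultimately obtain c where "(v, 0) = c *\<^sub>C (v, v')" using top by blast
    then show False using v by (auto simp: scaleC_prod_def)
  qed
  have fst: "submodule UNIV \<rho> (fst ` W)"
    by (rule submodule_image[OF _ _ W]) (auto intro!: clinearI simp: \<pi>_def)
  have snd: "submodule UNIV \<rho>' (snd ` W)"
    by (rule submodule_image[OF _ _ W]) (auto intro!: clinearI simp: \<pi>_def)
  have "fst ` W = UNIV" using simple_moduleD[OF \<rho>(2) fst, of v] vW v by force
  then have ex: "\<exists>y. (x, y) \<in> W" for x by (metis UNIV_I imageE prod.collapse)
  have uniq: "y = y'" if "(x, y) \<in> W" "(x, y') \<in> W" for x y y'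
    using inj2[of "y - y'"] csubspace_diff[OF sW that] by simp
  obtain f where f: "\<And>x. (x, f x) \<in> W" using ex by metis
  have "snd ` W = UNIV" using simple_moduleD[OF \<rho>'(2) snd, of v'] vW v by force
  then have surj: "surj f" unfolding surj_def by (metis UNIV_I imageE prod.collapse uniq f)
  have inj: "inj f"
  proof (rule injI)
    fix x y assume "f x = f y"
    then show "x = y" using inj1[of "x - y"] csubspace_diff[OF sW f[of x] f[of y]] by simp
  qed
  show ?thesis
    unfolding module_iso_def full_module_def
  proof (rule exI[of _ f], simp, intro conjI allI)
    show "bij f" using inj surj by (simp add: bij_def)
    show "f (x + y) = f x + f y" for x y
      using csubspace_add[OF sW f[of x] f[of y]] by (intro uniq[OF f]) simp
    show "f (c *\<^sub>C x) = c *\<^sub>C f x" for c x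
      using csubspace_scale[OF sW f[of x], of c] by (intro uniq[OF f]) (simp add: scaleC_prod_def)
    show "f (\<rho> X x) = \<rho>' X (f x)" for X x
      using \<pi>W[OF f[of x], of X] by (intro uniq[OF f]) (simp add: \<pi>_def)
  qed
qed

subsection \<open>Highest weight vectors in the parabolic category O\<close>

text \<open>
  The commuting operators in \<open>H\<close> have a common eigenvector in \<open>W\<close>. As the Levi subalgebra is spanned
  by \<open>H\<close> and root vectors, the span of the weight vectors in \<open>W\<close> is a submodule, hence all of \<open>W\<close>.
\<close>

lemma simple_levi_module_weights:
  assumes \<rho>: "lie_module \<rho>" and W: "cfinite_dim W" "simple_submodule (levi H I) \<rho> W"
  shows "W \<subseteq> cspan (\<Union>\<mu>\<in>funs_on. weight_space \<rho> \<mu>)"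
proof -
  note lin = lie_moduleD[OF \<rho>]
  have sW: "csubspace W" and LW: "\<And>X w. X \<in> levi H I \<Longrightarrow> w \<in> W \<Longrightarrow> \<rho> X w \<in> W" and W0: "W \<noteq> {0}"
    using W(2) by (auto simp: simple_submodule_def submodule_def)
  have Hl: "h \<in> levi H I" if "h \<in> H" for h unfolding levi_def using that by (intro cspan_base) simp
  have "\<exists>x\<in>W. x \<noteq> 0 \<and> (\<forall>h\<in>H. \<exists>a. \<rho> h x = a *\<^sub>C x)"
  proof (rule common_eigenvector[OF W(1) W0 lin(1) LW[OF Hl]])
    show "\<rho> h (\<rho> k x) = \<rho> k (\<rho> h x)" if "h \<in> H" "k \<in> H" for h k x
      using lin(3)[of h k x] H_abelian[OF that] clinear_0[OF lin(2), of x] by simp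
  qed
  then obtain x a where x: "x \<in> W" "x \<noteq> 0" "\<And>h. h \<in> H \<Longrightarrow> \<rho> h x = a h *\<^sub>C x" by metis
  define \<nu> where "\<nu> h = (if h \<in> H then a h else 0)" for h
  have \<nu>: "\<nu> \<in> funs_on" "x \<in> weight_space \<rho> \<nu>" using x(3) by (auto simp: \<nu>_def funs_on_def weight_space_def)
  let ?W = "cspan (\<Union>\<mu>\<in>funs_on. weight_space \<rho> \<mu> \<inter> W)"
  have "submodule (levi H I) \<rho> ?W"
    unfolding submodule_def
  proof (intro conjI ballI csubspace_cspan)
    fix X w assume X: "X \<in> levi H I" and w: "w \<in> ?W"
    show "\<rho> X w \<in> ?W"
    proof (rule clinear_image_cspan[OF lin(1) w _ csubspace_cspan])
      fix y assume "y \<in> (\<Union>\<mu>\<in>funs_on. weight_space \<rho> \<mu> \<inter> W)"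
      then obtain \<mu> where y: "\<mu> \<in> funs_on" "y \<in> weight_space \<rho> \<mu>" "y \<in> W" by blast
      show "\<rho> X y \<in> ?W"
      proof (rule clinear_image_cspan[OF lin(2) X[unfolded levi_def] _ csubspace_cspan])
        fix u assume u: "u \<in> H \<union> (\<Union>\<alpha>\<in>levi_roots H I. root_space H \<alpha>)"
        then have "u \<in> levi H I" unfolding levi_def by (rule cspan_base)
        then have uW: "\<rho> u y \<in> W" using LW y(3) by blast
        from u show "\<rho> u y \<in> ?W"
        proof
          assume "u \<in> H"
          then have "\<rho> u y = \<mu> u *\<^sub>C y" by (rule weight_spaceD[OF y(2)])
          then show ?thesis using y by (auto intro!: cspan_scale intro: cspan_base)
        next
          assume "u \<in> (\<Union>\<alpha>\<in>levi_roots H I. root_space H \<alpha>)"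
          then obtain \<alpha> where \<alpha>: "\<alpha> \<in> roots H" "u \<in> root_space H \<alpha>" by (auto simp: levi_roots_def)
          have "\<rho> u y \<in> weight_space \<rho> (\<lambda>t. \<mu> t + \<alpha> t) \<inter> W"
            using root_vector_weight[OF \<rho> y(2) \<alpha>(2)] uW by simp
          then show ?thesis using funs_on_add[OF y(1) roots_funs_on[OF \<alpha>(1)]] by (intro cspan_base) blast
        qed
      qed
    qed
  qed
  moreover have "?W \<subseteq> W" by (rule cspan_minimal[OF _ sW]) blast
  moreover have "x \<in> ?W" using x(1) \<nu> by (intro cspan_base) blast
  ultimately have "?W = W" using W(2) x(2) unfolding simple_submodule_def by blast
  moreover have "?W \<subseteq> cspan (\<Union>\<mu>\<in>funs_on. weight_space \<rho> \<mu>)" by (rule cspan_mono) blast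
  ultimately show ?thesis by simp
qed

lemma category_O_weights:
  assumes "in_category_O H \<Delta> I \<rho>"
  shows "cspan (\<Union>\<mu>\<in>funs_on. weight_space \<rho> \<mu>) = UNIV"
proof -
  obtain \<W> where \<W>: "direct_sum \<W>" "\<And>W. W \<in> \<W> \<Longrightarrow> cfinite_dim W \<and> simple_submodule (levi H I) \<rho> W"
    and \<rho>: "lie_module \<rho>" using assms unfolding in_category_O_def by blast
  have "cspan (\<Union>\<W>) \<subseteq> cspan (\<Union>\<mu>\<in>funs_on. weight_space \<rho> \<mu>)"
    by (rule cspan_minimal[OF Union_least csubspace_cspan])
      (use simple_levi_module_weights[OF \<rho>] \<W>(2) in blast)
  then show ?thesis using \<W>(1) by (auto simp: direct_sum_def)
qed

lemma positive_root_space_parabolic: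
  assumes "\<beta> \<in> positive_roots H \<Delta>" shows "root_space H \<beta> \<subseteq> parabolic H \<Delta> I"
proof
  fix e assume e: "e \<in> root_space H \<beta>"
  have 0: "0 \<in> levi H I" "0 \<in> nilradical H \<Delta> I" by (simp_all add: levi_def nilradical_def cspan_0)
  show "e \<in> parabolic H \<Delta> I"
  proof (cases "\<beta> \<in> levi_roots H I")
    case True
    then have "e \<in> levi H I" unfolding levi_def using e by (intro cspan_base) blast
    then show ?thesis unfolding parabolic_def using set_plus_intro[OF _ 0(2)] by fastforce
  next
    case False
    then have "e \<in> nilradical H \<Delta> I" unfolding nilradical_def using e assms by (intro cspan_base) blast
    then show ?thesis unfolding parabolic_def using set_plus_intro[OF 0(1)] by fastforce
  qed
qed

text \<open>
  A weight vector generates a finite-dimensional module over the parabolic subalgebra, and any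
  vector of maximal weight in it is killed by all positive root vectors.
\<close>

lemma highest_weight_vector_exists:
  assumes O: "in_category_O H \<Delta> I \<rho>" and simple_\<rho>: "simple_module \<rho>"
  shows "\<exists>\<nu> v. highest_weight_vector \<rho> \<nu> v"
proof -
  have \<rho>: "lie_module \<rho>" and fin: "\<And>v. cfinite_dim (generated_submodule (parabolic H \<Delta> I) \<rho> {v})"
    using O by (auto simp: in_category_O_def)
  note lin = lie_moduleD[OF \<rho>]
  have "\<exists>\<mu>\<in>funs_on. \<exists>w\<in>weight_space \<rho> \<mu>. w \<noteq> 0"
  proof (rule ccontr)
    assume "\<not> ?thesis"
    then have "(\<Union>\<mu>\<in>funs_on. weight_space \<rho> \<mu>) \<subseteq> {0}" by blast
    then have "cspan (\<Union>\<mu>\<in>funs_on. weight_space \<rho> \<mu>) \<subseteq> {0}" by (rule cspan_minimal) simp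
    then show False using category_O_weights[OF O] simple_\<rho> by (auto simp: simple_submodule_def)
  qed
  then obtain \<mu>0 w where w: "\<mu>0 \<in> funs_on" "w \<in> weight_space \<rho> \<mu>0" "w \<noteq> 0" by blast
  define M where "M = generated_submodule (parabolic H \<Delta> I) \<rho> {w}"
  have M: "cfinite_dim M" "submodule (parabolic H \<Delta> I) \<rho> M" "w \<in> M"
    using fin submodule_hull[of "parabolic H \<Delta> I" \<rho> "{w}"] hull_subset[of "{w}" "submodule (parabolic H \<Delta> I) \<rho>"]
    by (auto simp: M_def generated_submodule_def)
  define \<Lambda> where "\<Lambda> = {\<mu> \<in> funs_on. weight_space \<rho> \<mu> \<inter> M \<noteq> {0}}"
  have "finite \<Lambda>"
  proof (rule finite_weights[OF M(1), of H \<rho> \<Lambda> "weight_space \<rho>"])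
    show "\<rho> h x \<in> weight_space \<rho> \<mu>" if "h \<in> H" "x \<in> weight_space \<rho> \<mu>" for \<mu> h x
      using csubspace_scale[OF csubspace_weight_space[OF lin(1)] that(2)] weight_spaceD[OF that(2,1)] by simp
  qed (auto simp: \<Lambda>_def lin csubspace_weight_space funs_on_def dest: weight_space_gen_eigen[THEN subsetD])
  moreover have "\<mu>0 \<in> \<Lambda>" using w M(3) by (auto simp: \<Lambda>_def)
  \<comment> \<open>a weight of \<open>M\<close> with the largest number of weights of \<open>M\<close> below it is maximal\<close>
  ultimately have "Max ((\<lambda>\<mu>. card (below \<mu> \<inter> \<Lambda>)) ` \<Lambda>) \<in> (\<lambda>\<mu>. card (below \<mu> \<inter> \<Lambda>)) ` \<Lambda>"
    by (intro Max_in) auto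
  then obtain \<nu> where \<nu>: "\<nu> \<in> \<Lambda>" and \<nu>_max: "card (below \<nu> \<inter> \<Lambda>) = Max ((\<lambda>\<mu>. card (below \<mu> \<inter> \<Lambda>)) ` \<Lambda>)"
    by auto
  have max: "card (below \<mu> \<inter> \<Lambda>) \<le> card (below \<nu> \<inter> \<Lambda>)" if "\<mu> \<in> \<Lambda>" for \<mu>
    unfolding \<nu>_max by (rule Max_ge) (use \<open>finite \<Lambda>\<close> that in auto)
  have "0 \<in> weight_space \<rho> \<nu> \<inter> M"
    using csubspace_0[OF csubspace_weight_space[of \<rho>, OF lin(1)]] csubspace_0[OF cfinite_dim_csubspace[OF M(1)]] by simp
  then obtain v where v: "v \<in> weight_space \<rho> \<nu>" "v \<in> M" "v \<noteq> 0" using \<nu> by (auto simp: \<Lambda>_def)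
  have "\<rho> e v = 0" if \<beta>: "\<beta> \<in> positive_roots H \<Delta>" and e: "e \<in> root_space H \<beta>" for \<beta> e
  proof (rule ccontr)
    assume ne: "\<rho> e v \<noteq> 0"
    let ?\<mu> = "\<lambda>t. \<nu> t + \<beta> t"
    have \<beta>': "\<beta> \<in> roots H" "\<beta> \<in> Qplus" using \<beta> by (simp_all add: positive_roots_iff)
    have "\<rho> e v \<in> M" using M(2) v(2) e positive_root_space_parabolic[OF \<beta>] by (auto simp: submodule_def)
    moreover have "\<rho> e v \<in> weight_space \<rho> ?\<mu>" by (rule root_vector_weight[OF \<rho> v(1) e])
    moreover have \<nu>f: "\<nu> \<in> funs_on" using \<nu> by (simp add: \<Lambda>_def)
    then have "?\<mu> \<in> funs_on" by (rule funs_on_add[OF _ roots_funs_on[OF \<beta>'(1)]])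
    ultimately have \<mu>\<Lambda>: "?\<mu> \<in> \<Lambda>" using ne by (auto simp: \<Lambda>_def)
    have "(\<lambda>t. ?\<mu> t - \<beta> t) \<in> below ?\<mu>" by (rule below_minus[OF below_refl \<beta>'(2) roots_funs_on[OF \<beta>'(1)]])
    then have lt: "\<nu> \<in> below ?\<mu>" by simp
    have "?\<mu> \<noteq> \<nu>"
    proof
      assume "?\<mu> = \<nu>"
      then have "\<beta> t = 0" for t using fun_cong[of ?\<mu> \<nu> t] by simp
      then show False using roots_nonzero[OF \<beta>'(1)] by blast
    qed
    then have "?\<mu> \<notin> below \<nu>" using below_antisym lt by blast
    then have "below \<nu> \<inter> \<Lambda> \<subset> below ?\<mu> \<inter> \<Lambda>" using below_trans[OF _ lt] below_refl \<mu>\<Lambda> by blast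
    then have "card (below \<nu> \<inter> \<Lambda>) < card (below ?\<mu> \<inter> \<Lambda>)" using \<open>finite \<Lambda>\<close> by (intro psubset_card_mono) auto
    then show False using max[OF \<mu>\<Lambda>] by simp
  qed
  then have "highest_weight_vector \<rho> \<nu> v"
    using v \<nu> by (auto simp: highest_weight_vector_def \<Lambda>_def)
  then show ?thesis by blast
qed

end

section \<open>The spin module\<close>

locale levi_spin = lie_simple_roots H \<Delta> for H :: "'g::lie_algebra set" and \<Delta> :: "('g \<Rightarrow> complex) set" +
  fixes I :: "('g \<Rightarrow> complex) set" and m :: nat and Z :: "nat \<Rightarrow> 'g"
    and \<gamma> :: "'g \<Rightarrow> 's::complex_vector \<Rightarrow> 's"
  assumes onb: "orthonormal_basis (levi_complement H \<Delta> I) m Z"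
    and spin: "spin_module (levi_complement H \<Delta> I) \<gamma>"
begin

abbreviation \<ss> :: "'g set"
  where "\<ss> \<equiv> levi_complement H \<Delta> I"

abbreviation (input) \<uu> :: "'g set"
  where "\<uu> \<equiv> nilradical H \<Delta> I"

abbreviation (input) \<uu>' :: "'g set"
  where "\<uu>' \<equiv> opposite_nilradical H \<Delta> I"

abbreviation (input) spin_act :: "'g \<Rightarrow> 's \<Rightarrow> 's"
  where "spin_act \<equiv> spin_action m Z \<gamma>"

abbreviation (input) cubic :: "'s \<Rightarrow> 's"
  where "cubic \<equiv> cubic_term m Z \<gamma>"

abbreviation (input) diag :: "('g \<Rightarrow> 'v \<Rightarrow> 'v) \<Rightarrow> 'g \<Rightarrow> ('v::complex_vector, 's) tensor \<Rightarrow> ('v, 's) tensor"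
  where "diag \<equiv> diagonal_action m Z \<gamma>"

abbreviation (input) dirac :: "('g \<Rightarrow> 'v \<Rightarrow> 'v) \<Rightarrow> ('v::complex_vector, 's) tensor \<Rightarrow> ('v, 's) tensor"
  where "dirac \<equiv> dirac_operator m Z \<gamma>"

abbreviation (input) cohomology :: "('g \<Rightarrow> 'v \<Rightarrow> 'v) \<Rightarrow> ('g, ('v::complex_vector, 's) tensor set) module_structure"
  where "cohomology \<equiv> dirac_cohomology m Z \<gamma>"

definition radical_roots :: "('g \<Rightarrow> complex) set"
  where "radical_roots = positive_roots H \<Delta> - levi_roots H I"

lemma \<ss>_span: "\<ss> = cspan (Z ` {1..m})"
  and Z_orthonormal: "i \<in> {1..m} \<Longrightarrow> j \<in> {1..m} \<Longrightarrow> killing (Z i) (Z j) = (if i = j then 1 else 0)"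
  using onb by (auto simp: orthonormal_basis_def)

lemma csubspace_\<ss>: "csubspace \<ss>"
  unfolding \<ss>_span by (rule csubspace_cspan)

lemma Z_in_\<ss>: "i \<in> {1..m} \<Longrightarrow> Z i \<in> \<ss>"
  unfolding \<ss>_span by (rule cspan_base) simp

lemma \<ss>_expansion:
  assumes "x \<in> \<ss>" shows "x = (\<Sum>i\<in>{1..m}. killing x (Z i) *\<^sub>C Z i)"
proof -
  have "x \<in> cspan (Z ` {1..m})" using assms \<ss>_span by simp
  then show ?thesis
  proof (induction rule: cspan_induct)
    case (add x y)
    show ?case by (simp only: killing_add_left scaleC_add_left sum.distrib add[symmetric])
  next
    case (scale c x)
    show ?case
      by (simp only: killing_scale_left scaleC_scaleC[symmetric]
          complex_vector.scale_sum_right[symmetric] scale[symmetric])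
  next
    case (base x)
    then obtain j where j: "j \<in> {1..m}" "x = Z j" by auto
    have "(\<Sum>i\<in>{1..m}. killing x (Z i) *\<^sub>C Z i) = (\<Sum>i\<in>{1..m}. if i = j then Z i else 0)"
      by (rule sum.cong) (use j in \<open>auto simp: Z_orthonormal scaleC_one\<close>)
    then show ?case using j by simp
  qed simp
qed

lemma \<ss>_decompose:
  assumes "x \<in> \<ss>"
  obtains a b where "x = a + b" "a \<in> \<uu>" "b \<in> \<uu>'"
  using assms unfolding levi_complement_def by (rule set_plus_elim) metis

lemma nilradical_\<ss>: "\<uu> \<subseteq> \<ss>" and opposite_\<ss>: "\<uu>' \<subseteq> \<ss>"
proof -
  have 0: "0 \<in> \<uu>" "0 \<in> \<uu>'"
    by (simp_all add: nilradical_def opposite_nilradical_def cspan_0)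
  show "\<uu> \<subseteq> \<ss>"
    unfolding levi_complement_def using set_plus_intro[OF _ 0(2)] by fastforce
  show "\<uu>' \<subseteq> \<ss>"
    unfolding levi_complement_def using set_plus_intro[OF 0(1)] by fastforce
qed

lemma root_space_\<ss>:
  assumes "\<alpha> \<in> radical_roots"
  shows "root_space H \<alpha> \<subseteq> \<ss>" "root_space H (\<lambda>t. - \<alpha> t) \<subseteq> \<ss>"
  using assms nilradical_\<ss> opposite_\<ss>
  unfolding nilradical_def opposite_nilradical_def radical_roots_def by (blast intro: cspan_base)+

lemma bracket_H_root_spaces:
  assumes "h \<in> H" "x \<in> cspan (\<Union>\<alpha>\<in>R. root_space H (f \<alpha>))"
  shows "bracket h x \<in> cspan (\<Union>\<alpha>\<in>R. root_space H (f \<alpha>))"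
proof (rule clinear_image_cspan[OF clinear_bracket_right assms(2) _ csubspace_cspan])
  fix y assume "y \<in> (\<Union>\<alpha>\<in>R. root_space H (f \<alpha>))"
  then obtain \<alpha> where "\<alpha> \<in> R" "y \<in> root_space H (f \<alpha>)" by blast
  then show "bracket h y \<in> cspan (\<Union>\<alpha>\<in>R. root_space H (f \<alpha>))"
    using bracket_root_space[OF assms(1)] by (auto intro!: cspan_scale intro: cspan_base)
qed

lemma bracket_H_nilradical: "h \<in> H \<Longrightarrow> x \<in> \<uu> \<Longrightarrow> bracket h x \<in> \<uu>"
  unfolding nilradical_def by (rule bracket_H_root_spaces[where f = "\<lambda>\<alpha>. \<alpha>"])

lemma bracket_H_\<ss>:
  assumes "h \<in> H" "x \<in> \<ss>" shows "bracket h x \<in> \<ss>"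
proof -
  obtain a b where ab: "x = a + b" "a \<in> \<uu>" "b \<in> \<uu>'"
    using \<ss>_decompose[OF assms(2)] .
  have "bracket h b \<in> \<uu>'"
    using ab(3) unfolding opposite_nilradical_def by (rule bracket_H_root_spaces[OF assms(1)])
  then show ?thesis
    unfolding ab(1) bracket_add_right
    using bracket_H_nilradical[OF assms(1) ab(2)] nilradical_\<ss> opposite_\<ss> by (intro csubspace_add[OF csubspace_\<ss>]) auto
qed

lemma radical_roots_Qplus: "\<alpha> \<in> radical_roots \<Longrightarrow> \<alpha> \<in> roots H \<and> \<alpha> \<in> Qplus \<and> \<alpha> \<in> funs_on \<and> \<alpha> \<noteq> (\<lambda>t. 0)"
  unfolding radical_roots_def using positive_roots_iff roots_funs_on roots_nonzero by blast

lemma nilradical_isotropic: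
  assumes "x \<in> \<uu>" "y \<in> \<uu>" shows "killing x y = 0"
proof -
  have rs: "killing a b = 0" if "\<alpha> \<in> radical_roots" "a \<in> root_space H \<alpha>" "\<beta> \<in> radical_roots" "b \<in> root_space H \<beta>" for a b \<alpha> \<beta>
  proof -
    note \<alpha> = radical_roots_Qplus[OF that(1)] note \<beta> = radical_roots_Qplus[OF that(3)]
    have "\<exists>h\<in>H. \<alpha> h + \<beta> h \<noteq> 0"
    proof (rule ccontr)
      assume *: "\<not> ?thesis"
      have "\<alpha> t + \<beta> t = 0" for t using * \<alpha> \<beta> by (cases "t \<in> H") (auto simp: funs_on_def)
      then show False using Qplus_sum_zero[of \<alpha> \<beta>] \<alpha> \<beta> by blast
    qed
    then obtain h where h: "h \<in> H" "\<alpha> h + \<beta> h \<noteq> 0" by blast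
    have "x \<in> gen_eigen (bracket h) (\<delta> h)" if "x \<in> root_space H \<delta>" for x \<delta>
      using bracket_root_space[OF h(1) that] by (auto simp: gen_eigen_def shifted_def intro!: exI[of _ 1])
    then show ?thesis using killing_gen_eigen_orthogonal h(2) that(2,4) by blast
  qed
  \<comment> \<open>linear maps go between vector spaces here, so scalars are replaced by multiples of some \<open>z \<noteq> 0\<close>\<close>
  have k1: "clinear (\<lambda>b. killing a b *\<^sub>C z)" for a :: 'g and z :: 's
    by (rule clinearI) (simp_all add: killing_add_right killing_scale_right scaleC_add_left scaleC_scaleC)
  have k2: "clinear (\<lambda>b. killing b a *\<^sub>C z)" for a :: 'g and z :: 's
    by (rule clinearI) (simp_all add: killing_add_left killing_scale_left scaleC_add_left scaleC_scaleC)
  obtain z :: 's where z: "z \<noteq> 0" using spin unfolding spin_module_def by blast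
  have "killing a y *\<^sub>C z \<in> {0}" if "\<alpha> \<in> radical_roots" "a \<in> root_space H \<alpha>" for a \<alpha>
    by (rule clinear_image_cspan[OF k1 assms(2)[unfolded nilradical_def]])
      (use rs that in \<open>auto simp: radical_roots_def\<close>)
  then have "killing x y *\<^sub>C z \<in> {0}"
    by (intro clinear_image_cspan[OF k2 assms(1)[unfolded nilradical_def]])
      (auto simp: radical_roots_def)
  then show ?thesis using z by simp
qed

subsection \<open>Clifford multiplication\<close>

lemma \<gamma>_clinear: "u \<in> \<ss> \<Longrightarrow> clinear (\<gamma> u)"
  and \<gamma>_add: "u \<in> \<ss> \<Longrightarrow> u' \<in> \<ss> \<Longrightarrow> \<gamma> (u + u') t = \<gamma> u t + \<gamma> u' t"
  and \<gamma>_scale: "u \<in> \<ss> \<Longrightarrow> \<gamma> (c *\<^sub>C u) t = c *\<^sub>C \<gamma> u t"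
  and \<gamma>_rel: "u \<in> \<ss> \<Longrightarrow> u' \<in> \<ss> \<Longrightarrow> \<gamma> u (\<gamma> u' t) = (- 2 * killing u u') *\<^sub>C t - \<gamma> u' (\<gamma> u t)"
  and spin_simple: "csubspace T \<Longrightarrow> (\<And>u s. u \<in> \<ss> \<Longrightarrow> s \<in> T \<Longrightarrow> \<gamma> u s \<in> T) \<Longrightarrow> T = {0} \<or> T = UNIV"
  using spin unfolding spin_module_def clifford_module_def by (auto simp: eq_diff_eq)

text \<open>Nothing is known about the values of \<open>\<gamma>\<close> outside \<open>\<ss>\<close>, so linearity has to be relative to \<open>\<ss>\<close>.\<close>

definition linear_on_\<ss> :: "('g \<Rightarrow> 'v::complex_vector) \<Rightarrow> bool"
  where "linear_on_\<ss> f \<longleftrightarrow> (\<forall>x\<in>\<ss>. \<forall>y\<in>\<ss>. f (x + y) = f x + f y) \<and> (\<forall>c. \<forall>x\<in>\<ss>. f (c *\<^sub>C x) = c *\<^sub>C f x)"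

lemma linear_on_\<ss>_expansion:
  assumes f: "linear_on_\<ss> f" and x: "x \<in> \<ss>"
  shows "f x = (\<Sum>i\<in>{1..m}. killing x (Z i) *\<^sub>C f (Z i))"
proof -
  have f0: "f 0 = 0" using f csubspace_0[OF csubspace_\<ss>] unfolding linear_on_\<ss>_def
    by (metis complex_vector.scale_zero_left)
  have "f (\<Sum>i\<in>A. c i *\<^sub>C Z i) = (\<Sum>i\<in>A. c i *\<^sub>C f (Z i))" if "A \<subseteq> {1..m}" for A c
    using finite_subset[OF that finite_atLeastAtMost] that
  proof (induction A rule: finite_induct)
    case (insert a A)
    have "(\<Sum>i\<in>A. c i *\<^sub>C Z i) \<in> \<ss>" "Z a \<in> \<ss>" "c a *\<^sub>C Z a \<in> \<ss>"
      using insert.prems Z_in_\<ss> by (auto intro!: csubspace_sum csubspace_scale csubspace_\<ss>)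
    then show ?case using insert f by (simp add: linear_on_\<ss>_def)
  qed (simp add: f0)
  then show ?thesis using \<ss>_expansion[OF x] by (metis order_refl)
qed

lemma linear_on_\<ss>_\<gamma>: "linear_on_\<ss> (\<lambda>u. \<gamma> u t)"
  by (simp add: linear_on_\<ss>_def \<gamma>_add \<gamma>_scale)

lemma linear_on_\<ss>_compose: "clinear g \<Longrightarrow> linear_on_\<ss> f \<Longrightarrow> linear_on_\<ss> (\<lambda>u. g (f u))"
  by (auto simp: linear_on_\<ss>_def clinear_add clinear_scale)

text \<open>
  The tensor \<open>\<Sum>\<^sub>i Z\<^sub>i \<otimes> Z\<^sub>i\<close> is annihilated by \<open>H\<close>, because \<open>ad h\<close> is skew for the Killing form.
  Each invariance statement about the Dirac operator below is an instance with a suitable bilinear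
  \<open>G\<close>.
\<close>

lemma contraction_invariant:
  assumes h: "h \<in> H"
    and G1: "\<And>b. b \<in> \<ss> \<Longrightarrow> linear_on_\<ss> (\<lambda>a. G a b)" and G2: "\<And>a. a \<in> \<ss> \<Longrightarrow> linear_on_\<ss> (G a)"
  shows "(\<Sum>i\<in>{1..m}. G (Z i) (bracket h (Z i))) = - (\<Sum>i\<in>{1..m}. G (bracket h (Z i)) (Z i))"
proof -
  have skew: "killing (bracket h x) y = - killing (bracket h y) x" for x y
    using killing_invariant[of x h y] bracket_antisym[of h x] killing_sym[of x "bracket h y"]
    by (simp add: killing_uminus_left)
  have "(\<Sum>i\<in>{1..m}. G (Z i) (bracket h (Z i)))
      = (\<Sum>i\<in>{1..m}. \<Sum>l\<in>{1..m}. killing (bracket h (Z i)) (Z l) *\<^sub>C G (Z i) (Z l))"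
    by (intro sum.cong refl linear_on_\<ss>_expansion[OF G2] bracket_H_\<ss> h Z_in_\<ss>)
  also have "\<dots> = (\<Sum>l\<in>{1..m}. \<Sum>i\<in>{1..m}. - (killing (bracket h (Z l)) (Z i) *\<^sub>C G (Z i) (Z l)))"
    by (subst sum.swap) (intro sum.cong refl, subst skew, simp)
  also have "\<dots> = (\<Sum>l\<in>{1..m}. - G (bracket h (Z l)) (Z l))"
    unfolding sum_negf
    by (intro sum.cong refl arg_cong[of _ _ uminus] linear_on_\<ss>_expansion[OF G1, symmetric] bracket_H_\<ss> h Z_in_\<ss>)
  finally show ?thesis by (simp add: sum_negf)
qed

text \<open>
  The sums over increasing indices in \<open>\<alpha>(X)\<close> and \<open>v\<close> have to be turned into sums over all indices
  before \<open>contraction_invariant\<close> applies. This is possible since both the coefficients and the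
  products of the orthogonal \<open>Z\<^sub>i\<close> are antisymmetric.
\<close>

lemma sum_symmetric_pairs:
  fixes g :: "nat \<Rightarrow> nat \<Rightarrow> 'v::complex_vector"
  assumes "\<And>i j. i \<in> {1..m} \<Longrightarrow> j \<in> {1..m} \<Longrightarrow> g i j = g j i" "\<And>i. i \<in> {1..m} \<Longrightarrow> g i i = 0"
  shows "(\<Sum>i\<in>{1..m}. \<Sum>j\<in>{1..m}. g i j) = 2 *\<^sub>C (\<Sum>(i, j) | 1 \<le> i \<and> i < j \<and> j \<le> m. g i j)"
proof -
  let ?P = "\<Sum>i\<in>{1..m}. \<Sum>j\<in>{1..m}. if i < j then g i j else 0"
  have "(\<Sum>i\<in>{1..m}. \<Sum>j\<in>{1..m}. g i j)
      = (\<Sum>i\<in>{1..m}. \<Sum>j\<in>{1..m}. (if i < j then g i j else 0) + (if j < i then g i j else 0))"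
    by (intro sum.cong refl) (use assms(2) in \<open>auto simp: not_less_iff_gr_or_eq\<close>)
  also have "\<dots> = ?P + (\<Sum>i\<in>{1..m}. \<Sum>j\<in>{1..m}. if j < i then g i j else 0)"
    by (simp add: sum.distrib)
  also have "(\<Sum>i\<in>{1..m}. \<Sum>j\<in>{1..m}. if j < i then g i j else 0) = ?P"
    by (subst sum.swap) (intro sum.cong refl, use assms(1) in auto)
  also have "?P = (\<Sum>(i, j)\<in>{1..m} \<times> {1..m}. if i < j then g i j else 0)"
    by (rule sum.cartesian_product)
  also have "\<dots> = (\<Sum>(i, j) | 1 \<le> i \<and> i < j \<and> j \<le> m. g i j)"
    by (rule sum.mono_neutral_cong_right) (auto split: if_splits)
  finally show ?thesis
    by (metis (no_types, lifting) scaleC_add_left scaleC_one one_add_one)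
qed

lemma sum_symmetric_triples:
  fixes g :: "nat \<Rightarrow> nat \<Rightarrow> nat \<Rightarrow> 'v::complex_vector"
  assumes s1: "\<And>i j k. i \<in> {1..m} \<Longrightarrow> j \<in> {1..m} \<Longrightarrow> k \<in> {1..m} \<Longrightarrow> g i j k = g j i k"
    and s2: "\<And>i j k. i \<in> {1..m} \<Longrightarrow> j \<in> {1..m} \<Longrightarrow> k \<in> {1..m} \<Longrightarrow> g i j k = g i k j"
    and z: "\<And>i k. i \<in> {1..m} \<Longrightarrow> k \<in> {1..m} \<Longrightarrow> g i i k = 0"
  shows "(\<Sum>i\<in>{1..m}. \<Sum>j\<in>{1..m}. \<Sum>k\<in>{1..m}. g i j k)
    = 6 *\<^sub>C (\<Sum>(i, j, k) | 1 \<le> i \<and> i < j \<and> j < k \<and> k \<le> m. g i j k)"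
proof -
  have sw: "(\<Sum>i\<in>{1..m}. \<Sum>j\<in>{1..m}. \<Sum>k\<in>{1..m}. f i j k) = (\<Sum>i\<in>{1..m}. \<Sum>j\<in>{1..m}. \<Sum>k\<in>{1..m}. f j i k)"
    for f :: "nat \<Rightarrow> nat \<Rightarrow> nat \<Rightarrow> 'v" by (rule sum.swap)
  have sw2: "(\<Sum>i\<in>{1..m}. \<Sum>j\<in>{1..m}. \<Sum>k\<in>{1..m}. f i j k) = (\<Sum>i\<in>{1..m}. \<Sum>j\<in>{1..m}. \<Sum>k\<in>{1..m}. f i k j)"
    for f :: "nat \<Rightarrow> nat \<Rightarrow> nat \<Rightarrow> 'v" by (intro sum.cong refl sum.swap)
  let ?S = "\<lambda>f. \<Sum>i\<in>{1..m}. \<Sum>j\<in>{1..m}. \<Sum>k\<in>{1..m}. (f i j k :: 'v)"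
  have cong: "?S f = ?S f'" if "\<And>i j k. i \<in> {1..m} \<Longrightarrow> j \<in> {1..m} \<Longrightarrow> k \<in> {1..m} \<Longrightarrow> f i j k = f' i j k" for f f'
    by (intro sum.cong refl that)
  let ?o = "\<lambda>a b c x. if a < b \<and> b < (c::nat) then x else (0 :: 'v)"
  let ?P = "?S (\<lambda>i j k. ?o i j k (g i j k))"
  have z': "g i j i = 0" "g i j j = 0" if "i \<in> {1..m}" "j \<in> {1..m}" for i j
    using that z s1 s2 by metis+
  have e1: "?S (\<lambda>i j k. ?o i k j (g i j k)) = ?P"
    by (subst sw2) (rule cong, use s2 in auto)
  have e2: "?S (\<lambda>i j k. ?o j i k (g i j k)) = ?P"
    by (subst sw) (rule cong, use s1 in auto)
  have "?S (\<lambda>i j k. ?o k i j (g i j k)) = ?S (\<lambda>i j k. ?o j i k (g i j k))"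
    by (subst sw2) (rule cong, use s2 in auto)
  with e2 have e4: "?S (\<lambda>i j k. ?o k i j (g i j k)) = ?P" by (rule trans[rotated])
  have "?S (\<lambda>i j k. ?o j k i (g i j k)) = ?S (\<lambda>i j k. ?o i k j (g i j k))"
    by (subst sw) (rule cong, use s1 in auto)
  with e1 have e3: "?S (\<lambda>i j k. ?o j k i (g i j k)) = ?P" by (rule trans[rotated])
  have "?S (\<lambda>i j k. ?o k j i (g i j k)) = ?S (\<lambda>i j k. ?o j k i (g i j k))"
    by (subst sw2) (rule cong, use s2 in auto)
  with e3 have e5: "?S (\<lambda>i j k. ?o k j i (g i j k)) = ?P" by (rule trans[rotated])
  have "?S g = ?S (\<lambda>i j k. ?o i j k (g i j k) + ?o i k j (g i j k) + ?o j i k (g i j k)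
      + ?o j k i (g i j k) + ?o k i j (g i j k) + ?o k j i (g i j k))"
  proof (rule cong)
    fix i j k assume "i \<in> {1..m}" "j \<in> {1..m}" "k \<in> {1..m}"
    then show "g i j k = ?o i j k (g i j k) + ?o i k j (g i j k) + ?o j i k (g i j k)
      + ?o j k i (g i j k) + ?o k i j (g i j k) + ?o k j i (g i j k)"
      using z z' by (cases i j rule: linorder_cases; cases j k rule: linorder_cases; cases i k rule: linorder_cases) auto
  qed
  also have "\<dots> = ?P + ?S (\<lambda>i j k. ?o i k j (g i j k)) + ?S (\<lambda>i j k. ?o j i k (g i j k))
      + ?S (\<lambda>i j k. ?o j k i (g i j k)) + ?S (\<lambda>i j k. ?o k i j (g i j k)) + ?S (\<lambda>i j k. ?o k j i (g i j k))"
    by (simp add: sum.distrib)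
  also have "\<dots> = ?P + ?P + ?P + ?P + ?P + ?P"
    by (simp only: e1 e2 e3 e4 e5)
  finally have *: "?S g = ?P + ?P + ?P + ?P + ?P + ?P" .
  have PQ: "?P = (\<Sum>(i, j, k) | 1 \<le> i \<and> i < j \<and> j < k \<and> k \<le> m. g i j k)"
  proof -
    have "?P = (\<Sum>(i, j, k)\<in>{1..m} \<times> {1..m} \<times> {1..m}. ?o i j k (g i j k))"
      by (simp add: sum.cartesian_product)
    also have "\<dots> = (\<Sum>(i, j, k) | 1 \<le> i \<and> i < j \<and> j < k \<and> k \<le> m. g i j k)"
      by (rule sum.mono_neutral_cong_right) (auto split: if_splits)
    finally show ?thesis .
  qed
  have six: "6 *\<^sub>C x = x + x + x + x + x + x" for x :: 'v
    using scaleC_add_left[of 1 1 x] scaleC_add_left[of 2 1 x] scaleC_add_left[of 3 1 x] scaleC_add_left[of 4 1 x] scaleC_add_left[of 5 1 x]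
    by (simp add: scaleC_one)
  show ?thesis using * unfolding six PQ .
qed

subsection \<open>The action of the Cartan subalgebra\<close>

lemma clinear_spin_action: "clinear (spin_act X)"
proof -
  have "clinear (\<lambda>s. case p of (i, j) \<Rightarrow> killing X (bracket (Z i) (Z j)) *\<^sub>C \<gamma> (Z i) (\<gamma> (Z j) s))"
    if mem: "p \<in> {(i, j). 1 \<le> i \<and> i < j \<and> j \<le> m}" for p
  proof -
    obtain i j where p: "p = (i, j)" "i \<in> {1..m}" "j \<in> {1..m}" using mem by auto
    show ?thesis
      unfolding p(1) prod.case
      by (rule clinear_scaled[OF clinear_compose[OF \<gamma>_clinear[OF Z_in_\<ss>[OF p(2)]] \<gamma>_clinear[OF Z_in_\<ss>[OF p(3)]]]])
  qed
  from clinear_scaled[OF clinear_sums[OF this]] show ?thesis unfolding spin_action_def .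
qed

lemma clinear_cubic_term: "clinear cubic"
proof -
  have "clinear (\<lambda>s. case p of (i, j, k) \<Rightarrow>
      killing (bracket (Z i) (Z j)) (Z k) *\<^sub>C \<gamma> (Z i) (\<gamma> (Z j) (\<gamma> (Z k) s)))"
    if mem: "p \<in> {(i, j, k). 1 \<le> i \<and> i < j \<and> j < k \<and> k \<le> m}" for p
  proof -
    obtain i j k where p: "p = (i, j, k)" "i \<in> {1..m}" "j \<in> {1..m}" "k \<in> {1..m}" using mem by auto
    show ?thesis
      unfolding p(1) prod.case
      by (rule clinear_scaled[OF clinear_compose[OF \<gamma>_clinear[OF Z_in_\<ss>[OF p(2)]]
              clinear_compose[OF \<gamma>_clinear[OF Z_in_\<ss>[OF p(3)]] \<gamma>_clinear[OF Z_in_\<ss>[OF p(4)]]]]])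
  qed
  from clinear_scaled[OF clinear_sums[OF this]] show ?thesis unfolding cubic_term_def .
qed

lemma \<gamma>_anticommute: "i \<in> {1..m} \<Longrightarrow> j \<in> {1..m} \<Longrightarrow> i \<noteq> j \<Longrightarrow> \<gamma> (Z i) (\<gamma> (Z j) t) = - \<gamma> (Z j) (\<gamma> (Z i) t)"
  using \<gamma>_rel[OF Z_in_\<ss> Z_in_\<ss>, of i j t] by (simp add: Z_orthonormal)

lemma spin_action_sum:
  assumes h: "h \<in> H"
  shows "spin_act h t = (1/4) *\<^sub>C (\<Sum>i\<in>{1..m}. \<gamma> (Z i) (\<gamma> (bracket h (Z i)) t))"
proof -
  let ?g = "\<lambda>i j. killing h (bracket (Z i) (Z j)) *\<^sub>C \<gamma> (Z i) (\<gamma> (Z j) t)"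
  have "(\<Sum>i\<in>{1..m}. \<gamma> (Z i) (\<gamma> (bracket h (Z i)) t)) = (\<Sum>i\<in>{1..m}. \<Sum>j\<in>{1..m}. ?g i j)"
  proof (rule sum.cong[OF refl])
    fix i assume i: "i \<in> {1..m}"
    have "\<gamma> (Z i) (\<gamma> (bracket h (Z i)) t)
        = (\<Sum>j\<in>{1..m}. killing (bracket h (Z i)) (Z j) *\<^sub>C \<gamma> (Z i) (\<gamma> (Z j) t))"
      by (rule linear_on_\<ss>_expansion[OF linear_on_\<ss>_compose[OF \<gamma>_clinear[OF Z_in_\<ss>[OF i]] linear_on_\<ss>_\<gamma>]
            bracket_H_\<ss>[OF h Z_in_\<ss>[OF i]]])
    then show "\<gamma> (Z i) (\<gamma> (bracket h (Z i)) t) = (\<Sum>j\<in>{1..m}. ?g i j)" by (simp add: killing_invariant)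
  qed
  also have "\<dots> = 2 *\<^sub>C (\<Sum>(i, j) | 1 \<le> i \<and> i < j \<and> j \<le> m. ?g i j)"
  proof (rule sum_symmetric_pairs)
    fix i j assume ij: "i \<in> {1..m}" "j \<in> {1..m}"
    show "?g i j = ?g j i"
    proof (cases "i = j")
      case False
      then show ?thesis
        using \<gamma>_anticommute[OF ij] bracket_antisym[of "Z i" "Z j"] by (simp add: killing_uminus_right)
    qed simp
  qed (simp add: bracket_self)
  finally show ?thesis
    unfolding spin_action_def by (simp add: scaleC_scaleC)
qed

text \<open>
  The spin action implements the adjoint action: \<open>[\<alpha>(h), y] = [h, y]\<close> in the Clifford algebra. The
  anticommutators of \<open>y\<close> with \<open>Z\<^sub>i\<close> and \<open>[h, Z\<^sub>i]\<close> produce two contractions, each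
  equal to \<open>2 [h, y]\<close> up to the common factor \<open>1/4\<close>.
\<close>

lemma spin_action_derivation:
  assumes h: "h \<in> H" and y: "y \<in> \<ss>"
  shows "spin_act h (\<gamma> y t) = \<gamma> y (spin_act h t) + \<gamma> (bracket h y) t"
proof -
  note hs = bracket_H_\<ss>[OF h]
  have *: "\<gamma> (Z i) (\<gamma> (bracket h (Z i)) (\<gamma> y t)) = \<gamma> y (\<gamma> (Z i) (\<gamma> (bracket h (Z i)) t))
      + 2 *\<^sub>C (killing (Z i) y *\<^sub>C \<gamma> (bracket h (Z i)) t) - 2 *\<^sub>C (killing (bracket h (Z i)) y *\<^sub>C \<gamma> (Z i) t)"
    if i: "i \<in> {1..m}" for i
  proof -
    note zi = Z_in_\<ss>[OF i] and zh = hs[OF Z_in_\<ss>[OF i]]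
    have "\<gamma> (Z i) (\<gamma> (bracket h (Z i)) (\<gamma> y t))
        = (- 2 * killing (bracket h (Z i)) y) *\<^sub>C \<gamma> (Z i) t - \<gamma> (Z i) (\<gamma> y (\<gamma> (bracket h (Z i)) t))"
      unfolding \<gamma>_rel[OF zh y] by (simp only: clinear_diff[OF \<gamma>_clinear[OF zi]] clinear_scale[OF \<gamma>_clinear[OF zi]])
    also have "\<gamma> (Z i) (\<gamma> y (\<gamma> (bracket h (Z i)) t))
        = (- 2 * killing (Z i) y) *\<^sub>C \<gamma> (bracket h (Z i)) t - \<gamma> y (\<gamma> (Z i) (\<gamma> (bracket h (Z i)) t))"
      by (rule \<gamma>_rel[OF zi y])
    finally show ?thesis by (simp add: scaleC_scaleC algebra_simps)
  qed
  have c: "(\<Sum>i\<in>{1..m}. killing (Z i) y *\<^sub>C \<gamma> (bracket h (Z i)) t)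
      = - (\<Sum>i\<in>{1..m}. killing (bracket h (Z i)) y *\<^sub>C \<gamma> (Z i) t)"
    by (rule contraction_invariant[OF h, of "\<lambda>a b. killing a y *\<^sub>C \<gamma> b t"])
      (auto simp: linear_on_\<ss>_def killing_add_left killing_scale_left scaleC_add_left scaleC_add_right
        scaleC_scaleC \<gamma>_add \<gamma>_scale mult.commute)
  have d: "(\<Sum>i\<in>{1..m}. killing (bracket h (Z i)) y *\<^sub>C \<gamma> (Z i) t) = - \<gamma> (bracket h y) t"
  proof -
    have "killing (bracket h (Z i)) y = - killing (bracket h y) (Z i)" for i
      using killing_invariant[of "Z i" h y] bracket_antisym[of h "Z i"] killing_sym[of "Z i" "bracket h y"]
      by (simp add: killing_uminus_left)
    then show ?thesis by (simp add: sum_negf linear_on_\<ss>_expansion[OF linear_on_\<ss>_\<gamma> hs[OF y]])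
  qed
  have "(\<Sum>i\<in>{1..m}. \<gamma> (Z i) (\<gamma> (bracket h (Z i)) (\<gamma> y t)))
      = (\<Sum>i\<in>{1..m}. \<gamma> y (\<gamma> (Z i) (\<gamma> (bracket h (Z i)) t))
        + 2 *\<^sub>C (killing (Z i) y *\<^sub>C \<gamma> (bracket h (Z i)) t) - 2 *\<^sub>C (killing (bracket h (Z i)) y *\<^sub>C \<gamma> (Z i) t))"
    by (rule sum.cong[OF refl *])
  also have "\<dots> = \<gamma> y (\<Sum>i\<in>{1..m}. \<gamma> (Z i) (\<gamma> (bracket h (Z i)) t)) + 4 *\<^sub>C \<gamma> (bracket h y) t"
    unfolding sum_subtractf sum.distrib complex_vector.scale_sum_right[symmetric] c d
    by (simp add: clinear_sum[OF \<gamma>_clinear[OF y]] add.assoc scaleC_add_left[symmetric])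
  finally show ?thesis
    unfolding spin_action_sum[OF h]
    by (simp add: scaleC_add_right scaleC_scaleC scaleC_one clinear_scale[OF \<gamma>_clinear[OF y]])
qed

lemma spin_action_commute:
  assumes h: "h \<in> H" and k: "k \<in> H"
  shows "spin_act h (spin_act k t) = spin_act k (spin_act h t)"
proof -
  let ?a = "spin_act"
  note lin = clinear_spin_action[of h]
  have hk: "bracket h (bracket k z) = bracket k (bracket h z)" for z
    using bracket_derivation[of h k z] H_abelian[OF h k] by simp
  have c: "(\<Sum>i\<in>{1..m}. \<gamma> (Z i) (\<gamma> (bracket k (bracket h (Z i))) t))
      = - (\<Sum>i\<in>{1..m}. \<gamma> (bracket h (Z i)) (\<gamma> (bracket k (Z i)) t))"
    by (rule contraction_invariant[OF h, of "\<lambda>a b. \<gamma> a (\<gamma> (bracket k b) t)"])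
      (auto simp: linear_on_\<ss>_def bracket_add_right bracket_scale_right \<gamma>_add \<gamma>_scale bracket_H_\<ss>[OF k]
        clinear_add[OF \<gamma>_clinear] clinear_scale[OF \<gamma>_clinear])
  have "4 *\<^sub>C ?a h (?a k t) = (\<Sum>i\<in>{1..m}. ?a h (\<gamma> (Z i) (\<gamma> (bracket k (Z i)) t)))"
    unfolding spin_action_sum[OF k, of t] by (simp add: clinear_scale[OF lin] clinear_sum[OF lin] scaleC_scaleC scaleC_one)
  also have "\<dots> = (\<Sum>i\<in>{1..m}. \<gamma> (Z i) (\<gamma> (bracket k (Z i)) (?a h t))
      + \<gamma> (Z i) (\<gamma> (bracket k (bracket h (Z i))) t) + \<gamma> (bracket h (Z i)) (\<gamma> (bracket k (Z i)) t))"
  proof (rule sum.cong[OF refl])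
    fix i assume "i \<in> {1..m}"
    then have zi: "Z i \<in> \<ss>" by (rule Z_in_\<ss>)
    then have zk: "bracket k (Z i) \<in> \<ss>" by (rule bracket_H_\<ss>[OF k])
    show "?a h (\<gamma> (Z i) (\<gamma> (bracket k (Z i)) t)) = \<gamma> (Z i) (\<gamma> (bracket k (Z i)) (?a h t))
      + \<gamma> (Z i) (\<gamma> (bracket k (bracket h (Z i))) t) + \<gamma> (bracket h (Z i)) (\<gamma> (bracket k (Z i)) t)"
      unfolding spin_action_derivation[OF h zi] spin_action_derivation[OF h zk] hk
      by (simp add: clinear_add[OF \<gamma>_clinear[OF zi]])
  qed
  also have "\<dots> = 4 *\<^sub>C ?a k (?a h t)"
    unfolding sum.distrib c spin_action_sum[OF k, of "?a h t"] by (simp add: scaleC_scaleC scaleC_one)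
  finally show ?thesis by simp
qed

text \<open>
  The cubic term is the contraction of the trilinear form \<open>B([x, y], z)\<close> with products of three
  \<open>Z\<^sub>i\<close>. Commuting it with \<open>\<alpha>(h)\<close> differentiates one factor at a time; the contraction
  moves \<open>ad h\<close> onto the form, which is invariant.
\<close>

lemma cubic_term_commute:
  assumes h: "h \<in> H"
  shows "spin_act h (cubic t) = cubic (spin_act h t)"
proof -
  let ?a = "spin_act h"
  define c where "c x y z = killing (bracket x y) z" for x y z :: 'g
  have c_swap1: "c x y z = - c y x z" for x y z
    using bracket_antisym[of x y] by (simp add: c_def killing_uminus_left)
  have c_swap2: "c x y z = - c x z y" for x y z
    using bracket_antisym[of y z] by (simp add: c_def killing_invariant killing_uminus_right)
  have c_lin: "c (x + x') y z = c x y z + c x' y z" "c x (y + y') z = c x y z + c x y' z"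
    "c x y (z + z') = c x y z + c x y z'" "c (r *\<^sub>C x) y z = r * c x y z" "c x (r *\<^sub>C y) z = r * c x y z"
    "c x y (r *\<^sub>C z) = r * c x y z" for x x' y y' z z' r
    by (simp_all add: c_def bracket_add_left bracket_add_right bracket_scale_left bracket_scale_right
        killing_add_left killing_add_right killing_scale_left killing_scale_right)
  have c_inv: "c (bracket h x) y z + c x (bracket h y) z + c x y (bracket h z) = 0" for x y z
  proof -
    have "c (bracket h x) y z + c x (bracket h y) z = killing (bracket h (bracket x y)) z"
      unfolding c_def killing_add_left[symmetric] by (simp add: bracket_derivation[of h x y])
    also have "\<dots> = - killing (bracket x y) (bracket h z)"
      using killing_invariant[of "bracket x y" h z] bracket_antisym[of h "bracket x y"]
      by (simp add: killing_uminus_left)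
    finally show ?thesis by (simp add: c_def)
  qed
  define T where "T s = (\<Sum>i\<in>{1..m}. \<Sum>j\<in>{1..m}. \<Sum>k\<in>{1..m}.
      c (Z i) (Z j) (Z k) *\<^sub>C \<gamma> (Z i) (\<gamma> (Z j) (\<gamma> (Z k) s)))" for s
  have T: "cubic s = (1/12) *\<^sub>C T s" for s
  proof -
    let ?g = "\<lambda>i j k. c (Z i) (Z j) (Z k) *\<^sub>C \<gamma> (Z i) (\<gamma> (Z j) (\<gamma> (Z k) s))"
    have "T s = 6 *\<^sub>C (\<Sum>(i, j, k) | 1 \<le> i \<and> i < j \<and> j < k \<and> k \<le> m. ?g i j k)"
      unfolding T_def
    proof (rule sum_symmetric_triples)
      fix i j k assume ijk: "i \<in> {1..m}" "j \<in> {1..m}" "k \<in> {1..m}"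
      show "?g i j k = ?g j i k"
        using \<gamma>_anticommute[OF ijk(1,2)] c_swap1[of "Z i" "Z j"] by (cases "i = j") simp_all
      show "?g i j k = ?g i k j"
        using \<gamma>_anticommute[OF ijk(2,3)] c_swap2[of "Z i" "Z j" "Z k"] clinear_uminus[OF \<gamma>_clinear[OF Z_in_\<ss>[OF ijk(1)]]]
        by (cases "j = k") simp_all
    qed (simp add: c_def bracket_self)
    then show ?thesis unfolding cubic_term_def c_def by (simp add: scaleC_scaleC)
  qed
  have g: "linear_on_\<ss> (\<lambda>b. \<gamma> b t)" for t by (rule linear_on_\<ss>_\<gamma>)
  let ?S = "\<lambda>f. \<Sum>i\<in>{1..m}. \<Sum>j\<in>{1..m}. \<Sum>k\<in>{1..m}. (f i j k :: 's)"
  let ?W = "\<lambda>x y z. \<gamma> x (\<gamma> y (\<gamma> z t))"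
  note gs = \<gamma>_add \<gamma>_scale clinear_add[OF \<gamma>_clinear] clinear_scale[OF \<gamma>_clinear]
  have 1: "?S (\<lambda>i j k. c (Z i) (Z j) (Z k) *\<^sub>C ?W (bracket h (Z i)) (Z j) (Z k))
      = - ?S (\<lambda>i j k. c (bracket h (Z i)) (Z j) (Z k) *\<^sub>C ?W (Z i) (Z j) (Z k))"
  proof -
    have "(\<Sum>i\<in>{1..m}. G (Z i) (bracket h (Z i))) = - (\<Sum>i\<in>{1..m}. G (bracket h (Z i)) (Z i))"
      if "G = (\<lambda>a b. \<Sum>j\<in>{1..m}. \<Sum>k\<in>{1..m}. c a (Z j) (Z k) *\<^sub>C ?W b (Z j) (Z k))" for G
      by (rule contraction_invariant[OF h])
        (auto simp: that linear_on_\<ss>_def c_lin gs scaleC_add_left scaleC_add_right scaleC_scaleC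
          sum.distrib complex_vector.scale_sum_right mult.commute)
    then show ?thesis by simp
  qed
  have 2: "?S (\<lambda>i j k. c (Z i) (Z j) (Z k) *\<^sub>C ?W (Z i) (bracket h (Z j)) (Z k))
      = - ?S (\<lambda>i j k. c (Z i) (bracket h (Z j)) (Z k) *\<^sub>C ?W (Z i) (Z j) (Z k))"
  proof -
    have G: "(\<Sum>j\<in>{1..m}. G (Z j) (bracket h (Z j))) = - (\<Sum>j\<in>{1..m}. G (bracket h (Z j)) (Z j))"
      if "i \<in> {1..m}" "G = (\<lambda>a b. \<Sum>k\<in>{1..m}. c (Z i) a (Z k) *\<^sub>C ?W (Z i) b (Z k))" for G i
      by (rule contraction_invariant[OF h])
        (use Z_in_\<ss>[OF that(1)] in \<open>auto simp: that linear_on_\<ss>_def c_lin gs scaleC_add_left scaleC_add_right scaleC_scaleC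
          sum.distrib complex_vector.scale_sum_right mult.commute\<close>)
    show ?thesis
      by (subst sum_negf[symmetric], rule sum.cong[OF refl], rule G[OF _ refl])
  qed
  have 3: "?S (\<lambda>i j k. c (Z i) (Z j) (Z k) *\<^sub>C ?W (Z i) (Z j) (bracket h (Z k)))
      = - ?S (\<lambda>i j k. c (Z i) (Z j) (bracket h (Z k)) *\<^sub>C ?W (Z i) (Z j) (Z k))"
  proof -
    have G: "(\<Sum>k\<in>{1..m}. G (Z k) (bracket h (Z k))) = - (\<Sum>k\<in>{1..m}. G (bracket h (Z k)) (Z k))"
      if "i \<in> {1..m}" "j \<in> {1..m}" "G = (\<lambda>a b. c (Z i) (Z j) a *\<^sub>C ?W (Z i) (Z j) b)" for G i j
      by (rule contraction_invariant[OF h])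
        (use Z_in_\<ss>[OF that(1)] Z_in_\<ss>[OF that(2)] in \<open>auto simp: that linear_on_\<ss>_def c_lin gs scaleC_add_left scaleC_add_right
          scaleC_scaleC mult.commute\<close>)
    show ?thesis
      by (subst sum_negf[symmetric], rule sum.cong[OF refl], subst sum_negf[symmetric], rule sum.cong[OF refl], rule G[OF _ _ refl])
  qed
  have "?a (T t) = ?S (\<lambda>i j k. c (Z i) (Z j) (Z k) *\<^sub>C ?a (?W (Z i) (Z j) (Z k)))"
    unfolding T_def by (simp add: clinear_sum[OF clinear_spin_action] clinear_scale[OF clinear_spin_action])
  also have "\<dots> = ?S (\<lambda>i j k. c (Z i) (Z j) (Z k) *\<^sub>C \<gamma> (Z i) (\<gamma> (Z j) (\<gamma> (Z k) (?a t)))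
      + (c (Z i) (Z j) (Z k) *\<^sub>C ?W (bracket h (Z i)) (Z j) (Z k)
        + c (Z i) (Z j) (Z k) *\<^sub>C ?W (Z i) (bracket h (Z j)) (Z k)
        + c (Z i) (Z j) (Z k) *\<^sub>C ?W (Z i) (Z j) (bracket h (Z k))))"
  proof (intro sum.cong refl)
    fix i j k assume "i \<in> {1..m}" "j \<in> {1..m}" "k \<in> {1..m}"
    then have z: "Z i \<in> \<ss>" "Z j \<in> \<ss>" "Z k \<in> \<ss>" by (auto intro: Z_in_\<ss>)
    have "?a (?W (Z i) (Z j) (Z k)) = \<gamma> (Z i) (\<gamma> (Z j) (\<gamma> (Z k) (?a t))) + (?W (bracket h (Z i)) (Z j) (Z k)
        + ?W (Z i) (bracket h (Z j)) (Z k) + ?W (Z i) (Z j) (bracket h (Z k)))"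
      unfolding spin_action_derivation[OF h z(1)] spin_action_derivation[OF h z(2)] spin_action_derivation[OF h z(3)]
      by (simp add: clinear_add[OF \<gamma>_clinear[OF z(1)]] clinear_add[OF \<gamma>_clinear[OF z(2)]] algebra_simps)
    then show "c (Z i) (Z j) (Z k) *\<^sub>C ?a (?W (Z i) (Z j) (Z k)) = c (Z i) (Z j) (Z k) *\<^sub>C \<gamma> (Z i) (\<gamma> (Z j) (\<gamma> (Z k) (?a t)))
      + (c (Z i) (Z j) (Z k) *\<^sub>C ?W (bracket h (Z i)) (Z j) (Z k)
        + c (Z i) (Z j) (Z k) *\<^sub>C ?W (Z i) (bracket h (Z j)) (Z k)
        + c (Z i) (Z j) (Z k) *\<^sub>C ?W (Z i) (Z j) (bracket h (Z k)))"
      by (simp only: scaleC_add_right)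
  qed
  also have "\<dots> = T (?a t) - ?S (\<lambda>i j k. (c (bracket h (Z i)) (Z j) (Z k) + c (Z i) (bracket h (Z j)) (Z k)
      + c (Z i) (Z j) (bracket h (Z k))) *\<^sub>C ?W (Z i) (Z j) (Z k))"
    unfolding sum.distrib scaleC_add_left 1 2 3 T_def by simp
  also have "\<dots> = T (?a t)" by (simp add: c_inv)
  finally show ?thesis by (simp add: T clinear_scale[OF clinear_spin_action])
qed

subsection \<open>The top weight of the spin module\<close>

text \<open>
  Products of distinct \<open>Z\<^sub>i\<close> with decreasing indices, applied to \<open>t\<close>. Their span is stable under all
  \<open>Z\<^sub>i\<close>, so it is the whole spin module, which is thereby finite-dimensional.
\<close>

fun clifford_products :: "'s \<Rightarrow> nat \<Rightarrow> 's set"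
  where
    "clifford_products t 0 = {t}"
  | "clifford_products t (Suc j) = clifford_products t j \<union> \<gamma> (Z (Suc j)) ` clifford_products t j"

lemma spin_nonzero: "\<exists>t :: 's. t \<noteq> 0"
  using spin unfolding spin_module_def by blast

lemma clifford_products_stable:
  assumes "j \<le> m" "1 \<le> i" "i \<le> j" "a \<in> clifford_products t j"
  shows "\<gamma> (Z i) a \<in> cspan (clifford_products t j)"
  using assms
proof (induction j arbitrary: a)
  case (Suc j)
  let ?A = "clifford_products t j" let ?z = "Z (Suc j)"
  have zj: "?z \<in> \<ss>" and zi: "Z i \<in> \<ss>" using Suc.prems by (auto intro: Z_in_\<ss>)
  have sub: "cspan ?A \<subseteq> cspan (clifford_products t (Suc j))" by (rule cspan_mono) auto
  have up: "\<gamma> ?z b \<in> cspan (clifford_products t (Suc j))" if "b \<in> cspan ?A" for b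
    by (rule clinear_image_cspan[OF \<gamma>_clinear[OF zj] that]) (auto intro: cspan_base)
  show ?case
  proof (cases "i = Suc j")
    case True
    from Suc.prems(4) consider "a \<in> ?A" | b where "b \<in> ?A" "a = \<gamma> ?z b" by auto
    then show ?thesis
    proof cases
      case 1
      then show ?thesis using True up cspan_base by blast
    next
      case 2
      have "2 *\<^sub>C \<gamma> ?z (\<gamma> ?z b) = (- 2) *\<^sub>C b"
        using \<gamma>_rel[OF zj zj, of b] Z_orthonormal[of "Suc j" "Suc j"] Suc.prems scaleC_add_left[of 1 1 "\<gamma> ?z (\<gamma> ?z b)"]
        by (simp add: scaleC_one eq_diff_eq)
      then have "(1/2) *\<^sub>C 2 *\<^sub>C \<gamma> ?z (\<gamma> ?z b) = (1/2) *\<^sub>C (- 2) *\<^sub>C b" by simp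
      then have "\<gamma> (Z i) a = (- 1) *\<^sub>C b" unfolding scaleC_scaleC 2(2) True by (simp add: scaleC_one)
      moreover have "(- 1) *\<^sub>C b \<in> cspan (clifford_products t (Suc j))"
        by (rule subsetD[OF sub cspan_scale[OF cspan_base[OF 2(1)]]])
      ultimately show ?thesis by simp
    qed
  next
    case False
    then have i: "i \<le> j" using Suc.prems by simp
    have IH: "\<gamma> (Z i) b \<in> cspan ?A" if "b \<in> ?A" for b using Suc.IH[OF _ Suc.prems(2) i that] Suc.prems(1) by simp
    from Suc.prems(4) consider "a \<in> ?A" | b where "b \<in> ?A" "a = \<gamma> ?z b" by auto
    then show ?thesis
    proof cases
      case 1
      then show ?thesis using IH sub by blast
    next
      case 2
      have "\<gamma> (Z i) a = - \<gamma> ?z (\<gamma> (Z i) b)"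
        unfolding 2(2) by (rule \<gamma>_anticommute) (use Suc.prems False in auto)
      then show ?thesis using complex_vector.span_neg[OF up[OF IH[OF 2(1)]]] by simp
    qed
  qed
qed simp

lemma spin_fd: "cfinite_dim (UNIV :: 's set)"
proof -
  obtain t :: 's where t: "t \<noteq> 0" using spin_nonzero by blast
  let ?T = "cspan (clifford_products t m)"
  have fin: "finite (clifford_products t j)" for j by (induction j) auto
  have tA: "t \<in> clifford_products t j" for j by (induction j) auto
  have zT: "\<gamma> (Z i) s \<in> ?T" if "i \<in> {1..m}" "s \<in> ?T" for i s
    by (rule clinear_image_cspan[OF \<gamma>_clinear[OF Z_in_\<ss>[OF that(1)]] that(2)])
      (use that(1) in \<open>auto intro: clifford_products_stable\<close>)
  have "\<gamma> u s \<in> ?T" if "u \<in> \<ss>" "s \<in> ?T" for u s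
    unfolding linear_on_\<ss>_expansion[OF linear_on_\<ss>_\<gamma> that(1)]
    by (intro cspan_sum cspan_scale zT that(2))
  then have "?T = {0} \<or> ?T = UNIV" by (intro spin_simple) auto
  moreover have "t \<in> ?T" by (rule cspan_base[OF tA])
  ultimately have "?T = UNIV" using t by blast
  then show ?thesis unfolding cfinite_dim_def using fin by metis
qed

text \<open>
  The elements of \<open>\<uu>\<close> anticommute and have square zero. So if \<open>e t \<noteq> 0\<close>, then \<open>e t\<close> is killed by \<open>e\<close>
  and by everything in \<open>\<uu>\<close> that kills \<open>t\<close>.
\<close>

lemma nilradical_killed_vector: "\<exists>t. t \<noteq> 0 \<and> (\<forall>u\<in>\<uu>. \<gamma> u t = 0)"
proof -
  have sub: "csubspace \<uu>" by (simp add: nilradical_def)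
  obtain E where E: "finite E" "cspan E = \<uu>"
    using cfinite_dim_basis[OF fd_subspace[OF sub]] by metis
  have "\<exists>t. t \<noteq> 0 \<and> (\<forall>u\<in>F. \<gamma> u t = 0)" if "finite F" "F \<subseteq> \<uu>" for F
    using that
  proof (induction F rule: finite_induct)
    case empty
    show ?case using spin_nonzero by simp
  next
    case (insert e F)
    have "\<exists>t. t \<noteq> 0 \<and> (\<forall>u\<in>F. \<gamma> u t = 0)" using insert.IH insert.prems by simp
    then obtain t where t: "t \<noteq> 0" "\<And>u. u \<in> F \<Longrightarrow> \<gamma> u t = 0" by auto
    have e: "e \<in> \<uu>" "e \<in> \<ss>" using insert.prems nilradical_\<ss> by auto
    show ?case
    proof (cases "\<gamma> e t = 0")
      case True
      then show ?thesis using t by blast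
    next
      case False
      have rel: "\<gamma> u (\<gamma> e t) = - \<gamma> e (\<gamma> u t)" if "u \<in> \<uu>" for u
        using \<gamma>_rel[OF subsetD[OF nilradical_\<ss> that] e(2), of t] nilradical_isotropic[OF that e(1)] by simp
      have "\<gamma> u (\<gamma> e t) = 0" if "u \<in> F" for u
        using rel[of u] t(2)[OF that] that insert.prems clinear_0[OF \<gamma>_clinear[OF e(2)]] by auto
      moreover have "2 *\<^sub>C \<gamma> e (\<gamma> e t) = 0"
        using rel[OF e(1)] scaleC_add_left[of 1 1 "\<gamma> e (\<gamma> e t)"] by (simp add: scaleC_one eq_neg_iff_add_eq_0)
      then have "\<gamma> e (\<gamma> e t) = 0" by simp
      ultimately show ?thesis using False by blast
    qed
  qed
  from this[OF E(1)] complex_vector.span_superset[of E] E(2)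
  have "\<exists>t. t \<noteq> 0 \<and> (\<forall>u\<in>E. \<gamma> u t = 0)" by simp
  then obtain t where t: "t \<noteq> 0" "\<And>u. u \<in> E \<Longrightarrow> \<gamma> u t = 0" by auto
  have "u \<in> \<ss> \<and> \<gamma> u t = 0" if "u \<in> cspan E" for u
    using that
  proof (induction rule: cspan_induct)
    case (base u)
    then show ?case using t(2) nilradical_\<ss> E(2) cspan_base by blast
  next
    case zero
    have "\<gamma> (0 *\<^sub>C 0) t = 0" using \<gamma>_scale[OF csubspace_0[OF csubspace_\<ss>], of 0 t] by simp
    then show ?case using csubspace_0[OF csubspace_\<ss>] by simp
  qed (auto simp: \<gamma>_add \<gamma>_scale csubspace_add[OF csubspace_\<ss>] csubspace_scale[OF csubspace_\<ss>])
  then show ?thesis using t(1) E(2) by blast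
qed

definition spin_lowering :: "(('s \<Rightarrow> 's) \<times> ('g \<Rightarrow> complex)) set"
  where "spin_lowering = {(\<gamma> f, \<beta>) | f \<beta>. \<beta> \<in> radical_roots \<and> f \<in> root_space H (\<lambda>t. - \<beta> t)}"

lemma lowering_spin: "lowering spin_act spin_lowering"
  unfolding lowering_def
proof (clarify, intro conjI allI ballI)
  fix g \<beta> assume "(g, \<beta>) \<in> spin_lowering"
  then obtain f where f: "g = \<gamma> f" "\<beta> \<in> radical_roots" "f \<in> root_space H (\<lambda>t. - \<beta> t)"
    by (auto simp: spin_lowering_def)
  show "\<beta> \<in> Qplus" "\<beta> \<in> funs_on" "\<beta> \<noteq> (\<lambda>t. 0)" using radical_roots_Qplus[OF f(2)] by auto
  fix \<mu> x assume x: "x \<in> weight_space spin_act \<mu>"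
  have fs: "f \<in> \<ss>" using root_space_\<ss>(2)[OF f(2)] f(3) by blast
  show "g x \<in> weight_space spin_act (\<lambda>t. \<mu> t - \<beta> t)"
    unfolding weight_space_def
  proof (clarify)
    fix h assume h: "h \<in> H"
    have "spin_act h (g x) = \<gamma> f (\<mu> h *\<^sub>C x) + \<gamma> ((- \<beta> h) *\<^sub>C f) x"
      unfolding f(1) spin_action_derivation[OF h fs] using weight_spaceD[OF x h] bracket_root_space[OF h f(3)] by simp
    also have "\<dots> = \<mu> h *\<^sub>C g x + (- \<beta> h) *\<^sub>C g x"
      unfolding f(1) \<gamma>_scale[OF fs] clinear_scale[OF \<gamma>_clinear[OF fs]] ..
    finally show "spin_act h (g x) = (\<mu> h - \<beta> h) *\<^sub>C g x"
      by (simp add: complex_vector.scale_left_diff_distrib)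
  qed
qed

text \<open>
  The operators in \<open>H\<close> commute on the space of vectors killed by \<open>\<uu>\<close>; let \<open>s\<close> be a common
  eigenvector there. Moving elements of \<open>\<uu>\<close> to the right shows that every element of \<open>\<ss>\<close> exchanges
  the spans of the vectors obtained from \<open>s\<close> by an even and by an odd number of lowering operators.
  By simplicity the two spans together are everything, and the odd one contains the
  images of \<open>s\<close> under elements of \<open>\<ss>\<close> and under the cubic term. An odd number of lowering operators
  is not zero, so its weights are strictly below that of \<open>s\<close>.
\<close>

lemma spin_top_vector:
  obtains s \<sigma> where "top_vector spin_act \<sigma> s"
    "\<And>u. u \<in> \<ss> \<Longrightarrow> \<gamma> u s \<in> lower_span spin_act \<sigma>"
    "cubic s \<in> lower_span spin_act \<sigma>"
proof -
  let ?a = "spin_act" let ?L = spin_lowering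
  let ?K = "{t. \<forall>u\<in>\<uu>. \<gamma> u t = 0}"
  have \<gamma>n: "clinear (\<gamma> u)" if "u \<in> \<uu>" for u using \<gamma>_clinear that nilradical_\<ss> by blast
  have sK: "csubspace ?K"
    by (rule csubspaceI) (auto simp: clinear_0[OF \<gamma>n] clinear_add[OF \<gamma>n] clinear_scale[OF \<gamma>n])
  have "\<exists>x\<in>?K. x \<noteq> 0 \<and> (\<forall>h\<in>H. \<exists>a. ?a h x = a *\<^sub>C x)"
  proof (rule common_eigenvector)
    show "cfinite_dim ?K" by (rule cfinite_dim_subspace[OF spin_fd sK]) simp
    show "?K \<noteq> {0}" using nilradical_killed_vector by blast
    show "clinear (?a h)" for h by (rule clinear_spin_action)
    show "?a h (?a k x) = ?a k (?a h x)" if "h \<in> H" "k \<in> H" for h k x by (rule spin_action_commute[OF that])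
    show "?a h x \<in> ?K" if h: "h \<in> H" and x: "x \<in> ?K" for h x
    proof (clarify)
      fix u assume u: "u \<in> \<uu>"
      have "?a h (\<gamma> u x) = \<gamma> u (?a h x) + \<gamma> (bracket h u) x"
        by (rule spin_action_derivation[OF h subsetD[OF nilradical_\<ss> u]])
      then show "\<gamma> u (?a h x) = 0"
        using x u bracket_H_nilradical[OF h u] clinear_0[OF clinear_spin_action] by simp
    qed
  qed
  then obtain s where s': "s \<in> ?K" "s \<noteq> 0" "\<forall>h\<in>H. \<exists>a. ?a h s = a *\<^sub>C s" by blast
  obtain b where b: "\<forall>h\<in>H. ?a h s = b h *\<^sub>C s" using bchoice[OF s'(3)] by blast
  have s: "s \<noteq> 0" "\<And>u. u \<in> \<uu> \<Longrightarrow> \<gamma> u s = 0" "\<And>h. h \<in> H \<Longrightarrow> ?a h s = b h *\<^sub>C s"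
    using s' b by auto
  define \<sigma> where "\<sigma> h = (if h \<in> H then b h else 0)" for h
  have \<sigma>: "\<sigma> \<in> funs_on" "s \<in> weight_space ?a \<sigma>" using s(3) by (auto simp: \<sigma>_def funs_on_def weight_space_def)
  define W where "W n = cspan {w. \<exists>\<mu>. lowered ?L s \<sigma> n w \<mu>}" for n
  have sW: "csubspace (W n)" for n by (simp add: W_def)
  have lowW: "g w \<in> W (Suc n)" if gL: "(g, \<beta>) \<in> ?L" and wW: "w \<in> W n" for g \<beta> w n
  proof (rule clinear_image_cspan[OF _ wW[unfolded W_def] _ sW])
    obtain f where f: "g = \<gamma> f" "\<beta> \<in> radical_roots" "f \<in> root_space H (\<lambda>t. - \<beta> t)"
      using gL by (auto simp: spin_lowering_def)
    then show "clinear g" using root_space_\<ss>(2)[OF f(2)] \<gamma>_clinear by blast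
    fix y assume "y \<in> {w. \<exists>\<mu>. lowered ?L s \<sigma> n w \<mu>}"
    then show "g y \<in> W (Suc n)" unfolding W_def using lowered.step gL by (intro cspan_base) blast
  qed
  have raise: "\<gamma> e w \<in> (if n = 0 then {0} else W (n - 1))" if e: "e \<in> \<uu>" and w: "lowered ?L s \<sigma> n w \<mu>"
    for e n w \<mu>
    using w
  proof induction
    case start
    then show ?case using s(2)[OF e] by simp
  next
    case (step n w \<mu> g \<beta>)
    obtain f where f: "g = \<gamma> f" "\<beta> \<in> radical_roots" "f \<in> root_space H (\<lambda>t. - \<beta> t)"
      using step.hyps(2) by (auto simp: spin_lowering_def)
    have fs: "f \<in> \<ss>" using root_space_\<ss>(2)[OF f(2)] f(3) by blast
    have "g (\<gamma> e w) \<in> W n"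
    proof (cases n)
      case 0
      then have "g (\<gamma> e w) = 0" using step.IH clinear_0[OF \<gamma>_clinear[OF fs]] f(1) by simp
      then show ?thesis using csubspace_0[OF sW] by simp
    next
      case (Suc k)
      then show ?thesis using step.IH lowW[OF step.hyps(2), of "\<gamma> e w" k] by simp
    qed
    moreover have "w \<in> W n" unfolding W_def using step.hyps(1) by (intro cspan_base) blast
    moreover have "\<gamma> e (g w) = (- 2 * killing e f) *\<^sub>C w - g (\<gamma> e w)"
      unfolding f(1) by (rule \<gamma>_rel[OF subsetD[OF nilradical_\<ss> e] fs])
    ultimately have "\<gamma> e (g w) \<in> W n" using sW by (simp add: csubspace_diff csubspace_scale del: mult_minus_left)
    then show ?case by simp
  qed
  define P where "P p = cspan (\<Union>n\<in>{n. even n = p}. W n)" for p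
  have sP: "csubspace (P p)" for p by (simp add: P_def)
  have WP: "W n \<subseteq> P (even n)" for n
  proof
    fix w assume "w \<in> W n"
    then show "w \<in> P (even n)" unfolding P_def by (intro cspan_base UN_I[of n]) simp_all
  qed
  have P: "\<gamma> u w \<in> P (\<not> p)" if u: "u \<in> \<ss>" and w: "w \<in> P p" for u w p
  proof -
    have word: "\<gamma> u y \<in> P (odd n)" if y: "lowered ?L s \<sigma> n y \<mu>" for n y \<mu>
    proof -
      obtain e f where ef: "u = e + f" "e \<in> \<uu>" "f \<in> \<uu>'"
        using \<ss>_decompose[OF u] .
      have "\<gamma> e y \<in> P (odd n)"
      proof (cases n)
        case 0
        then show ?thesis using raise[OF ef(2) y] csubspace_0[OF sP] by simp
      next
        case (Suc k)
        then show ?thesis using raise[OF ef(2) y] WP[of k] by auto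
      qed
      moreover have "f \<in> \<ss> \<and> \<gamma> f y \<in> P (odd n)"
        using ef(3) unfolding opposite_nilradical_def
      proof (induction rule: cspan_induct)
        case zero
        have "\<gamma> (0 *\<^sub>C 0) y = 0" using \<gamma>_scale[OF csubspace_0[OF csubspace_\<ss>], of 0 y] by simp
        then show ?case using csubspace_0[OF csubspace_\<ss>] csubspace_0[OF sP] by simp
      next
        case (base x)
        then obtain \<alpha> where \<alpha>: "\<alpha> \<in> radical_roots" "x \<in> root_space H (\<lambda>t. - \<alpha> t)"
          by (auto simp: radical_roots_def)
        then have "(\<gamma> x, \<alpha>) \<in> ?L" by (auto simp: spin_lowering_def)
        moreover have "y \<in> W n" unfolding W_def using y by (intro cspan_base) blast
        ultimately have "\<gamma> x y \<in> W (Suc n)" by (rule lowW)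
        then show ?case using WP[of "Suc n"] root_space_\<ss>(2)[OF \<alpha>(1)] \<alpha>(2) by auto
      qed (auto simp: \<gamma>_add \<gamma>_scale csubspace_add[OF csubspace_\<ss>] csubspace_scale[OF csubspace_\<ss>]
          csubspace_add[OF sP] csubspace_scale[OF sP])
      ultimately show ?thesis
        using \<gamma>_add[OF subsetD[OF nilradical_\<ss> ef(2)] subsetD[OF opposite_\<ss> ef(3)]] ef(1) csubspace_add[OF sP] by simp
    qed
    have "\<gamma> u y \<in> P (odd n)" if "y \<in> W n" for y n
      by (rule clinear_image_cspan[OF \<gamma>_clinear[OF u] that[unfolded W_def] _ sP]) (use word in blast)
    then show ?thesis
      using clinear_image_cspan[OF \<gamma>_clinear[OF u] w[unfolded P_def] _ sP, of "\<not> p"] by auto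
  qed
  have s0: "s \<in> P True"
  proof -
    have "s \<in> W 0" unfolding W_def using lowered.start by (intro cspan_base) blast
    then show ?thesis using WP[of 0] by auto
  qed
  let ?T = "cspan (P True \<union> P False)"
  have "?T = {0} \<or> ?T = UNIV"
  proof (rule spin_simple)
    fix u w assume u: "u \<in> \<ss>" and w: "w \<in> ?T"
    show "\<gamma> u w \<in> ?T"
    proof (rule clinear_image_cspan[OF \<gamma>_clinear[OF u] w _ csubspace_cspan])
      fix y assume "y \<in> P True \<union> P False"
      then have "\<gamma> u y \<in> P True \<union> P False" using P[OF u, of y True] P[OF u, of y False] by auto
      then show "\<gamma> u y \<in> ?T" by (rule cspan_base)
    qed
  qed (rule csubspace_cspan)
  then have T: "?T = UNIV" using s0 s(1) cspan_base[of s "P True \<union> P False"] by blast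
  have PL: "P p \<subseteq> lowered_span ?L s \<sigma>" for p
    unfolding P_def by (intro cspan_minimal UN_least csubspace_lowered_span, unfold W_def, intro cspan_minimal csubspace_lowered_span)
      (auto intro: lowered_in_span)
  have "?T \<subseteq> lowered_span ?L s \<sigma>" by (rule cspan_minimal[OF _ csubspace_lowered_span]) (use PL in blast)
  then have L: "lowered_span ?L s \<sigma> = UNIV" using T by blast
  have top: "top_vector ?a \<sigma> s"
    using lowered_span_below[OF lowering_spin \<sigma>(2)] L \<sigma> s(1) by (auto simp: top_vector_def)
  have odd: "P False \<subseteq> lower_span ?a \<sigma>"
    unfolding P_def
  proof (intro cspan_minimal UN_least csubspace_cspan)
    fix n :: nat assume n: "n \<in> {n. even n = False}"
    have n0: "n > 0" using n by (auto intro: Nat.gr0I)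
    show "W n \<subseteq> lower_span ?a \<sigma>"
      unfolding W_def
    proof (rule cspan_mono, clarify)
      fix w \<mu> assume "lowered ?L s \<sigma> n w \<mu>"
      from lowered_weight[OF lowering_spin \<sigma>(2) this] n0
      show "w \<in> (\<Union>\<mu>\<in>below \<sigma> - {\<sigma>}. weight_space ?a \<mu>)" by blast
    qed
  qed
  have u1: "\<gamma> u s \<in> P False" if "u \<in> \<ss>" for u using P[OF that s0] by simp
  have "cubic s \<in> P False"
    unfolding cubic_term_def
  proof (intro csubspace_scale[OF sP] csubspace_sum[OF sP], clarify)
    fix i j k assume "1 \<le> i" "i < j" "j < k" "k \<le> m"
    then have z: "Z i \<in> \<ss>" "Z j \<in> \<ss>" "Z k \<in> \<ss>" by (auto intro!: Z_in_\<ss>)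
    show "killing (bracket (Z i) (Z j)) (Z k) *\<^sub>C \<gamma> (Z i) (\<gamma> (Z j) (\<gamma> (Z k) s)) \<in> P False"
      using P[OF z(1) P[OF z(2) u1[OF z(3)]]] by (intro csubspace_scale[OF sP]) simp
  qed
  then show ?thesis using that[OF top] u1 odd by blast
qed

end

subsection \<open>Tensor products\<close>

lemma clinear_tensor_left: "clinear (\<lambda>x. x \<otimes>\<^sub>C y)"
  by (rule clinearI) (simp_all add: tensor_pure_add_left tensor_pure_scale_left)

lemma clinear_tensor_right: "clinear (\<lambda>y. x \<otimes>\<^sub>C y)"
  by (rule clinearI) (simp_all add: tensor_pure_add_right tensor_pure_scale_right)

lemma tensor_span:
  assumes "x \<in> cspan A" "y \<in> cspan B" "csubspace T" "\<And>a b. a \<in> A \<Longrightarrow> b \<in> B \<Longrightarrow> a \<otimes>\<^sub>C b \<in> T"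
  shows "x \<otimes>\<^sub>C y \<in> T"
proof -
  have "a \<otimes>\<^sub>C y \<in> T" if "a \<in> A" for a
    by (rule clinear_image_cspan[OF clinear_tensor_right assms(2) assms(4)[OF that] assms(3)])
  then show ?thesis by (rule clinear_image_cspan[OF clinear_tensor_left assms(1) _ assms(3)])
qed

lemma tensor_subspace_UNIV:
  assumes "csubspace T" "\<And>x y. x \<otimes>\<^sub>C y \<in> T"
  shows "T = UNIV"
proof -
  have "t \<in> T" for t
    by (induction t rule: tensor_induct)
      (use assms in \<open>auto simp: csubspace_0 csubspace_add csubspace_scale\<close>)
  then show ?thesis by blast
qed

text \<open>
  A linear functional that is \<open>1\<close> at \<open>v\<close> gives a linear map \<open>V \<otimes> S \<rightarrow> S\<close> with \<open>v \<otimes> s \<mapsto> s\<close>.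
\<close>

lemma tensor_pure_nonzero:
  fixes v :: "'v::complex_vector" and s :: "'s::complex_vector"
  assumes "v \<noteq> 0" "s \<noteq> 0" shows "v \<otimes>\<^sub>C s \<noteq> 0"
proof
  assume 0: "v \<otimes>\<^sub>C s = 0"
  have "\<not> cdependent {v}" using assms(1) by simp
  then obtain E where E: "{v} \<subseteq> E" "\<not> cdependent E" "UNIV \<subseteq> cspan E"
    using complex_vector.maximal_independent_subset_extend[of "{v}" UNIV] by auto
  define b where "b x y = crepresentation E x v *\<^sub>C y" for x and y :: 's
  have inE: "x \<in> cspan E" for x using E(3) by blast
  have "\<exists>!h. clinear h \<and> (\<forall>x y. h (x \<otimes>\<^sub>C y) = b x y)"
    by (rule tensor_universal; rule clinearI)
      (simp_all add: b_def complex_vector.representation_add[OF E(2) inE inE]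
        complex_vector.representation_scale[OF E(2) inE] scaleC_add_left scaleC_add_right scaleC_scaleC mult.commute)
  then obtain h where h: "clinear h" "\<And>x y. h (x \<otimes>\<^sub>C y) = b x y" by blast
  have "b v s = 0" using h(2)[of v s] clinear_0[OF h(1)] 0 by simp
  moreover have "crepresentation E v v = 1"
    using E(1) by (simp add: complex_vector.representation_basis[OF E(2)])
  ultimately show False using assms(2) by (simp add: b_def)
qed

section \<open>Weights of Dirac cohomology\<close>

text \<open>
  The operations of \<^const>\<open>quotient_module\<close> map the coset of \<open>x\<close> to the coset of the image of \<open>x\<close>.
\<close>

lemma image_coset:
  assumes T: "clinear T" and N': "csubspace N'" and "csubspace N" "\<And>x. x \<in> N \<Longrightarrow> T x \<in> N'"
  shows "T ` (x +o N) + N' = T x +o N'"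
proof (intro equalityI subsetI)
  fix y assume "y \<in> T ` (x +o N) + N'"
  then obtain n n' where "n \<in> N" "n' \<in> N'" "y = T (x + n) + n'" by (auto simp: set_plus_def elt_set_plus_def)
  then show "y \<in> T x +o N'"
    using assms(4) csubspace_add[OF N'] by (auto simp: elt_set_plus_def clinear_add[OF T] add.assoc)
next
  fix y assume "y \<in> T x +o N'"
  then obtain n' where n': "n' \<in> N'" "y = T x + n'" by (auto simp: elt_set_plus_def)
  have "x \<in> x +o N" using csubspace_0[OF assms(3)] by (auto simp: elt_set_plus_def intro!: bexI[of _ 0])
  then show "y \<in> T ` (x +o N) + N'" using n' by (auto intro!: set_plus_intro)
qed

lemma coset_eq_iff:
  assumes N: "csubspace N" shows "x +o N = y +o N \<longleftrightarrow> x - y \<in> N"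
proof
  assume "x +o N = y +o N"
  moreover have "x \<in> x +o N" using csubspace_0[OF N] by (auto simp: elt_set_plus_def intro!: bexI[of _ 0])
  ultimately show "x - y \<in> N" by (auto simp: elt_set_plus_def)
next
  have *: "a +o N \<subseteq> b +o N" if "a - b \<in> N" for a b
  proof
    fix z assume "z \<in> a +o N"
    then obtain n where n: "n \<in> N" "z = a + n" by (auto simp: elt_set_plus_def)
    have "b + ((a - b) + n) \<in> b +o N" by (rule set_plus_intro2[OF csubspace_add[OF N that n(1)]])
    then show "z \<in> b +o N" by (simp add: n(2))
  qed
  assume "x - y \<in> N"
  moreover have "y - x \<in> N" using csubspace_neg[OF N \<open>x - y \<in> N\<close>] by simp
  ultimately show "x +o N = y +o N" using * by blast
qed

text \<open>
  Being different from \<open>0 \<cdot> C\<close> is being nonzero, expressed through the operations that isomorphisms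
  preserve.
\<close>

definition has_weight :: "'g set \<Rightarrow> ('g, 'm) module_structure \<Rightarrow> ('g \<Rightarrow> complex) \<Rightarrow> bool"
  where "has_weight H M \<chi> \<longleftrightarrow> (\<exists>C\<in>mod_carrier M. C \<noteq> mod_scale M 0 C \<and>
    (\<forall>h\<in>H. mod_act M h C = mod_scale M (\<chi> h) C))"

lemma has_weight_iso:
  assumes iso: "module_iso A M N" and HA: "H \<subseteq> A"
    and scale: "\<And>c C. C \<in> mod_carrier M \<Longrightarrow> mod_scale M c C \<in> mod_carrier M"
    and act: "\<And>h C. h \<in> H \<Longrightarrow> C \<in> mod_carrier M \<Longrightarrow> mod_act M h C \<in> mod_carrier M"
  shows "has_weight H M \<chi> \<longleftrightarrow> has_weight H N \<chi>"
proof -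
  obtain f where f: "bij_betw f (mod_carrier M) (mod_carrier N)"
    "\<And>c x. x \<in> mod_carrier M \<Longrightarrow> f (mod_scale M c x) = mod_scale N c (f x)"
    "\<And>h x. h \<in> H \<Longrightarrow> x \<in> mod_carrier M \<Longrightarrow> f (mod_act M h x) = mod_act N h (f x)"
    using iso HA unfolding module_iso_def by blast
  have inj: "f x = f y \<longleftrightarrow> x = y" if "x \<in> mod_carrier M" "y \<in> mod_carrier M" for x y
    using f(1) that by (auto simp: bij_betw_def inj_on_def)
  have "(C \<noteq> mod_scale M 0 C \<and> (\<forall>h\<in>H. mod_act M h C = mod_scale M (\<chi> h) C))
      \<longleftrightarrow> (f C \<noteq> mod_scale N 0 (f C) \<and> (\<forall>h\<in>H. mod_act N h (f C) = mod_scale N (\<chi> h) (f C)))"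
    if C: "C \<in> mod_carrier M" for C
    using inj[OF C scale[OF C, of 0]] inj[OF act[OF _ C] scale[OF C]] f(2)[OF C] f(3)[OF _ C] by simp
  moreover have "mod_carrier N = f ` mod_carrier M" using f(1) by (simp add: bij_betw_def)
  ultimately show ?thesis unfolding has_weight_def by simp
qed

lemma quotient_module_closed:
  assumes "\<And>h. h \<in> H \<Longrightarrow> clinear (\<tau> h)" "csubspace K" "csubspace N"
    and "\<And>h x. h \<in> H \<Longrightarrow> x \<in> K \<Longrightarrow> \<tau> h x \<in> K" "\<And>h x. h \<in> H \<Longrightarrow> x \<in> N \<Longrightarrow> \<tau> h x \<in> N"
  shows "C \<in> mod_carrier (quotient_module \<tau> K N) \<Longrightarrow> mod_scale (quotient_module \<tau> K N) c C \<in> mod_carrier (quotient_module \<tau> K N)"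
    and "h \<in> H \<Longrightarrow> C \<in> mod_carrier (quotient_module \<tau> K N) \<Longrightarrow> mod_act (quotient_module \<tau> K N) h C \<in> mod_carrier (quotient_module \<tau> K N)"
proof -
  have sc: "clinear (scaleC c :: 'b \<Rightarrow> 'b)" for c using clinear_scaled[OF clinear_id(2)] .
  assume "C \<in> mod_carrier (quotient_module \<tau> K N)"
  then obtain x where x: "x \<in> K" "C = x +o N" by (auto simp: quotient_module_def)
  show "mod_scale (quotient_module \<tau> K N) c C \<in> mod_carrier (quotient_module \<tau> K N)"
    using csubspace_scale[OF assms(2) x(1)] csubspace_scale[OF assms(3)]
    by (simp add: quotient_module_def x(2) image_coset[OF sc assms(3,3)])
  assume h: "h \<in> H"
  show "mod_act (quotient_module \<tau> K N) h C \<in> mod_carrier (quotient_module \<tau> K N)"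
    using assms(4)[OF h x(1)] by (simp add: quotient_module_def x(2) image_coset[OF assms(1)[OF h] assms(3,3) assms(5)[OF h]])
qed

lemma has_weight_quotient:
  assumes "\<And>h. h \<in> H \<Longrightarrow> clinear (\<tau> h)" "csubspace N" "\<And>h x. h \<in> H \<Longrightarrow> x \<in> N \<Longrightarrow> \<tau> h x \<in> N"
  shows "has_weight H (quotient_module \<tau> K N) \<chi> \<longleftrightarrow>
    (\<exists>x\<in>K. x \<notin> N \<and> (\<forall>h\<in>H. \<tau> h x - \<chi> h *\<^sub>C x \<in> N))"
proof -
  have sc: "clinear (scaleC c :: 'b \<Rightarrow> 'b)" for c using clinear_scaled[OF clinear_id(2)] .
  have scale: "scaleC c ` (x +o N) + N = c *\<^sub>C x +o N" for c x
    by (rule image_coset[OF sc assms(2,2)]) (rule csubspace_scale[OF assms(2)])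
  have act: "\<tau> h ` (x +o N) + N = \<tau> h x +o N" if "h \<in> H" for h x
    by (rule image_coset[OF assms(1)[OF that] assms(2,2)]) (rule assms(3)[OF that])
  have "(\<forall>h\<in>H. \<tau> h ` (x +o N) + N = \<chi> h *\<^sub>C x +o N) \<longleftrightarrow> (\<forall>h\<in>H. \<tau> h x - \<chi> h *\<^sub>C x \<in> N)" for x
    by (rule ball_cong[OF refl]) (simp add: act coset_eq_iff[OF assms(2)])
  then have "(x +o N \<noteq> scaleC 0 ` (x +o N) + N \<and> (\<forall>h\<in>H. \<tau> h ` (x +o N) + N = scaleC (\<chi> h) ` (x +o N) + N))
    \<longleftrightarrow> (x \<notin> N \<and> (\<forall>h\<in>H. \<tau> h x - \<chi> h *\<^sub>C x \<in> N))" for x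
    unfolding scale using coset_eq_iff[OF assms(2), of x 0] by simp
  then show ?thesis by (simp add: has_weight_def quotient_module_def)
qed

context levi_spin
begin

lemma in_weight_span: "\<kappa> \<in> S \<Longrightarrow> x \<in> weight_space \<tau> \<kappa> \<Longrightarrow> x \<in> cspan (\<Union>\<mu>\<in>S. weight_space \<tau> \<mu>)"
  by (rule cspan_base) blast

lemma below_add_strict:
  assumes "\<mu> \<in> below \<nu>" "\<mu>' \<in> below \<sigma>" "\<mu> \<noteq> \<nu> \<or> \<mu>' \<noteq> \<sigma>"
  shows "(\<lambda>t. \<mu> t + \<mu>' t) \<in> below (\<lambda>t. \<nu> t + \<sigma> t) - {\<lambda>t. \<nu> t + \<sigma> t}"
proof -
  obtain q where q: "q \<in> Qplus" "q \<in> funs_on" "\<And>t. \<mu> t = \<nu> t - q t" using belowE[OF assms(1)] by metis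
  obtain r where r: "r \<in> Qplus" "r \<in> funs_on" "\<And>t. \<mu>' t = \<sigma> t - r t" using belowE[OF assms(2)] by metis
  have "(\<lambda>t. \<mu> t + \<mu>' t) \<noteq> (\<lambda>t. \<nu> t + \<sigma> t)"
  proof
    assume *: "(\<lambda>t. \<mu> t + \<mu>' t) = (\<lambda>t. \<nu> t + \<sigma> t)"
    have qr: "q t + r t = 0" for t using fun_cong[OF *, of t] q(3)[of t] r(3)[of t] by algebra
    then have q0: "q = (\<lambda>t. 0)" by (rule Qplus_sum_zero[OF q(1) r(1)])
    then have "r t = 0" for t using qr[of t] by simp
    then have "\<mu> = \<nu>" "\<mu>' = \<sigma>" using q(3) r(3) q0 by auto
    then show False using assms(3) by blast
  qed
  then show ?thesis using below_add[OF assms(1,2)] by blast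
qed

lemma diagonal_action_pure:
  assumes "lie_module \<rho>"
  shows "diag \<rho> X (x \<otimes>\<^sub>C y) = \<rho> X x \<otimes>\<^sub>C y + x \<otimes>\<^sub>C spin_act X y"
  by (simp add: diagonal_action_def tensor_map_pure lie_moduleD(1)[OF assms] clinear_spin_action)

lemma clinear_diagonal_action:
  assumes "lie_module \<rho>" shows "clinear (diag \<rho> X)"
  unfolding diagonal_action_def
  by (intro clinear_plus clinear_tensor_map lie_moduleD(1)[OF assms] clinear_spin_action clinear_id)

lemma dirac_operator_pure:
  assumes "lie_module \<rho>"
  shows "dirac \<rho> (x \<otimes>\<^sub>C y) =
    (\<Sum>i\<in>{1..m}. \<rho> (Z i) x \<otimes>\<^sub>C \<gamma> (Z i) y) + x \<otimes>\<^sub>C cubic y"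
proof -
  have "tensor_map (\<rho> (Z i)) (\<gamma> (Z i)) (x \<otimes>\<^sub>C y) = \<rho> (Z i) x \<otimes>\<^sub>C \<gamma> (Z i) y" if "i \<in> {1..m}" for i
    by (rule tensor_map_pure[OF lie_moduleD(1)[OF assms] \<gamma>_clinear[OF Z_in_\<ss>[OF that]]])
  then show ?thesis by (simp add: dirac_operator_def tensor_map_pure clinear_cubic_term)
qed

lemma clinear_dirac_operator:
  assumes "lie_module \<rho>" shows "clinear (dirac \<rho>)"
proof -
  have "clinear (\<lambda>t. \<Sum>i = 1..m. tensor_map (\<rho> (Z i)) (\<gamma> (Z i)) t)"
    by (rule clinear_sums) (rule clinear_tensor_map[OF lie_moduleD(1)[OF assms] \<gamma>_clinear[OF Z_in_\<ss>]])
  then show ?thesis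
    unfolding dirac_operator_def by (rule clinear_plus[OF _ clinear_tensor_map[OF clinear_id(1) clinear_cubic_term]])
qed

lemma dirac_operator_invariant:
  assumes \<rho>: "lie_module \<rho>" and h: "h \<in> H"
  shows "diag \<rho> h (dirac \<rho> t) = dirac \<rho> (diag \<rho> h t)"
proof -
  let ?\<tau> = "diag \<rho> h" and ?D = "dirac \<rho>"
  note lin = lie_moduleD[OF \<rho>] note l\<tau> = clinear_diagonal_action[OF \<rho>, of h] and lD = clinear_dirac_operator[OF \<rho>]
  note tl = tensor_pure_add_left tensor_pure_add_right tensor_pure_scale_left tensor_pure_scale_right
  have "?\<tau> (?D (x \<otimes>\<^sub>C y)) = ?D (?\<tau> (x \<otimes>\<^sub>C y))" for x y
  proof -
    let ?a = "spin_act h"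
    have c: "(\<Sum>i\<in>{1..m}. \<rho> (Z i) x \<otimes>\<^sub>C \<gamma> (bracket h (Z i)) y) = - (\<Sum>i\<in>{1..m}. \<rho> (bracket h (Z i)) x \<otimes>\<^sub>C \<gamma> (Z i) y)"
      by (rule contraction_invariant[OF h, of "\<lambda>a b. \<rho> a x \<otimes>\<^sub>C \<gamma> b y"])
        (auto simp: linear_on_\<ss>_def clinear_add[OF lin(2)] clinear_scale[OF lin(2)] \<gamma>_add \<gamma>_scale tl)
    have "?\<tau> (\<rho> (Z i) x \<otimes>\<^sub>C \<gamma> (Z i) y) = (\<rho> (Z i) (\<rho> h x) \<otimes>\<^sub>C \<gamma> (Z i) y + \<rho> (Z i) x \<otimes>\<^sub>C \<gamma> (Z i) (?a y))
        + (\<rho> (bracket h (Z i)) x \<otimes>\<^sub>C \<gamma> (Z i) y + \<rho> (Z i) x \<otimes>\<^sub>C \<gamma> (bracket h (Z i)) y)" if "i \<in> {1..m}" for i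
    proof -
      have "\<rho> h (\<rho> (Z i) x) = \<rho> (Z i) (\<rho> h x) + \<rho> (bracket h (Z i)) x" using lin(3)[of h "Z i" x] by simp
      then show ?thesis
        unfolding diagonal_action_pure[OF \<rho>] spin_action_derivation[OF h Z_in_\<ss>[OF that]] by (simp add: tl)
    qed
    then have "?\<tau> (?D (x \<otimes>\<^sub>C y)) = (\<Sum>i\<in>{1..m}. (\<rho> (Z i) (\<rho> h x) \<otimes>\<^sub>C \<gamma> (Z i) y + \<rho> (Z i) x \<otimes>\<^sub>C \<gamma> (Z i) (?a y))
        + (\<rho> (bracket h (Z i)) x \<otimes>\<^sub>C \<gamma> (Z i) y + \<rho> (Z i) x \<otimes>\<^sub>C \<gamma> (bracket h (Z i)) y))
        + ?\<tau> (x \<otimes>\<^sub>C cubic y)"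
      unfolding dirac_operator_pure[OF \<rho>] clinear_add[OF l\<tau>] clinear_sum[OF l\<tau>] by simp
    also have "\<dots> = (\<Sum>i\<in>{1..m}. \<rho> (Z i) (\<rho> h x) \<otimes>\<^sub>C \<gamma> (Z i) y) + (\<Sum>i\<in>{1..m}. \<rho> (Z i) x \<otimes>\<^sub>C \<gamma> (Z i) (?a y))
        + (\<rho> h x \<otimes>\<^sub>C cubic y + x \<otimes>\<^sub>C cubic (?a y))"
      unfolding sum.distrib c diagonal_action_pure[OF \<rho>] cubic_term_commute[OF h] by simp
    also have "\<dots> = ?D (?\<tau> (x \<otimes>\<^sub>C y))"
      unfolding diagonal_action_pure[OF \<rho>] clinear_add[OF lD] dirac_operator_pure[OF \<rho>] by (simp add: algebra_simps)
    finally show ?thesis .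
  qed
  then have "(\<lambda>t. ?\<tau> (?D t)) = (\<lambda>t. ?D (?\<tau> t))"
    by (intro tensor_clinear_eqI clinear_compose[OF l\<tau> lD] clinear_compose[OF lD l\<tau>])
  then show ?thesis by (rule fun_cong)
qed

lemma tensor_weight_space:
  assumes "lie_module \<rho>" "x \<in> weight_space \<rho> \<mu>" "y \<in> weight_space spin_act \<mu>'"
  shows "x \<otimes>\<^sub>C y \<in> weight_space (diag \<rho>) (\<lambda>t. \<mu> t + \<mu>' t)"
  using assms(2,3)
  by (simp add: weight_space_def diagonal_action_pure[OF assms(1)] tensor_pure_scale_left
      tensor_pure_scale_right scaleC_add_left)

lemma tensor_lower:
  assumes \<rho>: "lie_module \<rho>" and top: "top_vector \<rho> \<nu> v"
    and y: "y \<in> lower_span spin_act \<sigma>"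
  shows "x \<otimes>\<^sub>C y \<in> lower_span (diag \<rho>) (\<lambda>t. \<nu> t + \<sigma> t)"
proof (rule tensor_span[OF _ y csubspace_cspan])
  show "x \<in> cspan (\<Union>\<mu>\<in>below \<nu>. weight_space \<rho> \<mu>)" using top_vector_span_weights[OF top] by simp
  fix a b assume "a \<in> (\<Union>\<mu>\<in>below \<nu>. weight_space \<rho> \<mu>)" "b \<in> (\<Union>\<mu>\<in>below \<sigma> - {\<sigma>}. weight_space spin_act \<mu>)"
  then obtain \<mu> \<mu>' where ab: "\<mu> \<in> below \<nu>" "a \<in> weight_space \<rho> \<mu>" "\<mu>' \<in> below \<sigma>" "\<mu>' \<noteq> \<sigma>"
    "b \<in> weight_space spin_act \<mu>'" by blast
  show "a \<otimes>\<^sub>C b \<in> lower_span (diag \<rho>) (\<lambda>t. \<nu> t + \<sigma> t)"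
    by (rule in_weight_span[OF below_add_strict[OF ab(1,3) disjI2[OF ab(4)]] tensor_weight_space[OF \<rho> ab(2,5)]])
qed

lemma tensor_top_vector:
  assumes \<rho>: "lie_module \<rho>" and v: "top_vector \<rho> \<nu> v" and s: "top_vector spin_act \<sigma> s"
  shows "top_vector (diag \<rho>) (\<lambda>t. \<nu> t + \<sigma> t) (v \<otimes>\<^sub>C s)"
proof -
  let ?\<tau> = "diag \<rho>" and ?\<kappa> = "\<lambda>t. \<nu> t + \<sigma> t"
  let ?U = "\<Union>\<mu>\<in>below ?\<kappa> - {?\<kappa>}. weight_space ?\<tau> \<mu>"
  have v': "\<nu> \<in> funs_on" "v \<noteq> 0" "v \<in> weight_space \<rho> \<nu>" "cspan (insert v (\<Union>\<mu>\<in>below \<nu> - {\<nu>}. weight_space \<rho> \<mu>)) = UNIV"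
    using v by (auto simp: top_vector_def)
  have s': "\<sigma> \<in> funs_on" "s \<noteq> 0" "s \<in> weight_space spin_act \<sigma>"
    "cspan (insert s (\<Union>\<mu>\<in>below \<sigma> - {\<sigma>}. weight_space spin_act \<mu>)) = UNIV"
    using s by (auto simp: top_vector_def)
  have "x \<otimes>\<^sub>C y \<in> cspan (insert (v \<otimes>\<^sub>C s) ?U)" for x y
  proof (rule tensor_span[OF _ _ csubspace_cspan])
    show "x \<in> cspan (insert v (\<Union>\<mu>\<in>below \<nu> - {\<nu>}. weight_space \<rho> \<mu>))" using v'(4) by simp
    show "y \<in> cspan (insert s (\<Union>\<mu>\<in>below \<sigma> - {\<sigma>}. weight_space spin_act \<mu>))" using s'(4) by simp
    fix a b assume a: "a \<in> insert v (\<Union>\<mu>\<in>below \<nu> - {\<nu>}. weight_space \<rho> \<mu>)"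
      and b: "b \<in> insert s (\<Union>\<mu>\<in>below \<sigma> - {\<sigma>}. weight_space spin_act \<mu>)"
    obtain \<mu> where \<mu>: "\<mu> \<in> below \<nu>" "a \<in> weight_space \<rho> \<mu>" "a = v \<or> \<mu> \<noteq> \<nu>"
      using a v'(3) below_refl by blast
    obtain \<mu>' where \<mu>': "\<mu>' \<in> below \<sigma>" "b \<in> weight_space spin_act \<mu>'" "b = s \<or> \<mu>' \<noteq> \<sigma>"
      using b s'(3) below_refl by blast
    show "a \<otimes>\<^sub>C b \<in> cspan (insert (v \<otimes>\<^sub>C s) ?U)"
    proof (cases "a = v \<and> b = s")
      case True
      then show ?thesis by (intro cspan_base) simp
    next
      case False
      then have "\<mu> \<noteq> \<nu> \<or> \<mu>' \<noteq> \<sigma>" using \<mu>(3) \<mu>'(3) by blast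
      from in_weight_span[OF below_add_strict[OF \<mu>(1) \<mu>'(1) this] tensor_weight_space[OF \<rho> \<mu>(2) \<mu>'(2)]]
      show ?thesis by (rule subsetD[OF cspan_mono[OF subset_insertI]])
    qed
  qed
  then have "cspan (insert (v \<otimes>\<^sub>C s) ?U) = UNIV" by (intro tensor_subspace_UNIV csubspace_cspan)
  then show ?thesis
    using funs_on_add[OF v'(1) s'(1)] tensor_pure_nonzero[OF v'(2) s'(2)] tensor_weight_space[OF \<rho> v'(3) s'(3)]
    by (simp add: top_vector_def)
qed

abbreviation dirac_kernel :: "('g \<Rightarrow> 'v \<Rightarrow> 'v::complex_vector) \<Rightarrow> ('v, 's) tensor set"
  where "dirac_kernel \<rho> \<equiv> {t. dirac \<rho> t = 0}"

abbreviation dirac_boundaries :: "('g \<Rightarrow> 'v \<Rightarrow> 'v::complex_vector) \<Rightarrow> ('v, 's) tensor set"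
  where "dirac_boundaries \<rho> \<equiv> dirac_kernel \<rho> \<inter> range (dirac \<rho>)"

lemma dirac_cohomology_quotient:
  "cohomology \<rho> = quotient_module (diag \<rho>) (dirac_kernel \<rho>) (dirac_boundaries \<rho>)"
  by (simp add: dirac_cohomology_def Let_def)

lemma dirac_spaces:
  assumes \<rho>: "lie_module \<rho>"
  shows "csubspace (dirac_kernel \<rho>)" "csubspace (dirac_boundaries \<rho>)"
    and "h \<in> H \<Longrightarrow> x \<in> dirac_kernel \<rho> \<Longrightarrow> diag \<rho> h x \<in> dirac_kernel \<rho>"
    and "h \<in> H \<Longrightarrow> x \<in> dirac_boundaries \<rho> \<Longrightarrow> diag \<rho> h x \<in> dirac_boundaries \<rho>"
proof -
  let ?D = "dirac \<rho>"
  note lD = clinear_dirac_operator[OF \<rho>] and inv = dirac_operator_invariant[OF \<rho>]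
  show k: "csubspace (dirac_kernel \<rho>)" by (rule csubspace_kernel[OF lD])
  have "csubspace (range ?D)" by (rule csubspace_image[OF lD complex_vector.subspace_UNIV])
  then show "csubspace (dirac_boundaries \<rho>)" by (rule csubspace_Int[OF k])
  show k': "diag \<rho> h x \<in> dirac_kernel \<rho>" if "h \<in> H" "x \<in> dirac_kernel \<rho>" for h x
    using inv[OF that(1), of x] that(2) clinear_0[OF clinear_diagonal_action[OF \<rho>]] by simp
  show "diag \<rho> h x \<in> dirac_boundaries \<rho>"
    if h: "h \<in> H" and x: "x \<in> dirac_boundaries \<rho>" for h x
  proof -
    obtain t where "x = ?D t" using x by blast
    then have "diag \<rho> h x \<in> range ?D" using inv[OF h, of t] by simp
    moreover have "diag \<rho> h x \<in> dirac_kernel \<rho>" by (rule k'[OF h]) (use x in simp)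
    ultimately show ?thesis by simp
  qed
qed

lemma dirac_cohomology_closed:
  assumes \<rho>: "lie_module \<rho>" and C: "C \<in> mod_carrier (cohomology \<rho>)"
  shows "mod_scale (cohomology \<rho>) c C \<in> mod_carrier (cohomology \<rho>)"
    and "h \<in> H \<Longrightarrow> mod_act (cohomology \<rho>) h C \<in> mod_carrier (cohomology \<rho>)"
  using quotient_module_closed[where H = H and \<tau> = "diag \<rho>", OF clinear_diagonal_action[OF \<rho>]
      dirac_spaces(1,2)[OF \<rho>] dirac_spaces(3)[OF \<rho>] dirac_spaces(4)[OF \<rho>]] C
  unfolding dirac_cohomology_quotient by simp_all

lemma dirac_cohomology_weight_iff:
  assumes \<rho>: "lie_module \<rho>"
  shows "has_weight H (cohomology \<rho>) \<chi> \<longleftrightarrow> (\<exists>x\<in>dirac_kernel \<rho>. x \<notin> dirac_boundaries \<rho> \<and>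
    (\<forall>h\<in>H. diag \<rho> h x - \<chi> h *\<^sub>C x \<in> dirac_boundaries \<rho>))"
  unfolding dirac_cohomology_quotient
  by (rule has_weight_quotient[OF clinear_diagonal_action[OF \<rho>] dirac_spaces(2)[OF \<rho>] dirac_spaces(4)[OF \<rho>]])

text \<open>
  The class of \<open>v \<otimes> s\<close>: applying \<open>D\<close> gives something of weight \<open>\<nu> + \<sigma>\<close> that is a sum of vectors of
  lower weights, hence zero. The same comparison of weights excludes \<open>v \<otimes> s = D t\<close>.
\<close>

lemma dirac_cohomology_top_weight:
  assumes \<rho>: "lie_module \<rho>" and v: "top_vector \<rho> \<nu> v" and s: "top_vector spin_act \<sigma> s"
    and low: "\<And>u. u \<in> \<ss> \<Longrightarrow> \<gamma> u s \<in> lower_span spin_act \<sigma>"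
    "cubic s \<in> lower_span spin_act \<sigma>"
  shows "has_weight H (cohomology \<rho>) (\<lambda>t. \<nu> t + \<sigma> t)"
proof -
  let ?\<tau> = "diag \<rho>" and ?D = "dirac \<rho>" and ?\<kappa> = "\<lambda>t. \<nu> t + \<sigma> t"
  let ?U = "lower_span ?\<tau> ?\<kappa>"
  note lD = clinear_dirac_operator[OF \<rho>]
  have top: "?\<kappa> \<in> funs_on" "v \<otimes>\<^sub>C s \<noteq> 0" "v \<otimes>\<^sub>C s \<in> weight_space ?\<tau> ?\<kappa>"
    "cspan (insert (v \<otimes>\<^sub>C s) (\<Union>\<mu>\<in>below ?\<kappa> - {?\<kappa>}. weight_space ?\<tau> \<mu>)) = UNIV"
    using tensor_top_vector[OF \<rho> v s] by (auto simp: top_vector_def)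
  have Dw: "?D t \<in> weight_space ?\<tau> \<mu>" if "t \<in> weight_space ?\<tau> \<mu>" for t \<mu>
    using dirac_operator_invariant[OF \<rho>] that by (simp add: weight_space_def clinear_scale[OF lD])
  have disj: "x = 0" if "x \<in> ?U" "x \<in> weight_space ?\<tau> ?\<kappa>" for x
  proof (rule weight_spaces_disjoint[OF clinear_diagonal_action[OF \<rho>] _ that top(1)])
    show "below ?\<kappa> - {?\<kappa>} \<subseteq> funs_on" using below_funs_on top(1) by blast
  qed simp
  have "?D (v \<otimes>\<^sub>C s) \<in> ?U"
    unfolding dirac_operator_pure[OF \<rho>]
    by (intro cspan_add cspan_sum tensor_lower[OF \<rho> v] low Z_in_\<ss>)
  then have D0: "?D (v \<otimes>\<^sub>C s) = 0" using disj Dw[OF top(3)] by blast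
  have "v \<otimes>\<^sub>C s \<noteq> ?D t" for t
  proof
    assume t: "v \<otimes>\<^sub>C s = ?D t"
    have "t \<in> cspan (insert (v \<otimes>\<^sub>C s) (\<Union>\<mu>\<in>below ?\<kappa> - {?\<kappa>}. weight_space ?\<tau> \<mu>))" using top(4) by simp
    then have "?D t \<in> ?U"
    proof (rule clinear_image_cspan[OF lD _ _ csubspace_cspan])
      fix y assume "y \<in> insert (v \<otimes>\<^sub>C s) (\<Union>\<mu>\<in>below ?\<kappa> - {?\<kappa>}. weight_space ?\<tau> \<mu>)"
      then consider "y = v \<otimes>\<^sub>C s" | \<mu> where "\<mu> \<in> below ?\<kappa> - {?\<kappa>}" "y \<in> weight_space ?\<tau> \<mu>" by blast
      then show "?D y \<in> ?U"
      proof cases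
        case 1
        then show ?thesis using D0 cspan_0 by simp
      next
        case (2 \<mu>)
        show ?thesis by (rule in_weight_span[OF 2(1) Dw[OF 2(2)]])
      qed
    qed
    then have "v \<otimes>\<^sub>C s = 0" using disj top(3) t by simp
    then show False using top(2) by simp
  qed
  then have "v \<otimes>\<^sub>C s \<notin> dirac_boundaries \<rho>" by blast
  moreover have "?\<tau> h (v \<otimes>\<^sub>C s) - ?\<kappa> h *\<^sub>C (v \<otimes>\<^sub>C s) \<in> dirac_boundaries \<rho>" if "h \<in> H" for h
    using weight_spaceD[OF top(3) that] csubspace_0[OF dirac_spaces(2)[OF \<rho>]] by simp
  ultimately show ?thesis unfolding dirac_cohomology_weight_iff[OF \<rho>] using D0 by blast
qed

text \<open>
  For a representative \<open>x\<close> of a weight vector, the components \<open>y \<mu>\<close> of \<open>x\<close> satisfy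
  \<open>(\<mu> h - \<chi> h) y \<mu> \<in> N\<close>, where \<open>N\<close> is the space of boundaries in the kernel. If \<open>\<chi>\<close> is not a weight of
  \<open>V \<otimes> S\<close>, then all components are in \<open>N\<close>, and so is \<open>x\<close>.
\<close>

lemma dirac_cohomology_weights_below:
  assumes \<rho>: "lie_module \<rho>" and top: "top_vector (diag \<rho>) \<kappa> w"
    and \<chi>: "\<chi> \<in> funs_on" "has_weight H (cohomology \<rho>) \<chi>"
  shows "\<chi> \<in> below \<kappa>"
proof (rule ccontr)
  assume n: "\<chi> \<notin> below \<kappa>"
  let ?\<tau> = "diag \<rho>" let ?N = "dirac_boundaries \<rho>"
  note lin = clinear_diagonal_action[OF \<rho>] note N = dirac_spaces(2)[OF \<rho>]
  obtain x where x: "x \<notin> ?N" "\<And>h. h \<in> H \<Longrightarrow> ?\<tau> h x - \<chi> h *\<^sub>C x \<in> ?N"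
    using \<chi>(2) unfolding dirac_cohomology_weight_iff[OF \<rho>] by blast
  have xs: "x \<in> cspan (\<Union>\<mu>\<in>below \<kappa>. weight_space ?\<tau> \<mu>)" using top_vector_span_weights[OF top] by simp
  obtain F y where F: "finite F" "F \<subseteq> below \<kappa>" "\<And>\<mu>. \<mu> \<in> F \<Longrightarrow> y \<mu> \<in> weight_space ?\<tau> \<mu>" "x = (\<Sum>\<mu>\<in>F. y \<mu>)"
    by (rule cspan_Union_decompose[OF xs]) (auto intro: csubspace_weight_space lin)
  have Ff: "F \<subseteq> funs_on" using F(2) below_funs_on top unfolding top_vector_def by blast
  have "y \<mu> \<in> ?N" if \<mu>: "\<mu> \<in> F" for \<mu>
  proof -
    have "\<mu> \<noteq> \<chi>" using \<mu> F(2) n by blast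
    then obtain h where h: "h \<in> H" "\<mu> h \<noteq> \<chi> h" using funs_on_distinct[OF _ \<chi>(1), of \<mu>] Ff \<mu> by blast
    have "(\<Sum>\<mu>\<in>F. (\<mu> h - \<chi> h) *\<^sub>C y \<mu>) = ?\<tau> h x - \<chi> h *\<^sub>C x"
      unfolding F(4) clinear_sum[OF lin] complex_vector.scale_sum_right sum_subtractf[symmetric]
      by (rule sum.cong[OF refl]) (simp add: weight_spaceD[OF F(3) h(1)] complex_vector.scale_left_diff_distrib)
    then have sN: "(\<Sum>\<mu>\<in>F. (\<mu> h - \<chi> h) *\<^sub>C y \<mu>) \<in> ?N" using x(2)[OF h(1)] by simp
    have "(\<mu> h - \<chi> h) *\<^sub>C y \<mu> \<in> ?N"
    proof (rule weight_spaces_independent[where \<tau> = ?\<tau> and F = F and x = "\<lambda>\<mu>. (\<mu> h - \<chi> h) *\<^sub>C y \<mu>"])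
      show "(\<mu> h - \<chi> h) *\<^sub>C y \<mu> \<in> weight_space ?\<tau> \<mu>" if "\<mu> \<in> F" for \<mu>
        by (rule csubspace_scale[OF csubspace_weight_space[OF lin] F(3)[OF that]])
    qed (rule lin F(1) Ff N sN \<mu> dirac_spaces(4)[OF \<rho>]; assumption)+
    from csubspace_scale[OF N this, of "1 / (\<mu> h - \<chi> h)"] show ?thesis
      using h(2) by (simp add: scaleC_scaleC scaleC_one)
  qed
  then have "x \<in> ?N" unfolding F(4) by (rule csubspace_sum[OF N])
  then show False using x(1) by blast
qed

section \<open>Functoriality of Dirac cohomology\<close>

lemma dirac_cohomology_iso:
  fixes \<rho> :: "'g \<Rightarrow> 'v::complex_vector \<Rightarrow> 'v" and \<rho>' :: "'g \<Rightarrow> 'w::complex_vector \<Rightarrow> 'w"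
  assumes \<rho>: "lie_module \<rho>" and \<rho>': "lie_module \<rho>'"
    and iso: "module_iso UNIV (full_module \<rho>) (full_module \<rho>')"
  shows "module_iso A (cohomology \<rho>) (cohomology \<rho>')"
proof -
  obtain f where f: "bij f" "\<And>x y. f (x + y) = f x + f y" "\<And>c x. f (c *\<^sub>C x) = c *\<^sub>C f x"
    "\<And>X x. f (\<rho> X x) = \<rho>' X (f x)"
    using iso unfolding module_iso_def full_module_def by auto
  have lf: "clinear f" by (rule clinearI[OF f(2,3)])
  have inv_f: "f (inv f y) = y" "inv f (f x) = x" for x y
    using f(1) by (simp_all add: bij_def surj_f_inv_f)
  have li: "clinear (inv f)"
    by (rule clinearI) (metis inv_f f(2), metis inv_f f(3))
  define F where "F = (tensor_map f id :: ('v, 's) tensor \<Rightarrow> ('w, 's) tensor)"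
  define G where "G = (tensor_map (inv f) id :: ('w, 's) tensor \<Rightarrow> ('v, 's) tensor)"
  have lF: "clinear F" and lG: "clinear G" unfolding F_def G_def
    by (rule clinear_tensor_map[OF lf clinear_id(1)], rule clinear_tensor_map[OF li clinear_id(1)])
  have Fp: "F (x \<otimes>\<^sub>C y) = f x \<otimes>\<^sub>C y" and Gp: "G (x' \<otimes>\<^sub>C y) = inv f x' \<otimes>\<^sub>C y" for x x' y
    by (simp_all add: F_def G_def tensor_map_pure[OF lf clinear_id(1)] tensor_map_pure[OF li clinear_id(1)])
  have "(\<lambda>t. F (G t)) = (\<lambda>t. t)" "(\<lambda>t. G (F t)) = (\<lambda>t. t)"
    by (rule tensor_clinear_eqI[OF clinear_compose[OF lF lG] clinear_id(2)], simp add: Fp Gp inv_f,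
        rule tensor_clinear_eqI[OF clinear_compose[OF lG lF] clinear_id(2)], simp add: Fp Gp inv_f)
  then have FG: "F (G t) = t" and GF: "G (F u) = u" for t u by meson+
  have bijF: "bij F" using FG GF by (intro bijI') metis+
  let ?D = "dirac \<rho>" and ?D' = "dirac \<rho>'"
  let ?\<tau> = "diag \<rho>" and ?\<tau>' = "diag \<rho>'"
  have "(\<lambda>t. F (?D t)) = (\<lambda>t. ?D' (F t))"
    by (rule tensor_clinear_eqI[OF clinear_compose[OF lF clinear_dirac_operator[OF \<rho>]] clinear_compose[OF clinear_dirac_operator[OF \<rho>'] lF]])
      (simp add: dirac_operator_pure[OF \<rho>] dirac_operator_pure[OF \<rho>'] Fp clinear_add[OF lF] clinear_sum[OF lF] f(4))
  then have FD: "F (?D t) = ?D' (F t)" for t by meson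
  have "(\<lambda>t. F (?\<tau> X t)) = (\<lambda>t. ?\<tau>' X (F t))" for X
    by (rule tensor_clinear_eqI[OF clinear_compose[OF lF clinear_diagonal_action[OF \<rho>]] clinear_compose[OF clinear_diagonal_action[OF \<rho>'] lF]])
      (simp add: diagonal_action_pure[OF \<rho>] diagonal_action_pure[OF \<rho>'] Fp clinear_add[OF lF] f(4))
  then have F\<tau>: "F (?\<tau> X t) = ?\<tau>' X (F t)" for X t by meson
  have F0: "F t = 0 \<longleftrightarrow> t = 0" for t using GF clinear_0[OF lF] clinear_0[OF lG] by metis
  have K: "F ` dirac_kernel \<rho> = dirac_kernel \<rho>'"
  proof (intro equalityI subsetI)
    fix t assume "t \<in> dirac_kernel \<rho>'"
    then have "F (?D (G t)) = 0" by (simp add: FD FG)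
    then have "G t \<in> dirac_kernel \<rho>" by (simp add: F0)
    then show "t \<in> F ` dirac_kernel \<rho>" using FG by (metis image_eqI)
  qed (use FD clinear_0[OF lF] in \<open>auto simp: FD[symmetric]\<close>)
  have R: "F ` range ?D = range ?D'"
  proof (intro equalityI subsetI)
    fix t assume "t \<in> range ?D'"
    then obtain u where "t = ?D' u" by blast
    then have "t = F (?D (G u))" by (simp add: FD FG)
    then show "t \<in> F ` range ?D" by blast
  qed (auto simp: FD)
  have N: "F ` dirac_boundaries \<rho> = dirac_boundaries \<rho>'"
    using K R image_Int[OF bij_is_inj[OF bijF], of "dirac_kernel \<rho>" "range ?D"] by simp
  have Fplus: "F ` (C + C') = F ` C + F ` C'" for C C'
  proof (intro equalityI subsetI)
    fix z assume "z \<in> F ` (C + C')"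
    then obtain a b where "a \<in> C" "b \<in> C'" "z = F (a + b)" by (auto simp: set_plus_def)
    then show "z \<in> F ` C + F ` C'" by (auto simp: clinear_add[OF lF] intro!: set_plus_intro)
  next
    fix z assume "z \<in> F ` C + F ` C'"
    then obtain a b where "a \<in> C" "b \<in> C'" "z = F (a + b)" by (auto simp: set_plus_def clinear_add[OF lF])
    then show "z \<in> F ` (C + C')" by (auto intro!: set_plus_intro imageI)
  qed
  have Fcoset: "F ` (x +o C) = F x +o F ` C" for x C
  proof (intro equalityI subsetI)
    fix z assume "z \<in> F ` (x +o C)"
    then obtain c where "c \<in> C" "z = F (x + c)" by (auto simp: elt_set_plus_def)
    then show "z \<in> F x +o F ` C" by (auto simp: clinear_add[OF lF] intro!: set_plus_intro2)
  next
    fix z assume "z \<in> F x +o F ` C"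
    then obtain c where "c \<in> C" "z = F (x + c)" by (auto simp: elt_set_plus_def clinear_add[OF lF])
    then show "z \<in> F ` (x +o C)" by (auto intro!: set_plus_intro2 imageI)
  qed
  have "bij_betw (image F) ((\<lambda>x. x +o dirac_boundaries \<rho>) ` dirac_kernel \<rho>)
      ((\<lambda>x. x +o dirac_boundaries \<rho>') ` dirac_kernel \<rho>')"
  proof (rule bij_betw_imageI)
    show "inj_on (image F) ((\<lambda>x. x +o dirac_boundaries \<rho>) ` dirac_kernel \<rho>)"
      by (rule inj_onI) (simp only: inj_image_eq_iff[OF bij_is_inj[OF bijF]])
    have "image F ` (\<lambda>x. x +o dirac_boundaries \<rho>) ` dirac_kernel \<rho> = (\<lambda>x. x +o F ` dirac_boundaries \<rho>) ` F ` dirac_kernel \<rho>"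
      by (simp only: image_image Fcoset)
    then show "image F ` (\<lambda>x. x +o dirac_boundaries \<rho>) ` dirac_kernel \<rho> = (\<lambda>x. x +o dirac_boundaries \<rho>') ` dirac_kernel \<rho>'"
      unfolding N K .
  qed
  moreover have "F ` (scaleC c ` C + dirac_boundaries \<rho>) = scaleC c ` F ` C + dirac_boundaries \<rho>'" for c C
    unfolding Fplus N by (simp only: image_image clinear_scale[OF lF])
  moreover have "F ` (?\<tau> X ` C + dirac_boundaries \<rho>) = ?\<tau>' X ` F ` C + dirac_boundaries \<rho>'" for X C
    unfolding Fplus N by (simp only: image_image F\<tau>)
  ultimately show ?thesis
    unfolding module_iso_def dirac_cohomology_quotient quotient_module_def
    by (intro exI[of _ "image F"]) (simp only: module_structure.simps Fplus simp_thms ball_triv refl ball_simps)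
qed

end

section \<open>Simple modules are determined by their Dirac cohomology\<close>

theorem theorem3:
  fixes H :: "'g::lie_algebra set"
    and \<Delta> I :: "('g \<Rightarrow> complex) set"
    and m :: nat and Z :: "nat \<Rightarrow> 'g"
    and \<gamma> :: "'g \<Rightarrow> 's::complex_vector \<Rightarrow> 's"
    and \<rho> :: "'g \<Rightarrow> 'v::complex_vector \<Rightarrow> 'v"
    and \<rho>' :: "'g \<Rightarrow> 'w::complex_vector \<Rightarrow> 'w"
  assumes "cfinite_dim (UNIV :: 'g set)"
    and "semisimple TYPE('g)"
    and "cartan_subalgebra H"
    and "simple_system H \<Delta>"
    and "I \<subseteq> \<Delta>"
    and "orthonormal_basis (levi_complement H \<Delta> I) m Z"
    and "spin_module (levi_complement H \<Delta> I) \<gamma>"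
    and "in_category_O H \<Delta> I \<rho>" and "simple_module \<rho>"
    and "in_category_O H \<Delta> I \<rho>'" and "simple_module \<rho>'"
  shows "module_iso UNIV (full_module \<rho>) (full_module \<rho>') \<longleftrightarrow>
    module_iso (levi H I) (dirac_cohomology m Z \<gamma> \<rho>) (dirac_cohomology m Z \<gamma> \<rho>')"
proof -
  interpret levi_spin H \<Delta> I m Z \<gamma>
    by unfold_locales (rule assms)+
  have \<rho>: "lie_module \<rho>" and \<rho>': "lie_module \<rho>'" using assms(8,10) by (simp_all add: in_category_O_def)
  show ?thesis
  proof
    assume "module_iso UNIV (full_module \<rho>) (full_module \<rho>')"
    then show "module_iso (levi H I) (dirac_cohomology m Z \<gamma> \<rho>) (dirac_cohomology m Z \<gamma> \<rho>')"
      by (rule dirac_cohomology_iso[OF \<rho> \<rho>'])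
  next
    assume iso: "module_iso (levi H I) (dirac_cohomology m Z \<gamma> \<rho>) (dirac_cohomology m Z \<gamma> \<rho>')"
    obtain \<nu> v where v: "highest_weight_vector \<rho> \<nu> v"
      using highest_weight_vector_exists[OF assms(8,9)] by blast
    obtain \<nu>' v' where v': "highest_weight_vector \<rho>' \<nu>' v'"
      using highest_weight_vector_exists[OF assms(10,11)] by blast
    note top = top_vector_highest_weight[OF \<rho> assms(9) v] and top' = top_vector_highest_weight[OF \<rho>' assms(11) v']
    obtain s \<sigma> where s: "top_vector (spin_action m Z \<gamma>) \<sigma> s"
      "\<And>u. u \<in> \<ss> \<Longrightarrow> \<gamma> u s \<in> lower_span (spin_action m Z \<gamma>) \<sigma>"
      "cubic_term m Z \<gamma> s \<in> lower_span (spin_action m Z \<gamma>) \<sigma>"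
      using spin_top_vector by metis
    note tt = tensor_top_vector[OF \<rho> top s(1)] and tt' = tensor_top_vector[OF \<rho>' top' s(1)]
    have Hl: "H \<subseteq> levi H I" unfolding levi_def by (auto intro: cspan_base)
    have eq: "has_weight H (dirac_cohomology m Z \<gamma> \<rho>) \<chi> \<longleftrightarrow> has_weight H (dirac_cohomology m Z \<gamma> \<rho>') \<chi>" for \<chi>
      by (rule has_weight_iso[OF iso Hl dirac_cohomology_closed[OF \<rho>]])
    have "(\<lambda>t. \<nu> t + \<sigma> t) \<in> below (\<lambda>t. \<nu>' t + \<sigma> t)"
      using dirac_cohomology_weights_below[OF \<rho>' tt'] dirac_cohomology_top_weight[OF \<rho> top s] eq tt
      by (simp add: top_vector_def)
    then have 1: "\<nu> \<in> below \<nu>'" by (rule below_cancel)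
    have "(\<lambda>t. \<nu>' t + \<sigma> t) \<in> below (\<lambda>t. \<nu> t + \<sigma> t)"
      using dirac_cohomology_weights_below[OF \<rho> tt] dirac_cohomology_top_weight[OF \<rho>' top' s] eq tt'
      by (simp add: top_vector_def)
    then have "\<nu>' \<in> below \<nu>" by (rule below_cancel)
    with 1 have "\<nu> = \<nu>'" by (rule below_antisym)
    then show "module_iso UNIV (full_module \<rho>) (full_module \<rho>')"
      using simple_highest_weight_iso[OF \<rho> assms(9) v \<rho>' assms(11)] v' by simp
  qed
qed

end
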